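(* Let $W$ and $W'$ be non-trivial complementary subspaces of $\mathbb{C}^n$, i.e. $W\oplus W'=\mathbb{C}^n$, and put $r=\dim W$. Let $\{h\}$ and $\{h'\}$ be equivalence classes of hermitian metrics on $W$ and $W'$, respectively, and let $g\in SL(n,\mathbb{C})$ be an element such that $ge_1,\dots,ge_r$ is an orthonormal basis of $\alpha h$ and $ge_{r+1},\dots,ge_n$ is an orthonormal basis of $\alpha'h'$ for some representatives $\alpha h$ of $\{h\}$ and $\alpha'h'$ of $\{h'\}$ ($\alpha,\alpha'>0$). Then $$t\longmapsto g\,\exp\bigl(t\;\mathrm{diag}(\underbrace{\rho,\dots,\rho}_{r},\sigma,\dots,\sigma)\bigr)u,\qquad \rho=\sqrt{\frac{n-r}{4rn^2}},\quad\sigma=-\frac{r}{n-r}\rho,$$ is a geodesic connecting $W$ and $W'$. In fact, this association defines a bijection between the set of pairs $(\{h\},\{h'\})$ of metric classes on $W$ and $W'$ and the set of geodesics (up to reparametrization) connecting $W$ and $W'$.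
   Context: $n\ge2$, $G=SL(n,\mathbb{C})$, $K=SU(n)$, $Z=G/K$, $u\in Z$ the class of $1$; $e_1,\dots,e_n$ is the standard basis of $\mathbb{C}^n$. Let $\mathfrak p\subset\mathfrak{sl}(n,\mathbb{C})$ be the space of trace-zero hermitian matrices, identified with $T_uZ$ via the projection $G\to Z$. $Z$ carries the $G$-invariant Riemannian metric which on $T_uZ\simeq\mathfrak p$ is given by the Killing form $(X,Y)\mapsto4n\,\mathrm{Re}\,\mathrm{Tr}(XY)$. A ray is a unit speed half-geodesic $\mathbb{R}_{\ge0}\to Z$; two rays are asymptotic if their distance is bounded; $Z(\infty)$ is the set of asymptoty classes of rays, on which $G$ acts. For a subspace $0\ne W\subsetneq\mathbb{C}^n$, $z_W\in Z(\infty)$ is the unique point whose stabilizer in $G$ is the stabilizer of $W$. A geodesic connects $W$ and $W'$ if its two ends (after normalizing to unit speed) define the points $z_W$ and $z_{W'}$ of $Z(\infty)$. A hermitian metric is a positive definite hermitian form; two hermitian metrics are equivalent if they differ by a positive real factor. *)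

theory Defs
  imports "HOL-Analysis.Analysis"
begin

text \<open>
  Throughout, \<open>n = CARD('n)\<close> where \<open>'n\<close> is a finite linearly ordered index type.  The order is
  needed only to list the standard basis as \<open>e\<^sub>1, \<dots>, e\<^sub>n\<close>; \<open>pos i\<close> is the 0-based position of \<open>i\<close>,
  so \<open>axis i 1\<close> is the basis vector number \<open>pos i + 1\<close>.
\<close>

definition pos :: "'n::{finite,linorder} \<Rightarrow> nat" where
  "pos i = card {j. j < i}"

type_synonym 'n cvec = "complex^'n"
type_synonym 'n cmat = "complex^'n^'n"


subsection \<open>The groups and the symmetric space\<close>

definition ctranspose :: "'n::finite cmat \<Rightarrow> 'n cmat" where
  "ctranspose A = (\<chi> i j. cnj (A $ j $ i))"

definition SL :: "'n::finite cmat set" where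
  "SL = {g. det g = 1}"

definition SU :: "'n::finite cmat set" where
  "SU = {k \<in> SL. k ** ctranspose k = mat 1}"

text \<open>Points of \<open>Z = G/K\<close> are left cosets \<open>gK\<close>.\<close>

type_synonym 'n point = "'n cmat set"

definition act :: "'n::finite cmat \<Rightarrow> 'n point \<Rightarrow> 'n point" where
  "act g x = (\<lambda>a. g ** a) ` x"

definition base :: "'n::finite point" where
  "base = SU"

definition Z :: "'n::finite point set" where
  "Z = (\<lambda>g. act g base) ` SL"


subsection \<open>Matrix exponential\<close>

definition mpow :: "'n::finite cmat \<Rightarrow> nat \<Rightarrow> 'n cmat" where
  "mpow A k = (((**) A) ^^ k) (mat 1)"

definition mexp :: "'n::finite cmat \<Rightarrow> 'n cmat" where
  "mexp A = (\<Sum>k. mpow A k /\<^sub>R fact k)"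


subsection \<open>The Riemannian distance\<close>

definition killing :: "'n::finite cmat \<Rightarrow> 'n cmat \<Rightarrow> real" where
  "killing X Y = 4 * real CARD('n) * Re (trace (X ** Y))"

text \<open>
  The differential at \<open>1\<close> of \<open>G \<rightarrow> Z\<close> has kernel \<open>su(n)\<close>, the skew-hermitian matrices; under the
  identification of the tangent space at the base point with the trace-zero hermitian matrices it is
  the projection of \<open>sl(n,\<complex>)\<close> onto its hermitian part.
\<close>

definition to_p :: "'n::finite cmat \<Rightarrow> 'n cmat" where
  "to_p X = (1/2) *\<^sub>R (X + ctranspose X)"

text \<open>
  If \<open>c\<close> is a curve in \<open>G\<close>, then left translation by \<open>(c t)\<^sup>-\<^sup>1\<close> carries the velocity at time \<open>t\<close> of the
  projected curve \<open>t \<mapsto> c(t)u\<close> in \<open>Z\<close> to the tangent vector \<open>to_p ((c t)\<^sup>-\<^sup>1 c'(t))\<close> at \<open>u\<close>.  So the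
  next two definitions give speed and length of the projected curve for the \<open>G\<close>-invariant metric.
  Every piecewise \<open>C\<^sup>1\<close> curve in \<open>Z\<close> is the projection of such a curve, since \<open>G \<rightarrow> Z\<close> is a
  principal bundle.
\<close>

definition speed :: "(real \<Rightarrow> 'n::finite cmat) \<Rightarrow> real \<Rightarrow> real" where
  "speed c t =
     (let X = to_p (matrix_inv (c t) ** vector_derivative c (at t)) in sqrt (killing X X))"

definition curve_length :: "(real \<Rightarrow> 'n::finite cmat) \<Rightarrow> real" where
  "curve_length c = integral {0..1} (speed c)"

text \<open>
  \<open>c piecewise_C1_differentiable_on {0..1}\<close> allows \<open>c'\<close> to be unbounded near the finitely many break
  points, in which case the curve may have infinite length and \<open>integral\<close> would return \<open>0\<close>; hence the
  integrability condition.  It holds automatically when \<open>c'\<close> has one-sided limits at these points.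
\<close>

definition distZ :: "'n::finite point \<Rightarrow> 'n point \<Rightarrow> real" where
  "distZ x y = Inf {curve_length c | c.
     c piecewise_C1_differentiable_on {0..1} \<and> speed c integrable_on {0..1} \<and>
     c ` {0..1} \<subseteq> SL \<and>
     act (c 0) base = x \<and> act (c 1) base = y}"


subsection \<open>Geodesics, rays and the boundary at infinity\<close>

text \<open>
  A geodesic of speed \<open>v\<close> on an interval \<open>I\<close> is a curve of constant speed \<open>v\<close> that locally realizes
  the Riemannian distance.
\<close>

definition geodesic_on :: "real set \<Rightarrow> real \<Rightarrow> (real \<Rightarrow> 'n::finite point) \<Rightarrow> bool" where
  "geodesic_on I v \<gamma> \<longleftrightarrow> \<gamma> ` I \<subseteq> Z \<and>
     (\<forall>t\<in>I. \<exists>\<epsilon>>0. \<forall>s\<in>I. \<forall>s'\<in>I. \<bar>s - t\<bar> < \<epsilon> \<longrightarrow> \<bar>s' - t\<bar> < \<epsilon> \<longrightarrow>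
        distZ (\<gamma> s) (\<gamma> s') = v * \<bar>s - s'\<bar>)"

definition geodesic :: "(real \<Rightarrow> 'n::finite point) \<Rightarrow> bool" where
  "geodesic \<gamma> \<longleftrightarrow> (\<exists>v>0. geodesic_on UNIV v \<gamma>)"

text \<open>
  A ray is represented by a function on all of \<open>\<real>\<close> with arbitrary values at negative arguments.
  Asymptoty only sees arguments \<open>t \<ge> 0\<close>, so these values do not affect the set of classes.
\<close>

definition ray :: "(real \<Rightarrow> 'n::finite point) \<Rightarrow> bool" where
  "ray \<gamma> \<longleftrightarrow> geodesic_on {0..} 1 \<gamma>"

definition asymptotic :: "((real \<Rightarrow> 'n::finite point) \<times> (real \<Rightarrow> 'n point)) set" where
  "asymptotic = {(\<gamma>, \<delta>). ray \<gamma> \<and> ray \<delta> \<and> (\<exists>C. \<forall>t\<ge>0. distZ (\<gamma> t) (\<delta> t) \<le> C)}"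

type_synonym 'n infpoint = "(real \<Rightarrow> 'n point) set"

definition Zinf :: "'n::finite infpoint set" where
  "Zinf = Collect ray // asymptotic"

definition act_inf :: "'n::finite cmat \<Rightarrow> 'n infpoint \<Rightarrow> 'n infpoint" where
  "act_inf g \<xi> = (\<lambda>\<gamma>. act g \<circ> \<gamma>) ` \<xi>"

definition stab_inf :: "'n::finite infpoint \<Rightarrow> 'n cmat set" where
  "stab_inf \<xi> = {g \<in> SL. act_inf g \<xi> = \<xi>}"

definition stab_space :: "'n::finite cvec set \<Rightarrow> 'n cmat set" where
  "stab_space W = {g \<in> SL. (\<lambda>x. g *v x) ` W = W}"

definition z_of :: "'n::finite cvec set \<Rightarrow> 'n infpoint" where
  "z_of W = (THE \<xi>. \<xi> \<in> Zinf \<and> stab_inf \<xi> = stab_space W)"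

text \<open>The point at infinity defined by a ray.\<close>

definition endpoint :: "(real \<Rightarrow> 'n::finite point) \<Rightarrow> 'n infpoint" where
  "endpoint \<gamma> = asymptotic `` {\<gamma>}"

text \<open>
  Being connected by a geodesic does not depend on its orientation; accordingly geodesics are taken
  up to affine, possibly orientation-reversing, reparametrization (no other reparametrization
  preserves constant speed).
\<close>

definition connects ::
    "'n::finite cvec set \<Rightarrow> 'n cvec set \<Rightarrow> (real \<Rightarrow> 'n point) \<Rightarrow> bool" where
  "connects W W' \<gamma> \<longleftrightarrow> (\<exists>v>0. geodesic_on UNIV v \<gamma> \<and>
     (let p = endpoint (\<lambda>t. \<gamma> (t / v)); m = endpoint (\<lambda>t. \<gamma> (- t / v))
      in (p = z_of W \<and> m = z_of W') \<or> (p = z_of W' \<and> m = z_of W)))"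

definition reparam :: "((real \<Rightarrow> 'n::finite point) \<times> (real \<Rightarrow> 'n point)) set" where
  "reparam = {(\<gamma>, \<delta>). geodesic \<gamma> \<and> geodesic \<delta> \<and>
     (\<exists>a b. a \<noteq> 0 \<and> \<delta> = (\<lambda>t. \<gamma> (a * t + b)))}"

definition connecting_classes ::
    "'n::finite cvec set \<Rightarrow> 'n cvec set \<Rightarrow> (real \<Rightarrow> 'n point) set set" where
  "connecting_classes W W' = Collect (connects W W') // reparam"


subsection \<open>Hermitian metrics on subspaces\<close>

type_synonym 'n form = "'n cvec \<Rightarrow> 'n cvec \<Rightarrow> complex"

text \<open>
  A form on \<open>W\<close> is represented by a function whose values outside \<open>W \<times> W\<close> are arbitrary and are
  ignored by the equivalence relation.  Positivity is stated for the real part; the imaginary part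
  of \<open>h x x\<close> vanishes by hermitian symmetry.
\<close>

definition herm_metric :: "'n::finite cvec set \<Rightarrow> 'n form \<Rightarrow> bool" where
  "herm_metric W h \<longleftrightarrow>
     (\<forall>x\<in>W. \<forall>y\<in>W. \<forall>z\<in>W. \<forall>a b. h (a *s x + b *s y) z = a * h x z + b * h y z) \<and>
     (\<forall>x\<in>W. \<forall>y\<in>W. h y x = cnj (h x y)) \<and>
     (\<forall>x\<in>W. x \<noteq> 0 \<longrightarrow> Re (h x x) > 0)"

definition metric_equiv :: "'n::finite cvec set \<Rightarrow> ('n form \<times> 'n form) set" where
  "metric_equiv W = {(h, k). herm_metric W h \<and> herm_metric W k \<and>
     (\<exists>\<alpha>>0. \<forall>x\<in>W. \<forall>y\<in>W. k x y = complex_of_real \<alpha> * h x y)}"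

definition metric_class :: "'n::finite cvec set \<Rightarrow> 'n form \<Rightarrow> 'n form set" where
  "metric_class W h = metric_equiv W `` {h}"

definition metric_classes :: "'n::finite cvec set \<Rightarrow> 'n form set set" where
  "metric_classes W = Collect (herm_metric W) // metric_equiv W"

definition orthonormal_basis ::
    "'n::finite cvec set \<Rightarrow> 'n form \<Rightarrow> 'i set \<Rightarrow> ('i \<Rightarrow> 'n cvec) \<Rightarrow> bool" where
  "orthonormal_basis W h I v \<longleftrightarrow>
     (\<forall>i\<in>I. v i \<in> W) \<and> vec.span (v ` I) = W \<and>
     (\<forall>i\<in>I. \<forall>j\<in>I. h (v i) (v j) = (if i = j then 1 else 0))"

text \<open>
  \<open>ge\<^sub>1, \<dots>, ge\<^sub>r\<close> is an orthonormal basis of a representative of the class \<open>H\<close> on \<open>W\<close>, and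
  \<open>ge\<^sub>r\<^sub>+\<^sub>1, \<dots>, ge\<^sub>n\<close> is one of a representative of the class \<open>H'\<close> on \<open>W'\<close>.
\<close>

definition adapted :: "'n::{finite,linorder} cvec set \<Rightarrow> 'n cvec set \<Rightarrow> nat \<Rightarrow>
    'n form set \<Rightarrow> 'n form set \<Rightarrow> 'n cmat \<Rightarrow> bool" where
  "adapted W W' r H H' g \<longleftrightarrow> g \<in> SL \<and>
     (\<exists>k\<in>H. orthonormal_basis W k {i. pos i < r} (\<lambda>i. g *v axis i 1)) \<and>
     (\<exists>k'\<in>H'. orthonormal_basis W' k' {i. r \<le> pos i} (\<lambda>i. g *v axis i 1))"

text \<open>The matrix \<open>diag(\<rho>, \<dots>, \<rho>, \<sigma>, \<dots>, \<sigma>)\<close> with \<open>r\<close> entries \<open>\<rho>\<close>.\<close>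

definition block_diag :: "nat \<Rightarrow> real \<Rightarrow> real \<Rightarrow> 'n::{finite,linorder} cmat" where
  "block_diag r \<rho> \<sigma> =
     (\<chi> i j. if i = j then complex_of_real (if pos i < r then \<rho> else \<sigma>) else 0)"

end

theory Submission
  imports Defs
begin

text \<open>
  A point of \<open>Z\<close> is a coset \<open>gu\<close>, and \<open>line g \<xi>\<close> is the curve \<open>t \<mapsto> g exp(t diag \<xi>) u\<close>, where \<open>\<xi>\<close> is a
  real vector with coordinate sum zero.  Every geodesic is such a line, and after that the
  proposition is linear algebra with the pairs \<open>(g, \<xi>)\<close>.

  Distances.  Gram-Schmidt applied to the vectors \<open>g\<^sup>*e\<^sub>i\<close>, in any chosen order, gives vectors \<open>w\<^sub>i\<close>;
  the logarithms of their lengths form the Iwasawa projection of \<open>gu\<close>.  Along a curve \<open>c\<close> in \<open>G\<close> the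
  derivative of \<open>ln \<bar>w\<^sub>i\<bar>\<close> is \<open>\<langle>Hf\<^sub>i, f\<^sub>i\<rangle>\<close>, where \<open>H\<close> is the hermitian part of \<open>c\<^sup>-\<^sup>1 c'\<close> and the
  \<open>f\<^sub>i\<close> are the normalized \<open>w\<^sub>i\<close>; hence the projection does not increase lengths
  (\<open>iwasawa_le_curve_length\<close>).  On the diagonal matrices \<open>exp(diag \<xi>)\<close> it is the logarithm, so the
  curve \<open>t \<mapsto> g exp(t diag \<xi>) u\<close> on \<open>[0,1]\<close> is shortest, and by the Cartan decomposition every pair
  of points is joined by one.  This computes the Riemannian distance (\<open>distZ_dexp\<close>).

  Geodesics.  If a point lies metrically between two points of a line, then equality in the
  Lipschitz estimate fixes its Iwasawa projection for every order at once, and this fixes the point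
  (\<open>between_unique\<close>).  So locally minimizing curves are locally lines, and they are lines globally
  because a line is determined by two of its points (\<open>line_eqI\<close>).

  The boundary.  The lines \<open>line g \<xi>\<close> and \<open>line h \<eta>\<close> of unit speed are asymptotic iff the matrix
  \<open>exp(-t diag \<xi>) g\<^sup>-\<^sup>1 h exp(t diag \<eta>)\<close> stays bounded, a condition on the zero entries of \<open>g\<^sup>-\<^sup>1 h\<close>
  (\<open>asymptotic_line_iff\<close>).  Thus the stabilizer of the end of \<open>line g \<xi>\<close> is a conjugate \<open>gPg\<^sup>-\<^sup>1\<close> of a
  standard parabolic group, and its invariant subspaces determine \<open>\<xi>\<close> and the flag when it is the
  stabilizer of a subspace.  Consequently \<open>z\<^sub>W\<close> is the end of \<open>line g \<xi>\<close> whenever \<open>\<xi>\<close> has two values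
  \<open>a > b\<close>, normalized to unit speed, and \<open>W\<close> is spanned by the columns of \<open>g\<close> where \<open>\<xi>\<close> is \<open>a\<close>
  (\<open>z_of_image_coord\<close>).

  The bijection.  A geodesic from \<open>W'\<close> to \<open>W\<close> is therefore a line whose \<open>g\<close> has some columns spanning \<open>W\<close>
  and the others spanning \<open>W'\<close>; declaring these columns orthonormal gives the two metrics.  If
  \<open>g\<close> and \<open>g'\<close> give proportional metrics on \<open>W\<close> and on \<open>W'\<close>, then \<open>M = g\<^sup>-\<^sup>1 g'\<close> respects the
  two blocks and \<open>M\<^sup>*M\<close> is scalar on each; as \<open>det M = 1\<close>, the matrix \<open>M\<close> is a unitary matrix times some
  \<open>exp(s diag \<xi>)\<close>, and the two lines differ by a shift of the parameter
  (\<open>line_shift_of_proportional\<close>).  Conversely, reparametrized lines have \<open>g\<^sup>-\<^sup>1 g' = exp(s diag \<xi>) k\<close> with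
  \<open>k\<close> unitary, so the metrics are proportional (\<open>proportional_of_line_shift\<close>).
\<close>

section \<open>The Hermitian inner product\<close>

definition cinner :: "complex^'n::finite \<Rightarrow> complex^'n \<Rightarrow> complex" where
  "cinner x y = (\<Sum>i\<in>UNIV. x $ i * cnj (y $ i))"

lemma cinner_add_left: "cinner (x + y) z = cinner x z + cinner y z"
  and cinner_add_right: "cinner z (x + y) = cinner z x + cinner z y"
  and cinner_diff_left: "cinner (x - y) z = cinner x z - cinner y z"
  and cinner_scale_left: "cinner (c *s x) z = c * cinner x z"
  and cinner_scale_right: "cinner z (c *s x) = cnj c * cinner z x"
  and cinner_zero_left [simp]: "cinner 0 z = 0"
  and cinner_zero_right [simp]: "cinner z 0 = 0"
  by (simp_all add: cinner_def algebra_simps sum.distrib sum_subtractf sum_distrib_left)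

lemma cinner_sum_left: "cinner (sum f I) z = (\<Sum>i\<in>I. cinner (f i) z)"
  by (induction I rule: infinite_finite_induct) (simp_all add: cinner_add_left)

lemma cnj_cinner: "cnj (cinner x y) = cinner y x"
  by (simp add: cinner_def mult.commute)

lemma cinner_eq_0_commute: "cinner x y = 0 \<longleftrightarrow> cinner y x = 0"
  by (metis cnj_cinner complex_cnj_zero_iff)

lemma Re_cinner: "Re (cinner x y) = x \<bullet> y"
  by (simp add: cinner_def inner_vec_def inner_complex_def)

lemma cinner_self: "cinner x x = complex_of_real ((norm x)\<^sup>2)"
proof -
  have "Im (cinner x x) = 0"
    by (simp add: cinner_def mult.commute)
  then show ?thesis
    by (simp add: complex_eq_iff Re_cinner power2_norm_eq_inner)
qed

lemma cinner_self_eq_0 [simp]: "cinner x x = 0 \<longleftrightarrow> x = 0"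
  by (simp add: cinner_self)

lemma cinner_adjoint: "cinner (A *v x) y = cinner x (ctranspose A *v y)"
proof -
  have "cinner (A *v x) y = (\<Sum>i\<in>UNIV. \<Sum>j\<in>UNIV. A $ i $ j * x $ j * cnj (y $ i))"
    by (simp add: cinner_def matrix_vector_mult_def sum_distrib_right)
  also have "\<dots> = (\<Sum>j\<in>UNIV. \<Sum>i\<in>UNIV. A $ i $ j * x $ j * cnj (y $ i))"
    by (rule sum.swap)
  also have "\<dots> = cinner x (ctranspose A *v y)"
    by (simp add: cinner_def matrix_vector_mult_def ctranspose_def sum_distrib_left mult_ac)
  finally show ?thesis .
qed

lemma cinner_axis_right: "cinner x (axis i 1) = x $ i"
proof -
  have "cinner x (axis i 1) = (\<Sum>j\<in>UNIV. if j = i then x $ j else 0)"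
    unfolding cinner_def by (rule sum.cong) (auto simp: axis_def)
  then show ?thesis by simp
qed

lemma bounded_bilinear_cinner: "bounded_bilinear (cinner :: complex^'n::finite \<Rightarrow> _)"
  unfolding bilinear_conv_bounded_bilinear[symmetric] bilinear_def
  by (auto intro!: linearI simp: cinner_def algebra_simps sum.distrib sum_distrib_left scaleR_sum_right)

lemma bounded_bilinear_vector_scalar_mult:
  "bounded_bilinear ((*s) :: complex \<Rightarrow> complex^'n::finite \<Rightarrow> _)"
  unfolding bilinear_conv_bounded_bilinear[symmetric] bilinear_def
  by (auto intro!: linearI simp: vec_eq_iff algebra_simps)

lemma mult_axis_nth: "((A :: 'n::finite cmat) *v axis j 1) $ i = A $ i $ j"
  by (simp add: matrix_vector_mult_def axis_def if_distrib cong: if_cong)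

lemma matrix_eqI_axis:
  fixes A B :: "'n::finite cmat"
  assumes "\<And>i. A *v axis i 1 = B *v axis i 1" shows "A = B"
  unfolding vec_eq_iff using assms by (metis mult_axis_nth)

lemma scaleR_eq_smult: "r *\<^sub>R (x :: complex^'n) = complex_of_real r *s x"
  by (simp add: vec_eq_iff scaleR_conv_of_real[where 'a=complex])

lemma cinner_axis: "cinner (axis i 1) (axis j 1) = (if i = j then 1 else 0)"
  unfolding cinner_axis_right by (simp add: axis_def)

section \<open>The groups and their cosets\<close>

lemma ctranspose_nth [simp]: "ctranspose A $ i $ j = cnj (A $ j $ i)"
  by (simp add: ctranspose_def)

lemma ctranspose_mult: "ctranspose (A ** B) = ctranspose B ** ctranspose A"
  by (simp add: vec_eq_iff matrix_matrix_mult_def mult.commute)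

lemma ctranspose_mult_nth:
  fixes A B :: "'n::finite cmat"
  shows "(ctranspose A ** B) $ i $ j = cinner (B *v axis j 1) (A *v axis i 1)"
  by (simp add: matrix_matrix_mult_def cinner_def mult_axis_nth mult.commute)

lemma ctranspose_mat1 [simp]: "ctranspose (mat 1) = mat 1"
  by (auto simp: vec_eq_iff mat_def)

lemma ctranspose_ctranspose [simp]: "ctranspose (ctranspose A) = A"
  by (simp add: vec_eq_iff)

lemma det_ctranspose: "det (ctranspose A) = cnj (det A)"
proof -
  have "ctranspose A = transpose (\<chi> i j. cnj (A $ i $ j))"
    by (simp add: vec_eq_iff transpose_def)
  then have "det (ctranspose A) = det (\<chi> i j. cnj (A $ i $ j))"
    by (simp only: det_transpose)
  also have "\<dots> = cnj (det A)"
    by (simp add: det_def)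
  finally show ?thesis .
qed

lemma matrix_inv_mult_SL:
  assumes "g \<in> SL"
  shows "matrix_inv g ** g = mat 1" "g ** matrix_inv g = mat 1"
proof -
  have "invertible g" using assms invertible_det_nz[of g] by (simp add: SL_def)
  then have "\<exists>A'. g ** A' = mat 1 \<and> A' ** g = mat 1" by (simp add: invertible_def)
  from someI_ex[OF this] show "matrix_inv g ** g = mat 1" "g ** matrix_inv g = mat 1"
    by (simp_all add: matrix_inv_def)
qed

lemma matrix_inv_cancel_SL:
  assumes "g \<in> SL"
  shows "matrix_inv g ** (g ** A) = A" "g ** (matrix_inv g ** A) = A"
    "A ** g ** matrix_inv g = A" "A ** matrix_inv g ** g = A"
  using matrix_inv_mult_SL[OF assms] by (metis matrix_mul_assoc matrix_mul_lid matrix_mul_rid)+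

lemma SL_mult: "g \<in> SL \<Longrightarrow> h \<in> SL \<Longrightarrow> g ** h \<in> SL"
  by (simp add: SL_def det_mul)

lemma SL_mat1 [simp]: "mat 1 \<in> SL"
  by (simp add: SL_def)

lemma SL_matrix_inv: "g \<in> SL \<Longrightarrow> matrix_inv g \<in> SL"
  using matrix_inv_mult_SL[of g] det_mul[of g "matrix_inv g"] by (simp add: SL_def)

lemma SU_SL: "k \<in> SU \<Longrightarrow> k \<in> SL"
  by (simp add: SU_def)

lemma SU_ctranspose_mult: "k \<in> SU \<Longrightarrow> ctranspose k ** k = mat 1"
  using matrix_left_right_inverse by (auto simp: SU_def)

lemma SU_mult_ctranspose: "k \<in> SU \<Longrightarrow> k ** ctranspose k = mat 1"
  by (simp add: SU_def)

lemma SU_mat1 [simp]: "mat 1 \<in> SU"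
  by (simp add: SU_def)

lemma SU_mult: "k \<in> SU \<Longrightarrow> l \<in> SU \<Longrightarrow> k ** l \<in> SU"
  unfolding SU_def
  by (auto simp: SL_mult ctranspose_mult)
     (metis matrix_mul_assoc matrix_mul_rid)

lemma SU_ctranspose: "k \<in> SU \<Longrightarrow> ctranspose k \<in> SU"
  using SU_ctranspose_mult[of k] by (auto simp: SU_def SL_def det_ctranspose)

lemma matrix_inv_unique:
  fixes g :: "'n::finite cmat"
  assumes "A ** g = mat 1"
  shows "matrix_inv g = A"
proof -
  have right: "g ** A = mat 1" using assms matrix_left_right_inverse by blast
  then have "\<exists>A'. g ** A' = mat 1 \<and> A' ** g = mat 1" using assms by auto
  from someI_ex[OF this] have "g ** matrix_inv g = mat 1"
    by (simp add: matrix_inv_def)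
  then show ?thesis by (metis assms matrix_mul_assoc matrix_mul_lid matrix_mul_rid)
qed

lemma matrix_inv_mult:
  "g \<in> SL \<Longrightarrow> h \<in> SL \<Longrightarrow> matrix_inv (g ** h) = matrix_inv h ** matrix_inv g"
  by (rule matrix_inv_unique)
     (metis matrix_inv_mult_SL(1) matrix_mul_assoc matrix_mul_rid)

lemma matrix_inv_inv: "g \<in> SL \<Longrightarrow> matrix_inv (matrix_inv g) = g"
  by (simp add: matrix_inv_mult_SL(2) matrix_inv_unique)

lemma cinner_unitary:
  assumes "ctranspose k ** k = mat 1"
  shows "cinner (k *v x) (k *v y) = cinner x y"
  by (simp add: cinner_adjoint matrix_vector_mul_assoc assms)

lemma norm_unitary:
  assumes "ctranspose k ** k = mat 1"
  shows "norm (k *v x) = norm x"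
  using cinner_unitary[OF assms, of x x] unfolding cinner_self of_real_eq_iff by simp

lemma act_act: "act g (act h x) = act (g ** h) x"
  by (simp add: act_def image_image matrix_mul_assoc)

lemma act_mat1 [simp]: "act (mat 1) x = x"
  by (simp add: act_def)

lemma act_base_eq_iff:
  assumes "g \<in> SL" "h \<in> SL"
  shows "act g base = act h base \<longleftrightarrow> matrix_inv g ** h \<in> SU"
proof
  assume "act g base = act h base"
  then have "h \<in> act g base"
    by (metis SU_mat1 act_def base_def image_eqI matrix_mul_rid)
  then obtain k where "k \<in> SU" "h = g ** k" by (auto simp: act_def base_def)
  then show "matrix_inv g ** h \<in> SU"
    using assms by (simp add: matrix_inv_cancel_SL)
next
  assume *: "matrix_inv g ** h \<in> SU"
  have "act k base = base" if "k \<in> SU" for k :: "'a cmat"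
  proof
    show "act k base \<subseteq> base" using that by (auto simp: act_def base_def SU_mult)
    show "base \<subseteq> act k base"
    proof
      fix l :: "'a cmat" assume "l \<in> base"
      then have "ctranspose k ** l \<in> SU" using that by (simp add: base_def SU_ctranspose SU_mult)
      moreover have "k ** (ctranspose k ** l) = l"
        using that by (simp add: matrix_mul_assoc SU_mult_ctranspose)
      ultimately show "l \<in> act k base" unfolding act_def base_def by (metis image_eqI)
    qed
  qed
  from this[OF *] have "act g (act (matrix_inv g ** h) base) = act g base" by simp
  then show "act g base = act h base"
    using assms by (simp add: act_act matrix_inv_cancel_SL)
qed

lemma act_SU_base: "k \<in> SU \<Longrightarrow> act k base = base"
  using act_base_eq_iff[of "mat 1" k] matrix_inv_unique[of "mat 1" "mat 1"]
  by (metis SL_mat1 SU_SL act_mat1 matrix_mul_lid)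

lemma act_mult_SU: "k \<in> SU \<Longrightarrow> act (g ** k) base = act g base"
  by (metis act_SU_base act_act)

lemma Z_cases:
  assumes "x \<in> Z" obtains g where "g \<in> SL" "x = act g base"
  using assms by (auto simp: Z_def)

lemma act_base_Z: "g \<in> SL \<Longrightarrow> act g base \<in> Z"
  by (auto simp: Z_def)

section \<open>Positive diagonal matrices\<close>

definition dexp :: "real^'n \<Rightarrow> 'n::finite cmat" where
  "dexp \<xi> = (\<chi> i j. if i = j then complex_of_real (exp (\<xi> $ i)) else 0)"

lemma diag_mult_nth:
  "((\<chi> i j. if i = j then d i else 0) ** A) $ i $ j = d i * A $ i $ j"
  "(A ** (\<chi> i j. if i = j then d i else 0)) $ i $ j = A $ i $ j * (d j :: complex)"
  by (simp_all add: matrix_matrix_mult_def if_distrib if_distribR cong: if_cong)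

lemma dexp_mult_nth:
  "(dexp \<xi> ** A) $ i $ j = complex_of_real (exp (\<xi> $ i)) * A $ i $ j"
  "(A ** dexp \<xi>) $ i $ j = A $ i $ j * complex_of_real (exp (\<xi> $ j))"
  unfolding dexp_def by (rule diag_mult_nth)+

lemma dexp_add: "dexp (\<xi> + \<eta>) = dexp \<xi> ** dexp \<eta>"
  by (simp add: vec_eq_iff dexp_mult_nth) (simp add: dexp_def exp_add)

lemma dexp_0 [simp]: "dexp 0 = mat 1"
  by (simp add: vec_eq_iff dexp_def mat_def)

lemma ctranspose_dexp [simp]: "ctranspose (dexp \<xi>) = dexp \<xi>"
  by (auto simp: vec_eq_iff dexp_def)

lemma dexp_mult_vector_nth: "(dexp \<xi> *v x) $ i = complex_of_real (exp (\<xi> $ i)) * x $ i"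
  by (simp add: dexp_def matrix_vector_mult_def if_distrib if_distribR cong: if_cong)

lemma dexp_axis: "dexp \<xi> *v axis i 1 = exp (\<xi> $ i) *\<^sub>R axis i 1"
  by (simp add: vec_eq_iff dexp_mult_vector_nth axis_def scaleR_conv_of_real[where 'a=complex])

lemma dexp_scaleR_add: "dexp ((s + t) *\<^sub>R \<xi>) = dexp (s *\<^sub>R \<xi>) ** dexp (t *\<^sub>R \<xi>)"
  by (simp add: scaleR_add_left dexp_add)

lemma det_dexp: "det (dexp \<xi>) = complex_of_real (exp (\<Sum>i\<in>UNIV. \<xi> $ i))"
proof -
  have "det (dexp \<xi>) = (\<Prod>i\<in>UNIV. dexp \<xi> $ i $ i)"
    by (rule det_diagonal) (simp add: dexp_def)
  also have "\<dots> = (\<Prod>i\<in>UNIV. complex_of_real (exp (\<xi> $ i)))"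
    by (simp add: dexp_def)
  finally show ?thesis by (simp add: exp_sum)
qed

text \<open>
  Equivalently, the diagonal matrix with diagonal \<open>\<xi>\<close> lies in \<open>\<pp>\<close>.
\<close>
definition trace0 :: "real^'n::finite \<Rightarrow> bool" where
  "trace0 \<xi> \<longleftrightarrow> (\<Sum>i\<in>UNIV. \<xi> $ i) = 0"

lemma trace0_scaleR: "trace0 \<xi> \<Longrightarrow> trace0 (t *\<^sub>R \<xi>)"
  by (simp add: trace0_def flip: sum_distrib_left)

lemma trace0_minus: "trace0 \<xi> \<Longrightarrow> trace0 (- \<xi>)"
  by (simp add: trace0_def sum_negf)

lemma trace0_double: "trace0 (\<xi> + \<xi>) \<longleftrightarrow> trace0 \<xi>"
  by (simp add: trace0_def sum.distrib flip: sum_distrib_left)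

lemma dexp_SL: "trace0 \<xi> \<Longrightarrow> dexp \<xi> \<in> SL"
  by (simp add: SL_def det_dexp trace0_def)

lemma dexp_scaleR_SL: "trace0 \<xi> \<Longrightarrow> dexp (t *\<^sub>R \<xi>) \<in> SL"
  by (intro dexp_SL trace0_scaleR)

lemma det_dexp_eq_1: "det (dexp \<xi>) = 1 \<Longrightarrow> trace0 \<xi>"
  unfolding det_dexp of_real_eq_1_iff by (simp add: trace0_def)

lemma dexp_minus: "dexp (- \<xi>) ** dexp \<xi> = mat 1" "dexp \<xi> ** dexp (- \<xi>) = mat 1"
  using dexp_add[of "-\<xi>" \<xi>] dexp_add[of \<xi> "-\<xi>"] by simp_all

lemma matrix_inv_dexp: "matrix_inv (dexp \<xi>) = dexp (- \<xi>)"
  by (simp add: dexp_minus(1) matrix_inv_unique)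

section \<open>Gram-Schmidt\<close>

text \<open>
  Gram-Schmidt without normalization, in the order that an injective \<open>q\<close> induces on the indices.
  The order is a parameter because a point of \<open>Z\<close> is recovered from its Iwasawa projections only by
  comparing several orders.
\<close>
function gs :: "('n::finite \<Rightarrow> nat) \<Rightarrow> ('n \<Rightarrow> complex^'n) \<Rightarrow> 'n \<Rightarrow> complex^'n" where
  "gs q v i = v i - (\<Sum>j\<in>{j. q j < q i}. (cinner (v i) (gs q v j) / cinner (gs q v j) (gs q v j)) *s gs q v j)"
  by auto
termination by (relation "Wellfounded.measure (\<lambda>(q, v, i). q i)") auto

declare gs.simps [simp del]

lemma gs_induct [case_names less]:
  fixes q :: "'n \<Rightarrow> nat"
  assumes "\<And>i. (\<And>j. q j < q i \<Longrightarrow> P j) \<Longrightarrow> P i"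
  shows "P i"
  using assms by (induction "q i" arbitrary: i rule: less_induct) blast

lemma gs_orthogonal:
  assumes "inj q" "i \<noteq> j"
  shows "cinner (gs q v i) (gs q v j) = 0"
proof -
  have "\<forall>k. q k < q i \<longrightarrow> cinner (gs q v i) (gs q v k) = 0" for i
  proof (induction i rule: gs_induct[of q])
    case (less i)
    show ?case
    proof (intro allI impI)
      fix k assume k: "q k < q i"
      let ?w = "gs q v"
      let ?c = "\<lambda>j. cinner (v i) (?w j) / cinner (?w j) (?w j)"
      have orth: "cinner (?w j) (?w k) = 0" if "q j < q i" "j \<noteq> k" for j
      proof -
        have "q j < q k \<or> q k < q j" using that assms(1) by (metis injD linorder_neqE_nat)
        then show ?thesis
          using less that k by (metis cinner_eq_0_commute)
      qed
      have "cinner (?w i) (?w k) =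
          cinner (v i) (?w k) - (\<Sum>j\<in>{j. q j < q i}. ?c j * cinner (?w j) (?w k))"
        by (subst gs.simps) (simp add: cinner_diff_left cinner_sum_left cinner_scale_left)
      also have "(\<Sum>j\<in>{j. q j < q i}. ?c j * cinner (?w j) (?w k)) =
          (\<Sum>j\<in>{j. q j < q i}. if j = k then ?c j * cinner (?w k) (?w k) else 0)"
        by (rule sum.cong) (auto simp: orth)
      also have "\<dots> = ?c k * cinner (?w k) (?w k)"
        using k by simp
      also have "cinner (v i) (?w k) - \<dots> = 0"
        by simp
      finally show "cinner (?w i) (?w k) = 0" .
    qed
  qed
  moreover have "q i < q j \<or> q j < q i" using assms by (metis injD linorder_neqE_nat)
  ultimately show ?thesis by (metis cinner_eq_0_commute)
qed

lemma gs_id: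
  assumes "\<And>i j. i \<noteq> j \<Longrightarrow> cinner (v i) (v j) = 0"
  shows "gs q v i = v i"
proof (induction i rule: gs_induct[of q])
  case (less i)
  have "cinner (v i) (gs q v j) = 0" if "q j < q i" for j
    using assms[of i j] less[OF that] that by auto
  then show ?case by (subst gs.simps) (simp add: sum.neutral)
qed

lemma gs_unitary:
  fixes k :: "'n::finite cmat"
  assumes "ctranspose k ** k = mat 1"
  shows "gs q (\<lambda>i. k *v v i) i = k *v gs q v i"
proof (induction i rule: gs_induct[of q])
  case (less i)
  have "gs q (\<lambda>i. k *v v i) i = k *v v i -
     (\<Sum>j\<in>{j. q j < q i}. (cinner (k *v v i) (k *v gs q v j) / cinner (k *v gs q v j) (k *v gs q v j)) *s (k *v gs q v j))"
    by (subst gs.simps) (simp add: less)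
  also have "\<dots> = k *v gs q v i"
    by (subst (4) gs.simps)
      (simp add: cinner_unitary[OF assms] matrix_vector_mult_diff_distrib vector_scalar_commute vec.sum)
  finally show ?case .
qed

text \<open>
  The change of basis is triangular with ones on the diagonal.  Hence no vector produced from
  the columns of an invertible matrix vanishes.
\<close>
lemma gs_coeffs:
  fixes M :: "'n::finite cmat"
  assumes "inj q"
  shows "\<exists>b. gs q (\<lambda>i. M *v axis i 1) i = M *v b \<and> b $ i = 1"
proof -
  have "\<exists>b. gs q (\<lambda>i. M *v axis i 1) i = M *v b \<and> b $ i = 1 \<and> (\<forall>j. q i < q j \<longrightarrow> b $ j = 0)"
  proof (induction i rule: gs_induct[of q])
    case (less i)
    let ?w = "gs q (\<lambda>i. M *v axis i 1)"
    from less obtain b where b: "\<And>j. q j < q i \<Longrightarrow> ?w j = M *v b j"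
      "\<And>j k. q j < q i \<Longrightarrow> q j < q k \<Longrightarrow> b j $ k = 0"
      by metis
    define c where "c = axis i 1 -
      (\<Sum>j\<in>{j. q j < q i}. (cinner (M *v axis i 1) (?w j) / cinner (?w j) (?w j)) *s b j)"
    have "?w i = M *v axis i 1 -
      (\<Sum>j\<in>{j. q j < q i}. (cinner (M *v axis i 1) (?w j) / cinner (?w j) (?w j)) *s ?w j)"
      by (rule gs.simps)
    also have "\<dots> = M *v axis i 1 -
      (\<Sum>j\<in>{j. q j < q i}. (cinner (M *v axis i 1) (?w j) / cinner (?w j) (?w j)) *s (M *v b j))"
      using b(1) by simp
    also have "\<dots> = M *v c"
      by (simp add: c_def matrix_vector_mult_diff_distrib vec.sum vector_scalar_commute)
    finally have "?w i = M *v c" .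
    moreover have "c $ i = 1" "\<forall>j. q i < q j \<longrightarrow> c $ j = 0"
      using b(2) by (auto simp: c_def axis_def intro!: sum.neutral)
    ultimately show ?case by blast
  qed
  then show ?thesis by blast
qed

lemma gs_nonzero:
  fixes M :: "'n::finite cmat"
  assumes "inj q" "det M \<noteq> 0"
  shows "gs q (\<lambda>i. M *v axis i 1) i \<noteq> 0"
proof
  assume *: "gs q (\<lambda>i. M *v axis i 1) i = 0"
  obtain b where "gs q (\<lambda>i. M *v axis i 1) i = M *v b" "b $ i = 1"
    using gs_coeffs[OF assms(1)] by blast
  then have "M *v b = 0" "b \<noteq> 0" using * by auto
  moreover have "inj ((*v) M)" using assms(2) by (simp add: inj_matrix_vector_mult invertible_det_nz)
  ultimately show False by (metis injD matrix_vector_mult_0_right)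
qed

text \<open>
  Suppose that all \<open>v\<^sub>i\<close> move by \<open>v\<^sub>i' = Bv\<^sub>i\<close>.  Differentiating the recursion gives
  \<open>w\<^sub>i' = Bw\<^sub>i + z\<close>: the derivatives of the coefficients and, inductively, the error terms of the earlier
  vectors all lie in the span of the earlier \<open>w\<^sub>j\<close>.
\<close>
lemma gs_vector_derivative:
  fixes v :: "real \<Rightarrow> 'n::finite \<Rightarrow> complex^'n"
  assumes v: "\<And>i. ((\<lambda>s. v s i) has_vector_derivative B *v v t i) (at t)"
    and nz: "\<And>i. gs q (v t) i \<noteq> 0"
  shows "\<exists>z. ((\<lambda>s. gs q (v s) i) has_vector_derivative B *v gs q (v t) i + z) (at t) \<and>
           z \<in> vec.span (gs q (v t) ` {j. q j < q i})"
proof (induction i rule: gs_induct[of q])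
  case (less i)
  let ?w = "\<lambda>s. gs q (v s)"
  let ?J = "{j. q j < q i}"
  let ?c = "\<lambda>j s. cinner (v s i) (?w s j) / cinner (?w s j) (?w s j)"
  from less obtain z where z: 
    "\<And>j. j \<in> ?J \<Longrightarrow> ((\<lambda>s. ?w s j) has_vector_derivative B *v ?w t j + z j) (at t)"
    "\<And>j. j \<in> ?J \<Longrightarrow> z j \<in> vec.span (?w t ` {k. q k < q j})"
    by (metis mem_Collect_eq)
  define d where "d j = vector_derivative (?c j) (at t)" for j
  have d: "(?c j has_vector_derivative d j) (at t)" if "j \<in> ?J" for j
  proof -
    have "(\<lambda>s. cinner (v s i) (?w s j)) differentiable (at t)"
      "(\<lambda>s. cinner (?w s j) (?w s j)) differentiable (at t)"
      using bounded_bilinear.has_vector_derivative[OF bounded_bilinear_cinner v[of i] z(1)[OF that]]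
        bounded_bilinear.has_vector_derivative[OF bounded_bilinear_cinner z(1)[OF that] z(1)[OF that]]
      by (auto intro!: differentiableI_vector)
    then have "?c j differentiable (at t)"
      by (rule differentiable_divide) (simp add: nz)
    then show ?thesis by (simp add: vector_derivative_works d_def)
  qed
  define y where "y = - (\<Sum>j\<in>?J. d j *s ?w t j + ?c j t *s z j)"
  have summand: "((\<lambda>s. ?c j s *s ?w s j) has_vector_derivative
      ?c j t *s (B *v ?w t j + z j) + d j *s ?w t j) (at t)" if "j \<in> ?J" for j
    by (rule bounded_bilinear.has_vector_derivative[OF bounded_bilinear_vector_scalar_mult
          d[OF that] z(1)[OF that]])
  have deriv: "((\<lambda>s. v s i - (\<Sum>j\<in>?J. ?c j s *s ?w s j)) has_vector_derivative
        B *v v t i - (\<Sum>j\<in>?J. ?c j t *s (B *v ?w t j + z j) + d j *s ?w t j)) (at t)"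
    by (rule has_vector_derivative_diff[OF v has_vector_derivative_sum[OF summand]])
  have Bw: "B *v ?w t i = B *v v t i - (\<Sum>j\<in>?J. ?c j t *s (B *v ?w t j))"
    using arg_cong[OF gs.simps[of q "v t" i], of "(*v) B"]
    by (simp add: matrix_vector_mult_diff_distrib vec.sum vector_scalar_commute)
  have eq: "B *v v t i - (\<Sum>j\<in>?J. ?c j t *s (B *v ?w t j + z j) + d j *s ?w t j)
      = B *v ?w t i + y"
    unfolding Bw y_def by (simp add: vector_add_ldistrib sum.distrib)
  have "(\<lambda>s. ?w s i) = (\<lambda>s. v s i - (\<Sum>j\<in>?J. ?c j s *s ?w s j))"
    by (rule ext) (rule gs.simps)
  then have "((\<lambda>s. ?w s i) has_vector_derivative B *v ?w t i + y) (at t)"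
    using deriv unfolding eq by (simp only:)
  moreover have "y \<in> vec.span (?w t ` ?J)"
  proof -
    have "z j \<in> vec.span (?w t ` ?J)" if "j \<in> ?J" for j
    proof -
      have "?w t ` {k. q k < q j} \<subseteq> ?w t ` ?J" using that by auto
      then show ?thesis using z(2)[OF that] by (rule vec.span_mono[THEN subsetD])
    qed
    then show ?thesis unfolding y_def
      by (intro vec.span_neg vec.span_sum vec.span_add vec.span_scale) (auto intro: vec.span_base)
  qed
  ultimately show ?case by blast
qed

lemma gs_continuous_on:
  fixes v :: "real \<Rightarrow> 'n::finite \<Rightarrow> complex^'n"
  assumes v: "\<And>i. continuous_on S (\<lambda>s. v s i)"
    and nz: "\<And>s i. s \<in> S \<Longrightarrow> gs q (v s) i \<noteq> 0"
  shows "continuous_on S (\<lambda>s. gs q (v s) i)"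
proof (induction i rule: gs_induct[of q])
  case (less i)
  have "continuous_on S (\<lambda>s. v s i - (\<Sum>j\<in>{j. q j < q i}.
     (cinner (v s i) (gs q (v s) j) / cinner (gs q (v s) j) (gs q (v s) j)) *s gs q (v s) j))"
    using v less nz
    by (intro continuous_on_diff continuous_on_sum continuous_on_divide
        bounded_bilinear.continuous_on[OF bounded_bilinear_vector_scalar_mult]
        bounded_bilinear.continuous_on[OF bounded_bilinear_cinner]) auto
  then show ?case by (subst gs.simps)
qed

lemma cinner_span_eq_0:
  assumes "z \<in> vec.span A" "\<And>x. x \<in> A \<Longrightarrow> cinner x y = 0"
  shows "cinner z y = 0"
  using assms by (induction rule: vec.span_induct_alt) (auto simp: cinner_add_left cinner_scale_left)

text \<open>
  The error term \<open>z\<close> is orthogonal to \<open>w\<^sub>i\<close>, so the length of \<open>w\<^sub>i\<close> does not see it.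
\<close>
lemma ln_norm_gs_derivative:
  fixes v :: "real \<Rightarrow> 'n::finite \<Rightarrow> complex^'n"
  assumes q: "inj q"
    and v: "\<And>i. ((\<lambda>s. v s i) has_vector_derivative B *v v t i) (at t)"
    and nz: "\<And>i. gs q (v t) i \<noteq> 0"
  shows "((\<lambda>s. ln (norm (gs q (v s) i))) has_vector_derivative
           (B *v gs q (v t) i) \<bullet> gs q (v t) i / (norm (gs q (v t) i))\<^sup>2) (at t)"
proof -
  let ?w = "\<lambda>s. gs q (v s) i"
  obtain z where z: "(?w has_vector_derivative B *v ?w t + z) (at t)"
      "z \<in> vec.span (gs q (v t) ` {j. q j < q i})"
    using gs_vector_derivative[OF v nz] by blast
  have "cinner z (?w t) = 0"
    using z(2) by (rule cinner_span_eq_0) (auto intro!: gs_orthogonal[OF q])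
  then have z0: "z \<bullet> ?w t = 0" by (metis Re_cinner zero_complex.sel(1))
  have "((\<lambda>s. ?w s \<bullet> ?w s) has_vector_derivative
      ?w t \<bullet> (B *v ?w t + z) + (B *v ?w t + z) \<bullet> ?w t) (at t)"
    by (rule bounded_bilinear.has_vector_derivative[OF bounded_bilinear_inner z(1) z(1)])
  then have "((\<lambda>s. ?w s \<bullet> ?w s) has_real_derivative 2 * ((B *v ?w t) \<bullet> ?w t)) (at t)"
    using z0 by (simp add: has_real_derivative_iff_has_vector_derivative inner_add inner_commute)
  then have "((\<lambda>s. ln (?w s \<bullet> ?w s) / 2) has_real_derivative
      (1 / (?w t \<bullet> ?w t) * (2 * ((B *v ?w t) \<bullet> ?w t))) / 2) (at t)"
    using nz by (intro DERIV_cdivide DERIV_chain2[OF DERIV_ln_divide]) auto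
  moreover have "(\<lambda>s. ln (?w s \<bullet> ?w s) / 2) = (\<lambda>s. ln (norm (?w s)))"
    by (simp add: norm_eq_sqrt_inner ln_sqrt fun_eq_iff)
  ultimately show ?thesis
    by (simp add: has_real_derivative_iff_has_vector_derivative power2_norm_eq_inner)
qed

section \<open>The Iwasawa projection is 1-Lipschitz\<close>

text \<open>
  The norm of the diagonal matrix with diagonal \<open>\<xi>\<close> in the Killing form.
\<close>
definition knorm :: "real^'n::finite \<Rightarrow> real" where
  "knorm \<xi> = sqrt (4 * real CARD('n)) * norm \<xi>"

text \<open>
  Let \<open>g = n a k\<close> with \<open>n\<close> unipotent and triangular for the order \<open>q\<close>, \<open>a\<close> positive diagonal and \<open>k\<close>
  unitary.  Then \<open>g\<^sup>*e\<^sub>i = k\<^sup>*a n\<^sup>*e\<^sub>i\<close>, and Gram-Schmidt removes \<open>n\<close>: the resulting vectors are \<open>a\<^sub>i k\<^sup>*e\<^sub>i\<close>.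
  So the definition yields the logarithm of \<open>a\<close>.
\<close>
definition iwasawa :: "('n::finite \<Rightarrow> nat) \<Rightarrow> 'n cmat \<Rightarrow> real^'n" where
  "iwasawa q g = (\<chi> i. ln (norm (gs q (\<lambda>i. ctranspose g *v axis i 1) i)))"

lemma iwasawa_mult_SU:
  assumes "k \<in> SU"
  shows "iwasawa q (g ** k) = iwasawa q g"
proof -
  have u: "ctranspose (ctranspose k) ** ctranspose k = mat 1"
    using assms by (simp add: SU_mult_ctranspose)
  have "(\<lambda>i. ctranspose (g ** k) *v axis i 1) = (\<lambda>i. ctranspose k *v (ctranspose g *v axis i 1))"
    by (simp add: ctranspose_mult matrix_vector_mul_assoc)
  then show ?thesis
    unfolding iwasawa_def by (simp add: gs_unitary[OF u] norm_unitary[OF u])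
qed

lemma iwasawa_dexp [simp]: "iwasawa q (dexp \<xi>) = \<xi>"
proof -
  have "gs q (\<lambda>i. dexp \<xi> *v axis i 1) i = dexp \<xi> *v axis i 1" for i
    by (rule gs_id) (simp add: dexp_axis scaleR_eq_smult cinner_scale_left cinner_scale_right cinner_axis)
  then have "norm (gs q (\<lambda>i. dexp \<xi> *v axis i 1) i) = exp (\<xi> $ i)" for i
    by (simp only:) (simp add: dexp_axis)
  then show ?thesis
    by (simp add: iwasawa_def vec_eq_iff)
qed

lemma iwasawa_mat1 [simp]: "iwasawa q (mat 1) = 0"
  using iwasawa_dexp[of q 0] by simp

text \<open>
  The Hilbert-Schmidt norm of a hermitian matrix can be computed in any orthonormal basis.
\<close>
lemma sum_norm_orthonormal:
  fixes f :: "'n::finite \<Rightarrow> complex^'n"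
  assumes f: "\<And>i j. cinner (f i) (f j) = (if i = j then 1 else 0)"
    and H: "ctranspose H = H"
  shows "(\<Sum>i\<in>UNIV. (norm (H *v f i))\<^sup>2) = Re (trace (H ** H))"
proof -
  define F :: "'n cmat" where "F = (\<chi> i j. f j $ i)"
  have Ff: "F *v axis i 1 = f i" for i
    by (simp add: F_def vec_eq_iff mult_axis_nth)
  have "ctranspose F ** F = mat 1"
    by (simp add: vec_eq_iff ctranspose_mult_nth Ff f mat_def)
  then have FF: "F ** ctranspose F = mat 1" by (simp add: matrix_left_right_inverse)
  have "complex_of_real (\<Sum>i\<in>UNIV. (norm (H *v f i))\<^sup>2) = (\<Sum>i\<in>UNIV. cinner (H *v f i) (H *v f i))"
    by (simp add: cinner_self)
  also have "\<dots> = (\<Sum>i\<in>UNIV. (ctranspose F ** (H ** H ** F)) $ i $ i)"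
    by (rule sum.cong) (simp_all add: ctranspose_mult_nth cinner_adjoint Ff H flip: matrix_vector_mul_assoc)
  also have "\<dots> = trace (ctranspose F ** (H ** H ** F))" by (simp add: trace_def)
  also have "\<dots> = trace (H ** H ** F ** ctranspose F)" by (rule trace_mul_sym)
  also have "\<dots> = trace (H ** H)" by (metis FF matrix_mul_assoc matrix_mul_rid)
  finally show ?thesis by (metis Re_complex_of_real)
qed

lemma ctranspose_to_p: "ctranspose (to_p A) = to_p A"
  by (simp add: to_p_def vec_eq_iff algebra_simps)

lemma to_p_inner: "(to_p A *v x) \<bullet> x = (ctranspose A *v x) \<bullet> x"
proof -
  have "to_p A *v x = (1/2) *\<^sub>R (A *v x + ctranspose A *v x)"
    by (simp add: to_p_def vec_eq_iff matrix_vector_mult_def scaleR_sum_right algebra_simps sum.distrib)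
  moreover have "(A *v x) \<bullet> x = (ctranspose A *v x) \<bullet> x"
    by (metis Re_cinner cinner_adjoint inner_commute)
  ultimately show ?thesis by (simp add: inner_add)
qed

lemma killing_nonneg:
  assumes "ctranspose H = H" shows "0 \<le> killing H H"
proof -
  have "0 \<le> (\<Sum>i\<in>UNIV. (norm (H *v axis i 1))\<^sup>2)" by (simp add: sum_nonneg)
  also have "\<dots> = Re (trace (H ** H))"
    by (rule sum_norm_orthonormal[OF cinner_axis assms])
  finally show ?thesis by (simp add: killing_def)
qed

lemma speed_nonneg: "0 \<le> speed c t"
  by (simp add: speed_def Let_def killing_nonneg ctranspose_to_p)

text \<open>
  In the orthonormal basis \<open>f\<^sub>i = w\<^sub>i / \<bar>w\<^sub>i\<bar>\<close> the numbers on the left are the diagonal entries of the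
  hermitian part \<open>H\<close>.  Their square sum is at most the square of the Hilbert-Schmidt norm of \<open>H\<close>, and
  the inequality is Cauchy-Schwarz.
\<close>
lemma frame_inner_le:
  fixes w :: "'n::finite \<Rightarrow> complex^'n" and \<xi> :: "real^'n"
  assumes w: "\<And>i j. i \<noteq> j \<Longrightarrow> cinner (w i) (w j) = 0" "\<And>i. w i \<noteq> 0"
  shows "sqrt (4 * real CARD('n)) * (\<Sum>i\<in>UNIV. ((ctranspose A *v w i) \<bullet> w i / (norm (w i))\<^sup>2) * \<xi> $ i)
     \<le> norm \<xi> * sqrt (killing (to_p A) (to_p A))"
proof -
  define f where "f i = (1 / norm (w i)) *\<^sub>R w i" for i
  let ?H = "to_p A"
  have fs: "f i = complex_of_real (1 / norm (w i)) *s w i" for i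
    by (simp add: f_def scaleR_eq_smult)
  have f: "cinner (f i) (f j) = (if i = j then 1 else 0)" for i j
    using w by (auto simp: fs cinner_scale_left cinner_scale_right cinner_self power2_eq_square)
  have nf: "norm (f i) = 1" for i
    using w by (simp add: f_def)
  have e: "(ctranspose A *v w i) \<bullet> w i / (norm (w i))\<^sup>2 = (?H *v f i) \<bullet> f i" for i
  proof -
    have "(?H *v f i) \<bullet> f i = (ctranspose A *v f i) \<bullet> f i" by (rule to_p_inner)
    also have "ctranspose A *v f i = (1 / norm (w i)) *\<^sub>R (ctranspose A *v w i)"
      by (simp add: f_def scaleR_eq_smult vector_scalar_commute)
    finally show ?thesis by (simp add: f_def power2_eq_square)
  qed
  define y :: "real^'n" where "y = (\<chi> i. (?H *v f i) \<bullet> f i)"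
  have "(norm y)\<^sup>2 = (\<Sum>i\<in>UNIV. ((?H *v f i) \<bullet> f i)\<^sup>2)"
    by (simp add: y_def norm_vec_def L2_set_def sum_nonneg)
  also have "\<dots> \<le> (\<Sum>i\<in>UNIV. (norm (?H *v f i))\<^sup>2)"
  proof (rule sum_mono)
    fix i
    have "\<bar>(?H *v f i) \<bullet> f i\<bar> \<le> norm (?H *v f i) * norm (f i)" by (rule Cauchy_Schwarz_ineq2)
    then show "((?H *v f i) \<bullet> f i)\<^sup>2 \<le> (norm (?H *v f i))\<^sup>2"
      by (simp add: nf abs_le_square_iff[symmetric])
  qed
  also have "\<dots> = Re (trace (?H ** ?H))"
    by (rule sum_norm_orthonormal[OF f ctranspose_to_p])
  finally have "norm y \<le> sqrt (Re (trace (?H ** ?H)))" by (rule real_le_rsqrt)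
  then have y: "sqrt (4 * real CARD('n)) * norm y \<le> sqrt (killing ?H ?H)"
    by (simp add: killing_def real_sqrt_mult mult_left_mono)
  have "sqrt (4 * real CARD('n)) * (y \<bullet> \<xi>) \<le> sqrt (4 * real CARD('n)) * (norm y * norm \<xi>)"
    by (rule mult_left_mono[OF norm_cauchy_schwarz]) simp
  also have "\<dots> = sqrt (4 * real CARD('n)) * norm y * norm \<xi>" by simp
  also have "\<dots> \<le> sqrt (killing ?H ?H) * norm \<xi>"
    by (rule mult_right_mono[OF y]) simp
  finally have "sqrt (4 * real CARD('n)) * (y \<bullet> \<xi>) \<le> norm \<xi> * sqrt (killing ?H ?H)"
    by (simp only: mult.commute)
  moreover have "(\<Sum>i\<in>UNIV. ((ctranspose A *v w i) \<bullet> w i / (norm (w i))\<^sup>2) * \<xi> $ i) = y \<bullet> \<xi>"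
    by (subst inner_vec_def) (simp add: e y_def)
  ultimately show ?thesis by (simp only:)
qed

definition admissible :: "(real \<Rightarrow> 'n::finite cmat) \<Rightarrow> bool" where
  "admissible c \<longleftrightarrow> c piecewise_C1_differentiable_on {0..1} \<and> speed c integrable_on {0..1} \<and>
     c ` {0..1} \<subseteq> SL"

text \<open>
  The Iwasawa projection does not increase length.  Its difference \<open>\<xi>\<close> between the ends of the
  curve is tested against \<open>\<xi>\<close> itself: the scalar product of the projection with \<open>\<xi>\<close> has derivative at most
  the speed times \<open>\<bar>\<xi>\<bar>\<close>, up to the normalization of the Killing form.  The left translation by \<open>a\<close> leaves
  \<open>c\<^sup>-\<^sup>1 c'\<close> unchanged, and with it one projection serves all base points.
\<close>
lemma iwasawa_le_curve_length:
  fixes c :: "real \<Rightarrow> 'n::finite cmat"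
  assumes c: "admissible c" and a: "a \<in> SL" and q: "inj q"
  shows "knorm (iwasawa q (a ** c 1) - iwasawa q (a ** c 0)) \<le> curve_length c"
proof -
  from c obtain S where S: "finite S" "c C1_differentiable_on {0..1} - S"
    and cont: "continuous_on {0..1} c" and SL: "\<And>t. t \<in> {0..1} \<Longrightarrow> c t \<in> SL"
    and int: "speed c integrable_on {0..1}"
    unfolding admissible_def piecewise_C1_differentiable_on_def by blast
  from S(2) obtain D where D: "\<And>t. t \<in> {0..1} - S \<Longrightarrow> (c has_vector_derivative D t) (at t)"
    unfolding C1_differentiable_on_def by blast
  define v where "v s i = ctranspose (a ** c s) *v axis i 1" for s i
  have lin: "bounded_linear (\<lambda>M. ctranspose (a ** M) *v axis i 1)" for i :: 'n
    unfolding linear_conv_bounded_linear[symmetric]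
    by (rule linearI)
      (simp_all add: vec_eq_iff mult_axis_nth matrix_matrix_mult_def
        algebra_simps sum.distrib scaleR_sum_right)
  have detz: "det (ctranspose (a ** c t)) \<noteq> 0" if "t \<in> {0..1}" for t
    using SL_mult[OF a SL[OF that]] by (simp add: det_ctranspose SL_def)
  have nz: "gs q (v t) i \<noteq> 0" if "t \<in> {0..1}" for t i
    unfolding v_def by (rule gs_nonzero[OF q detz[OF that]])
  define \<xi> where "\<xi> = iwasawa q (a ** c 1) - iwasawa q (a ** c 0)"
  define \<phi> where "\<phi> t = iwasawa q (a ** c t) \<bullet> \<xi>" for t
  have \<phi>: "\<phi> t = (\<Sum>i\<in>UNIV. ln (norm (gs q (v t) i)) * \<xi> $ i)" for t
  proof -
    have "v t = (\<lambda>i. ctranspose (a ** c t) *v axis i 1)" by (simp add: v_def fun_eq_iff)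
    then show ?thesis unfolding \<phi>_def by (subst inner_vec_def) (simp add: iwasawa_def)
  qed
  define A where "A t = matrix_inv (c t) ** D t" for t
  define d where "d t = (\<Sum>i\<in>UNIV. ((ctranspose (A t) *v gs q (v t) i) \<bullet> gs q (v t) i /
     (norm (gs q (v t) i))\<^sup>2) * \<xi> $ i)" for t
  have deriv: "(\<phi> has_vector_derivative d t) (at t)" if t: "t \<in> {0..1} - S" for t
  proof -
    have "((\<lambda>s. v s i) has_vector_derivative ctranspose (A t) *v v t i) (at t)" for i
    proof -
      have "ctranspose (A t) *v v t i = ctranspose (a ** (c t ** A t)) *v axis i 1"
        by (simp add: v_def matrix_vector_mul_assoc ctranspose_mult matrix_mul_assoc)
      also have "c t ** A t = D t"
        using matrix_inv_cancel_SL(2)[OF SL] t by (simp add: A_def)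
      finally show ?thesis
        using bounded_linear.has_vector_derivative[OF lin D[OF t], of i] by (simp add: v_def)
    qed
    then show ?thesis unfolding \<phi> d_def
      using t nz
      by (intro has_vector_derivative_sum has_vector_derivative_mult_left ln_norm_gs_derivative[OF q]) auto
  qed
  have v_cont: "continuous_on {0..1} (\<lambda>t. v t i)" for i
    unfolding v_def by (rule bounded_linear.continuous_on[OF lin cont])
  have "continuous_on {0..1} (\<lambda>t. gs q (v t) i)" for i
    by (rule gs_continuous_on[OF v_cont nz])
  then have "continuous_on {0..1} \<phi>" unfolding \<phi>
    using nz by (intro continuous_intros) auto
  \<comment> \<open>At the exceptional times the integrand is set to 0, which the speed always dominates.\<close>
  with deriv S(1) have "((\<lambda>t. if t \<in> {0..1} - S then d t else 0) has_integral (\<phi> 1 - \<phi> 0)) {0..1}"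
    by (intro fundamental_theorem_of_calculus_interior_strong[of S]) auto
  moreover have "((\<lambda>t. norm \<xi> / sqrt (4 * real CARD('n)) * speed c t) has_integral
      norm \<xi> / sqrt (4 * real CARD('n)) * curve_length c) {0..1}"
    unfolding curve_length_def using int by (intro has_integral_mult_right integrable_integral)
  ultimately have "\<phi> 1 - \<phi> 0 \<le> norm \<xi> / sqrt (4 * real CARD('n)) * curve_length c"
  proof (rule has_integral_le)
    fix t :: real assume t01: "t \<in> {0..1}"
    show "(if t \<in> {0..1} - S then d t else 0) \<le> norm \<xi> / sqrt (4 * real CARD('n)) * speed c t"
    proof (cases "t \<in> {0..1} - S")
      case True
      have "speed c t = sqrt (killing (to_p (A t)) (to_p (A t)))"
        using vector_derivative_at[OF D[OF True]] by (simp add: speed_def A_def Let_def)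
      moreover have "sqrt (4 * real CARD('n)) * d t \<le> norm \<xi> * sqrt (killing (to_p (A t)) (to_p (A t)))"
        unfolding d_def by (rule frame_inner_le) (use gs_orthogonal[OF q] nz t01 in auto)
      ultimately show ?thesis using True by (simp add: field_simps)
    next
      case False
      then show ?thesis by (simp add: speed_nonneg del: Diff_iff)
    qed
  qed
  moreover have "\<phi> 1 - \<phi> 0 = norm \<xi> * norm \<xi>"
    by (simp add: \<phi>_def \<xi>_def inner_diff_left[symmetric] power2_norm_eq_inner[symmetric] flip: power2_eq_square)
  ultimately have *: "norm \<xi> * norm \<xi> * sqrt (4 * real CARD('n)) \<le> norm \<xi> * curve_length c"
    by (simp add: field_simps)
  have "0 \<le> curve_length c"
    unfolding curve_length_def by (rule integral_nonneg[OF int]) (simp add: speed_nonneg)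
  with * show ?thesis
    by (cases "norm \<xi> = 0") (simp_all add: knorm_def \<xi>_def[symmetric] mult.assoc mult.commute)
qed

section \<open>The spectral theorem and the Cartan decomposition\<close>

lemma linear_le_quadratic_imp_0:
  fixes a b :: real
  assumes "\<And>t. 0 \<le> a * t + b * t\<^sup>2"
  shows "a = 0"
proof (rule ccontr)
  assume a: "a \<noteq> 0"
  define s where "s = 1 / (\<bar>b\<bar> + 1)"
  have s: "0 < s" "b * s < 1" by (auto simp: s_def field_simps)
  have "0 \<le> a * (- s * a) + b * (- s * a)\<^sup>2" by (rule assms)
  also have "\<dots> = (a\<^sup>2 * s) * (b * s - 1)" by (simp add: power2_eq_square algebra_simps)
  also have "\<dots> < 0" using a s by (intro mult_pos_neg) auto
  finally show False by simp
qed

lemma ex_orthogonal: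
  fixes f :: "'n::finite \<Rightarrow> complex^'n"
  assumes "i \<notin> S"
  obtains x where "x \<noteq> 0" "\<And>j. j \<in> S \<Longrightarrow> cinner x (f j) = 0"
proof -
  define M :: "'n cmat" where "M = (\<chi> k j. if k \<in> S then cnj (f k $ j) else 0)"
  have "row i M = 0" using assms by (simp add: row_def M_def vec_eq_iff)
  then have "det M = 0" by (rule det_zero_row)
  then have "\<not> invertible M" by (simp add: invertible_det_nz)
  then obtain x where x: "M *v x = 0" "x \<noteq> 0"
    using invertible_left_inverse matrix_left_invertible_ker by blast
  have "cinner x (f j) = 0" if "j \<in> S" for j
  proof -
    have "cinner x (f j) = (M *v x) $ j"
      using that by (simp add: matrix_vector_mult_def M_def cinner_def mult.commute)
    then show ?thesis using x by simp
  qed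
  with x that show ?thesis by blast
qed

text \<open>
  The orthogonal complement of given eigenvectors is invariant under \<open>H\<close>.  A maximum of
  \<open>\<langle>Hx, x\<rangle>\<close> on its unit sphere exists by compactness and is an eigenvector, because the first
  variation of \<open>m\<bar>x\<bar>\<^sup>2 - \<langle>Hx, x\<rangle> \<ge> 0\<close> vanishes there.
\<close>
lemma hermitian_eigenvector:
  fixes H :: "'n::finite cmat" and f :: "'n \<Rightarrow> complex^'n"
  assumes H: "ctranspose H = H" and i: "i \<notin> S"
    and f: "\<And>j. j \<in> S \<Longrightarrow> H *v f j = complex_of_real (l j) *s f j"
  obtains x m where "norm x = 1" "\<And>j. j \<in> S \<Longrightarrow> cinner x (f j) = 0"
    "H *v x = complex_of_real m *s x"
proof -
  define V where "V = {x. \<forall>j\<in>S. cinner x (f j) = 0}"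
  have V_add: "x + r *\<^sub>R y \<in> V" if "x \<in> V" "y \<in> V" for x y r
    using that by (simp add: V_def cinner_add_left cinner_scale_left scaleR_eq_smult)
  have V_scale: "r *\<^sub>R y \<in> V" if "y \<in> V" for y r
    using that by (simp add: V_def cinner_scale_left scaleR_eq_smult)
  have "closed V"
  proof -
    have "closed {x. cinner x (f j) = 0}" for j
      by (intro closed_Collect_eq continuous_intros
          bounded_linear.continuous_on[OF bounded_bilinear.bounded_linear_left[OF bounded_bilinear_cinner]])
    then have "closed (\<Inter>j\<in>S. {x. cinner x (f j) = 0})" by blast
    moreover have "V = (\<Inter>j\<in>S. {x. cinner x (f j) = 0})" by (auto simp: V_def)
    ultimately show ?thesis by simp
  qed
  then have "compact (V \<inter> sphere 0 1)" by (intro closed_Int_compact compact_sphere)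
  moreover have "V \<inter> sphere 0 1 \<noteq> {}"
  proof -
    obtain x where x: "x \<noteq> 0" "\<And>j. j \<in> S \<Longrightarrow> cinner x (f j) = 0"
      by (rule ex_orthogonal[OF i, of f]) blast
    then have "x \<in> V" by (simp add: V_def)
    with x(1) have "(1 / norm x) *\<^sub>R x \<in> V \<inter> sphere 0 1" using V_scale by simp
    then show ?thesis by blast
  qed
  moreover have lin: "bounded_linear ((*v) H)"
    unfolding linear_conv_bounded_linear[symmetric]
    by (rule linearI) (simp_all add: matrix_vector_right_distrib scaleR_eq_smult vector_scalar_commute)
  have "continuous_on (V \<inter> sphere 0 1) (\<lambda>x. (H *v x) \<bullet> x)"
    by (intro continuous_on_inner bounded_linear.continuous_on[OF lin] continuous_on_id)
  ultimately obtain x where attained: "x \<in> V \<inter> sphere 0 1"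
      "\<forall>y\<in>V \<inter> sphere 0 1. (H *v y) \<bullet> y \<le> (H *v x) \<bullet> x"
    using continuous_attains_sup[of "V \<inter> sphere 0 1" "\<lambda>x. (H *v x) \<bullet> x"] by blast
  then have x: "x \<in> V" "norm x = 1" by auto
  have max: "(H *v y) \<bullet> y \<le> (H *v x) \<bullet> x" if "y \<in> V" "norm y = 1" for y
    using attained(2) that by simp
  define m where "m = (H *v x) \<bullet> x"
  have H_scale: "H *v (r *\<^sub>R y) = r *\<^sub>R (H *v y)" for r y
    by (simp add: scaleR_eq_smult vector_scalar_commute)
  have H_sym: "(H *v y) \<bullet> z = (H *v z) \<bullet> y" for y z
    by (metis H Re_cinner cinner_adjoint inner_commute)
  have quad: "(H *v y) \<bullet> y \<le> m * (y \<bullet> y)" if "y \<in> V" for y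
  proof (cases "y = 0")
    case False
    define z where "z = (1 / norm y) *\<^sub>R y"
    have z: "norm z = 1" "z \<in> V" using False that V_scale by (auto simp: z_def)
    have y: "y = norm y *\<^sub>R z" using False by (simp add: z_def)
    have "(H *v y) \<bullet> y = (norm y)\<^sup>2 * ((H *v z) \<bullet> z)"
      by (subst (1 2) y) (simp add: H_scale power2_eq_square)
    also have "\<dots> \<le> (norm y)\<^sup>2 * m"
      using max[OF z(2,1)] by (simp add: m_def mult_left_mono)
    finally show ?thesis by (simp add: power2_norm_eq_inner mult.commute)
  qed simp
  have crit: "(H *v x - m *\<^sub>R x) \<bullet> y = 0" if y: "y \<in> V" for y
  proof -
    have "0 \<le> (2 * (m * (x \<bullet> y) - (H *v x) \<bullet> y)) * t + (m * (y \<bullet> y) - (H *v y) \<bullet> y) * t\<^sup>2" for t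
    proof -
      have "(H *v (x + t *\<^sub>R y)) \<bullet> (x + t *\<^sub>R y) \<le> m * ((x + t *\<^sub>R y) \<bullet> (x + t *\<^sub>R y))"
        by (rule quad[OF V_add[OF x(1) y]])
      moreover have "(H *v (x + t *\<^sub>R y)) \<bullet> (x + t *\<^sub>R y) =
          m + 2 * t * ((H *v x) \<bullet> y) + t\<^sup>2 * ((H *v y) \<bullet> y)"
        by (simp add: matrix_vector_right_distrib H_scale inner_add m_def H_sym[of y x]
            power2_eq_square algebra_simps)
      moreover have "(x + t *\<^sub>R y) \<bullet> (x + t *\<^sub>R y) = 1 + 2 * t * (x \<bullet> y) + t\<^sup>2 * (y \<bullet> y)"
        using x(2) by (simp add: inner_add norm_eq_1 inner_commute[of y x] power2_eq_square algebra_simps)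
      ultimately have "m + 2 * t * ((H *v x) \<bullet> y) + t\<^sup>2 * ((H *v y) \<bullet> y)
          \<le> m * (1 + 2 * t * (x \<bullet> y) + t\<^sup>2 * (y \<bullet> y))"
        by (simp only:)
      then show ?thesis by (simp add: algebra_simps)
    qed
    then have "2 * (m * (x \<bullet> y) - (H *v x) \<bullet> y) = 0" by (rule linear_le_quadratic_imp_0)
    then show ?thesis by (simp add: inner_diff_left)
  qed
  have "H *v x \<in> V"
    using x(1) f by (auto simp: V_def cinner_adjoint H cinner_scale_right)
  then have "H *v x - m *\<^sub>R x \<in> V"
    using V_add[OF _ x(1), of "H *v x" "- m"] by simp
  from crit[OF this] have "H *v x = m *\<^sub>R x" by simp
  then show ?thesis using that[of x m] x by (auto simp: V_def scaleR_eq_smult)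
qed

lemma hermitian_eigenbasis:
  fixes H :: "'n::finite cmat"
  assumes H: "ctranspose H = H"
  obtains f :: "'n \<Rightarrow> complex^'n" and l where "\<And>i j. cinner (f i) (f j) = (if i = j then 1 else 0)"
    "\<And>i. H *v f i = complex_of_real (l i) *s f i"
proof -
  have "\<exists>(f :: 'n \<Rightarrow> complex^'n) l. (\<forall>i\<in>S. \<forall>j\<in>S. cinner (f i) (f j) = (if i = j then 1 else 0)) \<and>
      (\<forall>i\<in>S. H *v f i = complex_of_real (l i) *s f i)" for S :: "'n set"
  proof (induction S rule: finite_induct[OF finite])
    case 1 then show ?case by simp
  next
    case (2 i S)
    then obtain f l where fl: "\<And>i j. i \<in> S \<Longrightarrow> j \<in> S \<Longrightarrow> cinner (f i) (f j) = (if i = j then 1 else 0)"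
      "\<And>i. i \<in> S \<Longrightarrow> H *v f i = complex_of_real (l i) *s f i" by blast
    obtain x m where x: "norm x = 1" "\<And>j. j \<in> S \<Longrightarrow> cinner x (f j) = 0"
      "H *v x = complex_of_real m *s x"
      by (rule hermitian_eigenvector[OF H \<open>i \<notin> S\<close>, of f l]) (use fl(2) in auto)
    then have "\<And>j. j \<in> S \<Longrightarrow> cinner (f j) x = 0" by (simp add: cinner_eq_0_commute)
    moreover have "cinner x x = 1" using x by (simp add: cinner_self)
    ultimately show ?case using fl x 2
      by (intro exI[of _ "f(i := x)"] exI[of _ "l(i := m)"]) auto
  qed
  from this[of UNIV] that show ?thesis by auto
qed

definition cdiag :: "('n \<Rightarrow> complex) \<Rightarrow> 'n::finite cmat" where
  "cdiag d = (\<chi> i j. if i = j then d i else 0)"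

lemma cdiag_mult_nth:
  "(cdiag d ** A) $ i $ j = d i * A $ i $ j" "(A ** cdiag d) $ i $ j = A $ i $ j * d j"
  unfolding cdiag_def by (rule diag_mult_nth)+

lemma det_cdiag: "det (cdiag d) = prod d UNIV"
  by (subst det_diagonal) (simp_all add: cdiag_def)

lemma cdiag_axis: "cdiag d *v axis i 1 = d i *s axis i 1"
  by (simp add: vec_eq_iff mult_axis_nth) (simp add: cdiag_def axis_def)

text \<open>
  Multiplying one column by a phase corrects the determinant.
\<close>
lemma unitary_phase:
  fixes U :: "'n::finite cmat"
  assumes U: "ctranspose U ** U = mat 1"
  obtains d where "\<And>i. cmod (d i) = 1" "U ** cdiag d \<in> SU"
proof -
  obtain i0 :: 'n where True by simp
  have one: "cnj (det U) * det U = 1"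
    using arg_cong[OF U, of det] by (simp add: det_mul det_ctranspose)
  then have "complex_of_real ((cmod (det U))\<^sup>2) = 1"
    by (metis complex_norm_square mult.commute)
  then have n1: "cmod (det U) = 1"
    by (metis norm_ge_zero of_real_eq_1_iff power2_eq_1_iff abs_of_nonneg abs_neg_one abs_one)
  define d where "d i = (if i = i0 then cnj (det U) else 1)" for i
  have d: "cmod (d i) = 1" for i using n1 by (simp add: d_def)
  then have dd: "d i * cnj (d i) = 1" for i
    by (metis complex_norm_square mult_1 of_real_1 power_one)
  have "prod d UNIV = cnj (det U)"
    unfolding d_def by (simp add: prod.delta)
  then have "det (U ** cdiag d) = 1" using one by (simp add: det_mul det_cdiag mult.commute)
  moreover have "U ** cdiag d ** ctranspose (U ** cdiag d) = mat 1"
  proof -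
    have "cdiag d ** ctranspose (cdiag d) = mat 1"
      by (simp add: vec_eq_iff cdiag_mult_nth) (simp add: cdiag_def mat_def dd)
    then have "U ** cdiag d ** ctranspose (U ** cdiag d) = U ** ctranspose U"
      by (metis ctranspose_mult matrix_mul_assoc matrix_mul_rid)
    also have "\<dots> = mat 1" using U matrix_left_right_inverse by blast
    finally show ?thesis .
  qed
  ultimately have "U ** cdiag d \<in> SU" by (simp add: SU_def SL_def)
  with d that show ?thesis by blast
qed

text \<open>
  Diagonalize \<open>g g\<^sup>* = k exp(2 diag \<xi>) k\<^sup>*\<close>; then \<open>exp(-diag \<xi>) k\<^sup>* g\<close> is unitary.
\<close>
lemma cartan_decomposition:
  fixes g :: "'n::finite cmat"
  assumes g: "g \<in> SL"
  obtains k \<xi> k' where "k \<in> SU" "k' \<in> SU" "trace0 \<xi>" "g = k ** dexp \<xi> ** k'"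
proof -
  define P where "P = g ** ctranspose g"
  have "ctranspose P = P" by (simp add: P_def ctranspose_mult)
  then obtain f :: "'n \<Rightarrow> complex^'n" and l where f: "\<And>i j. cinner (f i) (f j) = (if i = j then 1 else 0)"
    and l: "\<And>i. P *v f i = complex_of_real (l i) *s f i"
    by (rule hermitian_eigenbasis) blast
  define U :: "'n cmat" where "U = (\<chi> i j. f j $ i)"
  have Uf: "U *v axis i 1 = f i" for i by (simp add: U_def vec_eq_iff mult_axis_nth)
  have UU: "ctranspose U ** U = mat 1"
    by (simp add: vec_eq_iff ctranspose_mult_nth Uf f mat_def)
  obtain d where d: "\<And>i. cmod (d i) = 1" "U ** cdiag d \<in> SU" using unitary_phase[OF UU] by blast
  define k where "k = U ** cdiag d"
  have k: "k \<in> SU" using d by (simp add: k_def)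
  have detg: "det (ctranspose g) \<noteq> 0" using g by (simp add: det_ctranspose SL_def)
  have lpos: "0 < l i" for i
  proof -
    have "complex_of_real (l i) = cinner (P *v f i) (f i)" by (simp add: l cinner_scale_left f)
    also have "\<dots> = cinner (ctranspose g *v f i) (ctranspose g *v f i)"
      by (simp add: P_def cinner_adjoint flip: matrix_vector_mul_assoc)
    also have "\<dots> = complex_of_real ((norm (ctranspose g *v f i))\<^sup>2)" by (rule cinner_self)
    finally have "l i = (norm (ctranspose g *v f i))\<^sup>2" by (simp only: of_real_eq_iff)
    moreover have "ctranspose g *v f i \<noteq> 0"
    proof
      assume "ctranspose g *v f i = 0"
      moreover have "inj ((*v) (ctranspose g))"
        using detg by (simp add: inj_matrix_vector_mult invertible_det_nz)
      ultimately have "f i = 0" by (metis injD matrix_vector_mult_0_right)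
      then show False using f[of i i] by simp
    qed
    ultimately show ?thesis by simp
  qed
  define \<xi> :: "real^'n" where "\<xi> = (\<chi> i. ln (l i) / 2)"
  have "P ** k = k ** dexp (\<xi> + \<xi>)"
  proof (rule matrix_eqI_axis)
    fix i
    have ka: "k *v axis i 1 = d i *s f i"
      by (simp add: k_def cdiag_axis vector_scalar_commute Uf flip: matrix_vector_mul_assoc)
    have "exp ((\<xi> + \<xi>) $ i) = l i" using lpos by (simp add: \<xi>_def)
    then show "(P ** k) *v axis i 1 = (k ** dexp (\<xi> + \<xi>)) *v axis i 1"
      by (simp only: matrix_vector_mul_assoc[symmetric] dexp_axis scaleR_eq_smult vector_scalar_commute ka l)
         (simp add: mult.commute)
  qed
  then have kPk: "ctranspose k ** P ** k = dexp (\<xi> + \<xi>)"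
    by (metis SU_ctranspose_mult[OF k] matrix_mul_assoc matrix_mul_lid)
  have "det (ctranspose k ** P ** k) = 1"
    using SU_SL[OF k] g by (simp add: P_def det_mul det_ctranspose SL_def)
  then have tr: "trace0 \<xi>"
    unfolding kPk by (intro det_dexp_eq_1[THEN trace0_double[THEN iffD1]])
  define k' where "k' = dexp (- \<xi>) ** ctranspose k ** g"
  have "k' ** ctranspose k' = dexp (- \<xi>) ** (ctranspose k ** P ** k) ** dexp (- \<xi>)"
    by (simp add: k'_def P_def ctranspose_mult matrix_mul_assoc)
  also have "\<dots> = mat 1"
    unfolding kPk dexp_add[symmetric] by simp
  finally have "k' ** ctranspose k' = mat 1" .
  moreover have "k' \<in> SL"
    unfolding k'_def
    by (intro SL_mult dexp_SL trace0_minus tr g SU_SL SU_ctranspose k)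
  ultimately have k': "k' \<in> SU" by (simp add: SU_def)
  have "k ** dexp \<xi> ** k' = k ** (dexp \<xi> ** dexp (-\<xi>)) ** ctranspose k ** g"
    by (simp add: k'_def matrix_mul_assoc)
  also have "\<dots> = g" using SU_mult_ctranspose[OF k] by (simp add: dexp_minus)
  finally show ?thesis using that k k' tr by metis
qed

section \<open>The distance formula\<close>

definition rdiag :: "real^'n \<Rightarrow> 'n::finite cmat" where
  "rdiag \<xi> = cdiag (\<lambda>i. complex_of_real (\<xi> $ i))"

text \<open>
  Writing diagonal matrices as sums over the matrix units reduces derivatives and series of diagonal
  matrices to scalar ones.
\<close>
definition diag_unit :: "'n \<Rightarrow> 'n::finite cmat" where
  "diag_unit k = (\<chi> i j. if i = k \<and> j = k then 1 else 0)"

lemma sum_diag_unit: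
  "(\<Sum>k\<in>UNIV. d k *\<^sub>R diag_unit k) = (\<chi> i j. if i = j then complex_of_real (d i) else 0)"
proof -
  have "(\<Sum>k\<in>UNIV. d k *\<^sub>R diag_unit k) $ i $ j = (if i = j then complex_of_real (d i) else 0)" for i j
  proof -
    have "(\<Sum>k\<in>UNIV. d k *\<^sub>R diag_unit k) $ i $ j = (\<Sum>k\<in>UNIV. if k = i then (if i = j then complex_of_real (d i) else 0) else 0)"
      unfolding sum_component by (rule sum.cong) (auto simp: diag_unit_def scaleR_conv_of_real[where 'a=complex])
    then show ?thesis by simp
  qed
  then show ?thesis by (simp add: vec_eq_iff)
qed

lemma dexp_vector_derivative:
  fixes g :: "'n::finite cmat"
  shows "((\<lambda>t. g ** dexp (t *\<^sub>R \<xi>)) has_vector_derivative g ** dexp (t *\<^sub>R \<xi>) ** rdiag \<xi>) (at t)"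
proof -
  have "((\<lambda>t. exp (t * \<xi> $ k)) has_vector_derivative exp (t * \<xi> $ k) * \<xi> $ k) (at t)" for k
    unfolding has_real_derivative_iff_has_vector_derivative[symmetric]
    by (auto intro!: derivative_eq_intros)
  then have "((\<lambda>t. \<Sum>k\<in>UNIV. exp (t * \<xi> $ k) *\<^sub>R diag_unit k) has_vector_derivative
      (\<Sum>k\<in>UNIV. (exp (t * \<xi> $ k) * \<xi> $ k) *\<^sub>R diag_unit k)) (at t)"
    by (intro has_vector_derivative_sum bounded_linear.has_vector_derivative[OF bounded_linear_scaleR_left])
  moreover have "(\<lambda>t. \<Sum>k\<in>UNIV. exp (t * \<xi> $ k) *\<^sub>R diag_unit k) = (\<lambda>t. dexp (t *\<^sub>R \<xi>))"
    by (simp add: sum_diag_unit dexp_def cong: if_cong)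
  moreover have "(\<Sum>k\<in>UNIV. (exp (t * \<xi> $ k) * \<xi> $ k) *\<^sub>R diag_unit k) = dexp (t *\<^sub>R \<xi>) ** rdiag \<xi>"
    unfolding sum_diag_unit by (simp add: vec_eq_iff rdiag_def cdiag_mult_nth) (simp add: dexp_def)
  ultimately have deriv: "((\<lambda>t. dexp (t *\<^sub>R \<xi>)) has_vector_derivative dexp (t *\<^sub>R \<xi>) ** rdiag \<xi>) (at t)"
    by simp
  have "bounded_linear ((**) g)"
    unfolding linear_conv_bounded_linear[symmetric]
    by (rule linearI) (simp_all add: vec_eq_iff matrix_matrix_mult_def algebra_simps sum.distrib scaleR_sum_right)
  from bounded_linear.has_vector_derivative[OF this deriv] show ?thesis
    by (simp only: matrix_mul_assoc)
qed

lemma speed_dexp: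
  fixes g :: "'n::finite cmat"
  assumes "g \<in> SL" "trace0 \<xi>"
  shows "speed (\<lambda>t. g ** dexp (t *\<^sub>R \<xi>)) t = knorm \<xi>"
proof -
  let ?D = "rdiag \<xi>"
  have "g ** dexp (t *\<^sub>R \<xi>) \<in> SL" using assms by (intro SL_mult dexp_SL trace0_scaleR)
  from matrix_inv_cancel_SL(1)[OF this]
  have "matrix_inv (g ** dexp (t *\<^sub>R \<xi>)) ** (g ** dexp (t *\<^sub>R \<xi>) ** ?D) = ?D" .
  moreover have "to_p ?D = ?D"
    by (simp add: vec_eq_iff to_p_def rdiag_def cdiag_def scaleR_conv_of_real[where 'a=complex])
  moreover have "killing ?D ?D = 4 * real CARD('n) * (norm \<xi>)\<^sup>2"
  proof -
    have "trace (?D ** ?D) = complex_of_real (\<Sum>i\<in>UNIV. (\<xi> $ i)\<^sup>2)"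
      by (simp add: trace_def rdiag_def cdiag_mult_nth) (simp add: cdiag_def power2_eq_square)
    then show ?thesis by (simp add: killing_def norm_vec_def L2_set_def sum_nonneg)
  qed
  ultimately show ?thesis
    by (simp add: speed_def vector_derivative_at[OF dexp_vector_derivative] knorm_def real_sqrt_mult)
qed

lemma dexp_admissible:
  fixes g :: "'n::finite cmat"
  assumes "g \<in> SL" "trace0 \<xi>"
  shows "admissible (\<lambda>t. g ** dexp (t *\<^sub>R \<xi>))" "curve_length (\<lambda>t. g ** dexp (t *\<^sub>R \<xi>)) = knorm \<xi>"
proof -
  have s: "speed (\<lambda>t. g ** dexp (t *\<^sub>R \<xi>)) = (\<lambda>t. knorm \<xi>)"
    using speed_dexp[OF assms] by auto
  show "curve_length (\<lambda>t. g ** dexp (t *\<^sub>R \<xi>)) = knorm \<xi>"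
    by (simp add: curve_length_def s)
  have "continuous_on UNIV (\<lambda>t. g ** dexp (t *\<^sub>R \<xi>) ** rdiag \<xi>)"
  proof -
    have cont: "continuous_on UNIV (\<lambda>t. g ** dexp (t *\<^sub>R \<xi>))"
      by (intro continuous_at_imp_continuous_on ballI has_vector_derivative_continuous[OF dexp_vector_derivative])
    have "bounded_linear (\<lambda>M :: 'n cmat. M ** rdiag \<xi>)"
      unfolding linear_conv_bounded_linear[symmetric]
      by (rule linearI) (simp_all add: vec_eq_iff matrix_matrix_mult_def algebra_simps sum.distrib scaleR_sum_right)
    from bounded_linear.continuous_on[OF this cont] show ?thesis .
  qed
  then have "continuous_on {0..1} (\<lambda>t. g ** dexp (t *\<^sub>R \<xi>) ** rdiag \<xi>)"
    by (rule continuous_on_subset) simp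
  then have "(\<lambda>t. g ** dexp (t *\<^sub>R \<xi>)) C1_differentiable_on {0..1}"
    unfolding C1_differentiable_on_def
    by (intro exI[of _ "\<lambda>t. g ** dexp (t *\<^sub>R \<xi>) ** rdiag \<xi>"]) (simp add: dexp_vector_derivative)
  then show "admissible (\<lambda>t. g ** dexp (t *\<^sub>R \<xi>))"
    using assms by (auto simp: admissible_def s C1_differentiable_imp_piecewise intro!: SL_mult dexp_SL trace0_scaleR)
qed

lemma ex_inj_nat: "\<exists>q :: 'n::finite \<Rightarrow> nat. inj q"
  using finite_imp_inj_to_nat_seg[of "UNIV :: 'n set"] by auto

lemma iwasawa_coset:
  assumes "a \<in> SL" "g \<in> SL" "h \<in> SL" "act g base = act h base"
  shows "iwasawa q (a ** g) = iwasawa q (a ** h)"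
proof -
  have "matrix_inv g ** h \<in> SU" using assms by (simp add: act_base_eq_iff)
  moreover have "h = g ** (matrix_inv g ** h)" using assms by (simp add: matrix_inv_cancel_SL)
  ultimately show ?thesis by (metis iwasawa_mult_SU matrix_mul_assoc)
qed

definition path_lengths :: "'n::finite point \<Rightarrow> 'n point \<Rightarrow> real set" where
  "path_lengths x y = {curve_length c | c. admissible c \<and> act (c 0) base = x \<and> act (c 1) base = y}"

lemma distZ_eq_Inf: "distZ x y = Inf (path_lengths x y)"
  by (simp add: distZ_def path_lengths_def admissible_def conj_assoc)

lemma path_lengths_ge:
  assumes "a \<in> SL" "g \<in> SL" "h \<in> SL" "inj q" "l \<in> path_lengths (act g base) (act h base)"
  shows "knorm (iwasawa q (a ** h) - iwasawa q (a ** g)) \<le> l"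
proof -
  obtain c where c: "admissible c" "act (c 0) base = act g base" "act (c 1) base = act h base"
    "l = curve_length c" using assms by (auto simp: path_lengths_def)
  have "c 0 \<in> SL" "c 1 \<in> SL" using c(1) by (auto simp: admissible_def)
  then show ?thesis
    using iwasawa_le_curve_length[OF c(1) assms(1,4)] iwasawa_coset[OF assms(1)] c assms by metis
qed

lemma knorm_in_path_lengths:
  assumes "g \<in> SL" "trace0 \<xi>"
  shows "knorm \<xi> \<in> path_lengths (act g base) (act (g ** dexp \<xi>) base)"
  unfolding path_lengths_def mem_Collect_eq
  by (rule exI[of _ "\<lambda>t. g ** dexp (t *\<^sub>R \<xi>)"]) (simp add: dexp_admissible assms)

text \<open>
  The curve \<open>t \<mapsto> g exp(t diag \<xi>)\<close> has this length, and no curve is shorter by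
  \<open>iwasawa_le_curve_length\<close> with \<open>a = g\<^sup>-\<^sup>1\<close>.
\<close>
lemma distZ_dexp:
  assumes "g \<in> SL" "trace0 \<xi>"
  shows "distZ (act g base) (act (g ** dexp \<xi>) base) = knorm \<xi>"
  unfolding distZ_eq_Inf
proof (rule cInf_eq_minimum[OF knorm_in_path_lengths[OF assms]])
  fix l assume l: "l \<in> path_lengths (act g base) (act (g ** dexp \<xi>) base)"
  obtain q :: "'a \<Rightarrow> nat" where "inj q" using ex_inj_nat by blast
  from path_lengths_ge[OF SL_matrix_inv[OF assms(1)] assms(1) SL_mult[OF assms(1) dexp_SL[OF assms(2)]] this l]
  show "knorm \<xi> \<le> l"
    using assms by (simp add: matrix_inv_mult_SL matrix_mul_assoc)
qed

lemma cartan_pair: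
  assumes "x \<in> Z" "y \<in> Z"
  obtains g \<xi> where "g \<in> SL" "trace0 \<xi>" "x = act g base" "y = act (g ** dexp \<xi>) base"
proof -
  obtain a b where ab: "a \<in> SL" "x = act a base" "b \<in> SL" "y = act b base"
    using assms by (metis Z_cases)
  have "matrix_inv a ** b \<in> SL" using ab by (intro SL_mult SL_matrix_inv)
  then obtain k \<xi> k' where k: "k \<in> SU" "k' \<in> SU" "trace0 \<xi>"
    "matrix_inv a ** b = k ** dexp \<xi> ** k'" by (rule cartan_decomposition)
  have "b = a ** (matrix_inv a ** b)" using ab by (simp add: matrix_inv_cancel_SL)
  also have "\<dots> = (a ** k ** dexp \<xi>) ** k'" unfolding k(4) by (simp only: matrix_mul_assoc)
  finally have "y = act (a ** k ** dexp \<xi>) base" using ab k by (simp add: act_mult_SU)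
  then show ?thesis using that[of "a ** k" \<xi>] ab k by (simp add: act_mult_SU SL_mult SU_SL)
qed

lemma iwasawa_lipschitz:
  assumes "a \<in> SL" "g \<in> SL" "h \<in> SL" "inj q"
  shows "knorm (iwasawa q (a ** h) - iwasawa q (a ** g)) \<le> distZ (act g base) (act h base)"
  unfolding distZ_eq_Inf
proof (rule cInf_greatest)
  show "path_lengths (act g base) (act h base) \<noteq> {}"
    using cartan_pair[OF act_base_Z[OF assms(2)] act_base_Z[OF assms(3)]] knorm_in_path_lengths
    by (metis empty_iff)
qed (use path_lengths_ge[OF assms] in blast)

lemma knorm_minus [simp]: "knorm (- \<xi>) = knorm \<xi>"
  and knorm_nonneg [simp]: "0 \<le> knorm \<xi>"
  and knorm_0 [simp]: "knorm 0 = 0"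
  and knorm_scaleR: "knorm (t *\<^sub>R \<xi>) = \<bar>t\<bar> * knorm \<xi>"
  by (simp_all add: knorm_def)

lemma knorm_triangle: "knorm (\<xi> + \<eta>) \<le> knorm \<xi> + knorm \<eta>"
  unfolding knorm_def distrib_left[symmetric] by (intro mult_left_mono norm_triangle_ineq) simp

lemma distZ_commute:
  assumes "x \<in> Z" "y \<in> Z" shows "distZ x y = distZ y x"
proof -
  obtain g \<xi> where g: "g \<in> SL" "trace0 \<xi>" "x = act g base" "y = act (g ** dexp \<xi>) base"
    using assms by (rule cartan_pair)
  have "distZ y (act (g ** dexp \<xi> ** dexp (- \<xi>)) base) = knorm (- \<xi>)"
    unfolding g(4) using g by (intro distZ_dexp SL_mult dexp_SL trace0_minus)
  moreover have "g ** dexp \<xi> ** dexp (- \<xi>) = g"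
    by (metis dexp_minus(2) matrix_mul_assoc matrix_mul_rid)
  ultimately show ?thesis using distZ_dexp g by (metis knorm_minus)
qed

lemma distZ_self: "x \<in> Z \<Longrightarrow> distZ x x = 0"
  using distZ_dexp[of _ 0] by (auto simp: Z_def trace0_def)

text \<open>
  The distance of \<open>x\<close> and \<open>z\<close> is attained by an Iwasawa projection, and \<open>y\<close> can be inserted there: the
  triangle inequality of the Killing norm and the Lipschitz estimate suffice.
\<close>
lemma distZ_triangle:
  assumes "x \<in> Z" "y \<in> Z" "z \<in> Z" shows "distZ x z \<le> distZ x y + distZ y z"
proof -
  obtain q :: "'a \<Rightarrow> nat" where q: "inj q" using ex_inj_nat by blast
  obtain g \<xi> where g: "g \<in> SL" "trace0 \<xi>" "x = act g base" "z = act (g ** dexp \<xi>) base"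
    using assms(1,3) by (rule cartan_pair)
  obtain h where h: "h \<in> SL" "y = act h base" using assms(2) by (rule Z_cases)
  note [simp] = matrix_inv_mult_SL[OF g(1)] matrix_mul_assoc
  let ?a = "matrix_inv g" let ?\<eta> = "iwasawa q (?a ** h)"
  have a: "?a \<in> SL" and gd: "g ** dexp \<xi> \<in> SL" using g by (auto simp: SL_matrix_inv SL_mult dexp_SL)
  have "distZ x z = knorm (?\<eta> + (\<xi> - ?\<eta>))" using distZ_dexp g by simp
  also have "\<dots> \<le> knorm ?\<eta> + knorm (\<xi> - ?\<eta>)" by (rule knorm_triangle)
  also have "knorm ?\<eta> \<le> distZ x y"
    using iwasawa_lipschitz[OF a g(1) h(1) q] g h by simp
  also have "knorm (\<xi> - ?\<eta>) \<le> distZ y z"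
    using iwasawa_lipschitz[OF a h(1) gd q] g h by simp
  finally show ?thesis by simp
qed

lemma distZ_act:
  assumes "a \<in> SL" "x \<in> Z" "y \<in> Z" shows "distZ (act a x) (act a y) = distZ x y"
proof -
  obtain g \<xi> where g: "g \<in> SL" "trace0 \<xi>" "x = act g base" "y = act (g ** dexp \<xi>) base"
    using assms(2,3) by (rule cartan_pair)
  then show ?thesis
    using distZ_dexp[OF g(1,2)] distZ_dexp[OF SL_mult[OF assms(1) g(1)] g(2)]
    by (simp add: act_act matrix_mul_assoc)
qed

lemma act_Z: "a \<in> SL \<Longrightarrow> x \<in> Z \<Longrightarrow> act a x \<in> Z"
  by (auto simp: Z_def act_act SL_mult)

text \<open>
  In an order starting with \<open>i\<close> the projection gives the length of row \<open>i\<close> of \<open>h\<close>, which is therefore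
  1.  In an order starting with \<open>j, i\<close> it gives the distance of row \<open>i\<close> from the line spanned by row \<open>j\<close>, which
  is 1 as well, so by Pythagoras the rows \<open>i\<close> and \<open>j\<close> are orthogonal.
\<close>
lemma iwasawa_all_0_imp_SU:
  fixes h :: "'n::finite cmat"
  assumes h: "h \<in> SL" and z: "\<And>q. inj q \<Longrightarrow> iwasawa q h = 0"
  shows "h \<in> SU"
proof -
  let ?v = "\<lambda>i. ctranspose h *v axis i 1"
  obtain q0 :: "'n \<Rightarrow> nat" where q0: "inj q0" using ex_inj_nat by blast
  have det: "det (ctranspose h) \<noteq> 0" using h by (simp add: SL_def det_ctranspose)
  have gs1: "norm (gs q ?v i) = 1" if "inj q" for q i
  proof -
    have "ln (norm (gs q ?v i)) = 0" using z[OF that] by (simp add: iwasawa_def vec_eq_iff)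
    then show ?thesis using gs_nonzero[OF that det, of i] by simp
  qed
  have n1: "norm (?v i) = 1" for i
  proof -
    \<comment> \<open>The order that starts with \<open>i\<close>.\<close>
    define q where "q = (\<lambda>k. if k = i then 0 else Suc (q0 k))"
    have "inj q" using q0 by (auto simp: q_def inj_def)
    moreover have "gs q ?v i = ?v i" by (subst gs.simps) (simp add: q_def)
    ultimately show ?thesis using gs1 by metis
  qed
  have orth: "cinner (?v i) (?v j) = 0" if "i \<noteq> j" for i j
  proof -
    \<comment> \<open>The order that starts with \<open>j, i\<close>.\<close>
    define q where "q = (\<lambda>k. if k = j then 0 else if k = i then 1 else q0 k + 2)"
    have q: "inj q" using q0 by (auto simp: q_def inj_def)
    have J: "{k. q k < q i} = {j}" using that by (auto simp: q_def)
    have j: "gs q ?v j = ?v j" by (subst gs.simps) (simp add: q_def)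
    have c: "cinner (?v j) (?v j) = 1" by (simp add: cinner_self n1)
    have "gs q ?v i = ?v i - cinner (?v i) (?v j) *s ?v j"
      by (subst gs.simps) (simp add: J j c)
    then have v: "?v i = gs q ?v i + cinner (?v i) (?v j) *s ?v j" by simp
    have "cinner (gs q ?v i) (?v j) = 0" using gs_orthogonal[OF q that, of ?v] j by simp
    then have o: "cinner (gs q ?v i) (?v j) = 0" "cinner (?v j) (gs q ?v i) = 0"
      by (simp_all add: cinner_eq_0_commute)
    have "1 = cinner (?v i) (?v i)" by (simp add: cinner_self n1)
    also have "\<dots> = cinner (gs q ?v i) (gs q ?v i) + cinner (?v i) (?v j) * cnj (cinner (?v i) (?v j))"
      by (subst (1 2) v) (simp add: cinner_add_left cinner_add_right cinner_scale_left cinner_scale_right o c)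
    also have "\<dots> = 1 + cinner (?v i) (?v j) * cnj (cinner (?v i) (?v j))"
      by (simp add: cinner_self[of "gs q ?v i"] gs1[OF q])
    finally show ?thesis by simp
  qed
  have "(h ** ctranspose h) $ i $ j = (mat 1 :: 'n cmat) $ i $ j" for i j
  proof -
    have "(h ** ctranspose h) $ i $ j = cinner (?v j) (?v i)"
      using ctranspose_mult_nth[of "ctranspose h" "ctranspose h" i j] by simp
    then show ?thesis using orth[of j i] by (auto simp: mat_def cinner_self n1)
  qed
  then have "h ** ctranspose h = mat 1" by (simp add: vec_eq_iff)
  with h show ?thesis by (simp add: SU_def)
qed

section \<open>Geodesics\<close>

definition line :: "'n::finite cmat \<Rightarrow> real^'n \<Rightarrow> real \<Rightarrow> 'n point" where
  "line g \<xi> t = act (g ** dexp (t *\<^sub>R \<xi>)) base"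

lemma line_shift: "line (g ** dexp (s *\<^sub>R \<xi>)) \<xi> t = line g \<xi> (s + t)"
  by (simp add: line_def dexp_scaleR_add matrix_mul_assoc)

lemma line_scale: "line g (r *\<^sub>R \<xi>) t = line g \<xi> (r * t)"
  by (simp add: line_def mult.commute)

lemma act_line: "act a (line g \<xi> t) = line (a ** g) \<xi> t"
  by (simp add: line_def act_act matrix_mul_assoc)

lemma line_Z: "g \<in> SL \<Longrightarrow> trace0 \<xi> \<Longrightarrow> line g \<xi> t \<in> Z"
  by (simp add: line_def act_base_Z SL_mult dexp_scaleR_SL)

lemma distZ_line:
  assumes "g \<in> SL" "trace0 \<xi>"
  shows "distZ (line g \<xi> s) (line g \<xi> t) = knorm \<xi> * \<bar>s - t\<bar>"
proof -
  have "line g \<xi> t = act (g ** dexp (s *\<^sub>R \<xi>) ** dexp ((t - s) *\<^sub>R \<xi>)) base"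
    using dexp_scaleR_add[of s "t - s" \<xi>] by (simp add: line_def flip: matrix_mul_assoc)
  then have "distZ (line g \<xi> s) (line g \<xi> t) = knorm ((t - s) *\<^sub>R \<xi>)"
    unfolding line_def[of g \<xi> s] using assms trace0_scaleR[OF assms(2)]
    by (simp add: distZ_dexp SL_mult dexp_scaleR_SL)
  then show ?thesis by (simp add: knorm_scaleR abs_minus_commute mult.commute)
qed

text \<open>
  The two balls, centred at \<open>-l\<xi>\<close> and \<open>m\<xi>\<close>, touch only in \<open>0\<close>.
\<close>
lemma between_imp_0:
  fixes y \<xi> :: "'a::real_inner"
  assumes "0 \<le> l" "0 \<le> m" "norm (y + l *\<^sub>R \<xi>) \<le> l * norm \<xi>" "norm (m *\<^sub>R \<xi> - y) \<le> m * norm \<xi>"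
  shows "y = 0"
proof -
  have "(norm (y + l *\<^sub>R \<xi>))\<^sup>2 \<le> (l * norm \<xi>)\<^sup>2" "(norm (m *\<^sub>R \<xi> - y))\<^sup>2 \<le> (m * norm \<xi>)\<^sup>2"
    using assms by (auto intro!: power_mono)
  moreover have "(norm (y + l *\<^sub>R \<xi>))\<^sup>2 = y \<bullet> y + 2 * (l * (y \<bullet> \<xi>)) + (l * norm \<xi>)\<^sup>2"
    "(norm (m *\<^sub>R \<xi> - y))\<^sup>2 = y \<bullet> y - 2 * (m * (y \<bullet> \<xi>)) + (m * norm \<xi>)\<^sup>2"
    unfolding power_mult_distrib power2_norm_eq_inner
    by (simp_all add: inner_add inner_diff inner_commute[of \<xi> y] power2_eq_square algebra_simps)
  ultimately have 1: "y \<bullet> y + 2 * (l * (y \<bullet> \<xi>)) \<le> 0" and 2: "y \<bullet> y - 2 * (m * (y \<bullet> \<xi>)) \<le> 0"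
    by linarith+
  have "y \<bullet> y \<le> 0"
  proof (cases "y \<bullet> \<xi> \<le> 0")
    case True
    then have "m * (y \<bullet> \<xi>) \<le> 0" using assms(2) by (simp add: mult_nonneg_nonpos)
    with 2 show ?thesis by linarith
  next
    case False
    then have "0 \<le> l * (y \<bullet> \<xi>)" using assms(1) by simp
    with 1 show ?thesis by linarith
  qed
  then show ?thesis by (metis inner_eq_zero_iff inner_ge_zero order_antisym)
qed

lemma knorm_le_iff: "knorm (\<xi> :: real^'n::finite) \<le> r * knorm (\<eta> :: real^'n) \<longleftrightarrow> norm \<xi> \<le> r * norm \<eta>"
proof -
  have "0 < sqrt (4 * real CARD('n))" by simp
  moreover have "r * knorm \<eta> = sqrt (4 * real CARD('n)) * (r * norm \<eta>)" by (simp add: knorm_def)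
  ultimately show ?thesis unfolding knorm_def[of \<xi>] by (simp only: mult_le_cancel_left_pos)
qed

text \<open>
  Translate the candidate \<open>line g \<xi> s\<close> to the base point.  By the Lipschitz estimate every Iwasawa
  projection of \<open>x\<close> lies in two touching balls, so it is \<open>0\<close>, and \<open>x\<close> is the base point.
\<close>
lemma between_unique:
  fixes g :: "'n::finite cmat"
  assumes g: "g \<in> SL" "trace0 \<xi>" and x: "x \<in> Z" and s: "a \<le> s" "s \<le> b"
    and d: "distZ (line g \<xi> a) x = knorm \<xi> * (s - a)" "distZ x (line g \<xi> b) = knorm \<xi> * (b - s)"
  shows "x = line g \<xi> s"
proof -
  obtain h where h: "h \<in> SL" "x = act h base" using x by (rule Z_cases)
  define k where "k = g ** dexp (s *\<^sub>R \<xi>)"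
  have k: "k \<in> SL" by (simp add: k_def g SL_mult dexp_scaleR_SL)
  have k_line: "line g \<xi> (s + t) = act (k ** dexp (t *\<^sub>R \<xi>)) base" for t
    by (simp add: k_def line_def dexp_scaleR_add matrix_mul_assoc)
  have kd: "k ** dexp (t *\<^sub>R \<xi>) \<in> SL" for t by (simp add: k g SL_mult dexp_scaleR_SL)
  let ?k = "matrix_inv k"
  have kk: "?k \<in> SL" using k by (rule SL_matrix_inv)
  have "iwasawa q (?k ** h) = 0" if q: "inj q" for q
  proof (rule between_imp_0)
    show "0 \<le> s - a" "0 \<le> b - s" using s by auto
    have "knorm (iwasawa q (?k ** h) - iwasawa q (?k ** (k ** dexp ((a - s) *\<^sub>R \<xi>)))) \<le> (s - a) * knorm \<xi>"
      using iwasawa_lipschitz[OF kk kd h(1) q, of "a - s"] d(1) k_line[of "a - s"] h(2) by (simp add: mult.commute)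
    then have "knorm (iwasawa q (?k ** h) + (s - a) *\<^sub>R \<xi>) \<le> (s - a) * knorm \<xi>"
      by (simp add: matrix_inv_cancel_SL[OF k] algebra_simps)
    then show "norm (iwasawa q (?k ** h) + (s - a) *\<^sub>R \<xi>) \<le> (s - a) * norm \<xi>"
      by (simp only: knorm_le_iff)
    have "knorm (iwasawa q (?k ** (k ** dexp ((b - s) *\<^sub>R \<xi>))) - iwasawa q (?k ** h)) \<le> (b - s) * knorm \<xi>"
      using iwasawa_lipschitz[OF kk h(1) kd q, of "b - s"] d(2) k_line[of "b - s"] h(2) by (simp add: mult.commute)
    then show "norm ((b - s) *\<^sub>R \<xi> - iwasawa q (?k ** h)) \<le> (b - s) * norm \<xi>"
      by (simp add: matrix_inv_cancel_SL[OF k] knorm_le_iff)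
  qed
  then have "?k ** h \<in> SU" by (intro iwasawa_all_0_imp_SU SL_mult kk h)
  then have "act k base = act h base" using k h by (simp add: act_base_eq_iff)
  then show ?thesis using k_line[of 0] h by simp
qed

text \<open>
  If both \<open>k\<close> and \<open>exp(-s diag \<xi>) k exp(s diag \<xi>')\<close> are unitary, then
  \<open>k exp(2s diag \<xi>') k\<^sup>* = exp(2s diag \<xi>)\<close>; compare entries of
  \<open>k exp(2s diag \<xi>') = exp(2s diag \<xi>) k\<close>.
\<close>
lemma intertwine_entries:
  fixes k :: "'n::finite cmat"
  assumes k: "k \<in> SU" and l: "dexp (- (s *\<^sub>R \<xi>)) ** k ** dexp (s *\<^sub>R \<xi>') \<in> SU" and s: "s \<noteq> 0"
  shows "k $ i $ j = 0 \<or> \<xi> $ i = \<xi>' $ j"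
proof -
  let ?l = "dexp (- (s *\<^sub>R \<xi>)) ** k ** dexp (s *\<^sub>R \<xi>')"
  have "?l ** ctranspose ?l = mat 1" using l by (rule SU_mult_ctranspose)
  then have eq: "dexp (- (s *\<^sub>R \<xi>)) ** (k ** dexp (s *\<^sub>R \<xi>' + s *\<^sub>R \<xi>') ** ctranspose k) ** dexp (- (s *\<^sub>R \<xi>)) = mat 1"
    by (simp only: ctranspose_mult ctranspose_dexp dexp_add matrix_mul_assoc)
  let ?P = "k ** dexp (s *\<^sub>R \<xi>' + s *\<^sub>R \<xi>') ** ctranspose k"
  have "?P = (dexp (s *\<^sub>R \<xi>) ** dexp (- (s *\<^sub>R \<xi>))) ** ?P ** (dexp (- (s *\<^sub>R \<xi>)) ** dexp (s *\<^sub>R \<xi>))"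
    by (simp add: dexp_minus)
  also have "\<dots> = dexp (s *\<^sub>R \<xi>) ** (dexp (- (s *\<^sub>R \<xi>)) ** ?P ** dexp (- (s *\<^sub>R \<xi>))) ** dexp (s *\<^sub>R \<xi>)"
    by (simp only: matrix_mul_assoc)
  also have "\<dots> = dexp (s *\<^sub>R \<xi> + s *\<^sub>R \<xi>)"
    unfolding eq by (simp only: dexp_add matrix_mul_rid)
  finally have P: "?P = dexp (s *\<^sub>R \<xi> + s *\<^sub>R \<xi>)" .
  have "k ** dexp (s *\<^sub>R \<xi>' + s *\<^sub>R \<xi>') = ?P ** k"
    using SU_ctranspose_mult[OF k] by (simp flip: matrix_mul_assoc)
  then have "k ** dexp (s *\<^sub>R \<xi>' + s *\<^sub>R \<xi>') = dexp (s *\<^sub>R \<xi> + s *\<^sub>R \<xi>) ** k"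
    unfolding P .
  then have "(k ** dexp (s *\<^sub>R \<xi>' + s *\<^sub>R \<xi>')) $ i $ j = (dexp (s *\<^sub>R \<xi> + s *\<^sub>R \<xi>) ** k) $ i $ j"
    by simp
  then have "k $ i $ j * complex_of_real (exp ((s *\<^sub>R \<xi>' + s *\<^sub>R \<xi>') $ j))
      = complex_of_real (exp ((s *\<^sub>R \<xi> + s *\<^sub>R \<xi>) $ i)) * k $ i $ j"
    by (simp only: dexp_mult_nth)
  then have "k $ i $ j = 0 \<or> complex_of_real (exp ((s *\<^sub>R \<xi>' + s *\<^sub>R \<xi>') $ j))
      = complex_of_real (exp ((s *\<^sub>R \<xi> + s *\<^sub>R \<xi>) $ i))"
    by (metis mult.commute mult_cancel_left)
  then have "k $ i $ j = 0 \<or> (s *\<^sub>R \<xi>' + s *\<^sub>R \<xi>') $ j = (s *\<^sub>R \<xi> + s *\<^sub>R \<xi>) $ i"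
    by (simp only: of_real_eq_iff exp_inj_iff)
  then have "k $ i $ j = 0 \<or> (2 * s) * \<xi>' $ j = (2 * s) * \<xi> $ i" by simp
  then show ?thesis using s by (simp only: mult_cancel_left) auto
qed

lemma intertwine:
  fixes k :: "'n::finite cmat"
  assumes "\<And>i j. k $ i $ j = 0 \<or> \<xi> $ i = \<xi>' $ j"
  shows "k ** dexp (t *\<^sub>R \<xi>') = dexp (t *\<^sub>R \<xi>) ** k"
proof -
  have "(k ** dexp (t *\<^sub>R \<xi>')) $ i $ j = (dexp (t *\<^sub>R \<xi>) ** k) $ i $ j" for i j
    using assms[of i j] by (auto simp: dexp_mult_nth)
  then show ?thesis by (simp add: vec_eq_iff)
qed

text \<open>
  Two common points, at times \<open>a\<close> and \<open>b\<close>, provide the two unitary matrices that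
  \<open>intertwine_entries\<close> asks for, with \<open>s = b - a\<close>.
\<close>
lemma line_eq_entries:
  fixes g :: "'n::finite cmat"
  assumes g: "g \<in> SL" "trace0 \<xi>" "g' \<in> SL" "trace0 \<xi>'" and ab: "a \<noteq> b"
    and eq: "line g \<xi> a = line g' \<xi>' a" "line g \<xi> b = line g' \<xi>' b"
  defines "k \<equiv> matrix_inv (g ** dexp (a *\<^sub>R \<xi>)) ** (g' ** dexp (a *\<^sub>R \<xi>'))"
  shows "k \<in> SU" "k $ i $ j = 0 \<or> \<xi> $ i = \<xi>' $ j"
proof -
  have SL: "g ** dexp (t *\<^sub>R \<xi>) \<in> SL" "g' ** dexp (t *\<^sub>R \<xi>') \<in> SL" for t
    using g by (simp_all add: SL_mult dexp_scaleR_SL)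
  show k: "k \<in> SU" unfolding k_def using eq(1) SL by (simp add: line_def act_base_eq_iff)
  have gk: "g' ** dexp (a *\<^sub>R \<xi>') = g ** dexp (a *\<^sub>R \<xi>) ** k"
    unfolding k_def by (rule matrix_inv_cancel_SL(2)[OF SL(1), symmetric])
  have "matrix_inv (g ** dexp (b *\<^sub>R \<xi>)) ** (g' ** dexp (b *\<^sub>R \<xi>')) \<in> SU"
    using eq(2) SL by (simp add: line_def act_base_eq_iff)
  moreover have "g' ** dexp (b *\<^sub>R \<xi>') = g ** dexp (a *\<^sub>R \<xi>) ** k ** dexp ((b - a) *\<^sub>R \<xi>')"
    unfolding gk[symmetric] using dexp_scaleR_add[of a "b - a" \<xi>'] by (simp flip: matrix_mul_assoc)
  moreover have "matrix_inv (g ** dexp (b *\<^sub>R \<xi>)) = dexp (- ((b - a) *\<^sub>R \<xi>)) ** matrix_inv (g ** dexp (a *\<^sub>R \<xi>))"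
  proof -
    have e: "- (b *\<^sub>R \<xi>) = - ((b - a) *\<^sub>R \<xi>) + - (a *\<^sub>R \<xi>)" by (simp add: algebra_simps)
    have "matrix_inv (g ** dexp (t *\<^sub>R \<xi>)) = dexp (- (t *\<^sub>R \<xi>)) ** matrix_inv g" for t
      using g by (simp add: matrix_inv_mult dexp_scaleR_SL matrix_inv_dexp)
    then show ?thesis by (simp only: e dexp_add matrix_mul_assoc)
  qed
  ultimately have "dexp (- ((b - a) *\<^sub>R \<xi>)) ** (matrix_inv (g ** dexp (a *\<^sub>R \<xi>)) ** (g ** dexp (a *\<^sub>R \<xi>))
      ** k) ** dexp ((b - a) *\<^sub>R \<xi>') \<in> SU"
    by (simp add: matrix_mul_assoc)
  then have "dexp (- ((b - a) *\<^sub>R \<xi>)) ** k ** dexp ((b - a) *\<^sub>R \<xi>') \<in> SU"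
    by (simp add: matrix_inv_mult_SL[OF SL(1)])
  then show "k $ i $ j = 0 \<or> \<xi> $ i = \<xi>' $ j"
    using intertwine_entries[OF k] ab by auto
qed

text \<open>
  The unitary matrix \<open>k\<close> of \<open>line_eq_entries\<close> carries \<open>exp(t diag \<xi>')\<close> past itself to
  \<open>exp(t diag \<xi>)\<close> for all \<open>t\<close>, and is then absorbed by the base point.
\<close>
lemma line_eqI:
  fixes g :: "'n::finite cmat"
  assumes g: "g \<in> SL" "trace0 \<xi>" "g' \<in> SL" "trace0 \<xi>'" and ab: "a \<noteq> b"
    and eq: "line g \<xi> a = line g' \<xi>' a" "line g \<xi> b = line g' \<xi>' b"
  shows "line g \<xi> = line g' \<xi>'"
proof
  fix t
  define k where "k = matrix_inv (g ** dexp (a *\<^sub>R \<xi>)) ** (g' ** dexp (a *\<^sub>R \<xi>'))"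
  note k = line_eq_entries[OF assms, folded k_def]
  have gk: "g' ** dexp (a *\<^sub>R \<xi>') = g ** dexp (a *\<^sub>R \<xi>) ** k"
    unfolding k_def using g by (simp add: matrix_inv_cancel_SL SL_mult dexp_scaleR_SL)
  have "g' ** dexp (t *\<^sub>R \<xi>') = g ** dexp (a *\<^sub>R \<xi>) ** k ** dexp ((t - a) *\<^sub>R \<xi>')"
    unfolding gk[symmetric] using dexp_scaleR_add[of a "t - a" \<xi>'] by (simp flip: matrix_mul_assoc)
  also have "\<dots> = g ** dexp (a *\<^sub>R \<xi>) ** dexp ((t - a) *\<^sub>R \<xi>) ** k"
    using intertwine[OF k(2), of "t - a"] by (simp flip: matrix_mul_assoc)
  also have "\<dots> = g ** dexp (t *\<^sub>R \<xi>) ** k"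
    using dexp_scaleR_add[of a "t - a" \<xi>] by (simp flip: matrix_mul_assoc)
  finally show "line g \<xi> t = line g' \<xi>' t"
    by (simp add: line_def act_mult_SU[OF k(1)])
qed

lemma line_between:
  assumes x: "x \<in> Z" "y \<in> Z" and ab: "a < b" and v: "0 < v" "distZ x y = v * (b - a)"
  obtains g \<xi> where "g \<in> SL" "trace0 \<xi>" "line g \<xi> a = x" "line g \<xi> b = y" "knorm \<xi> = v"
proof -
  obtain g \<xi> where g: "g \<in> SL" "trace0 \<xi>" "x = act g base" "y = act (g ** dexp \<xi>) base"
    using x by (rule cartan_pair)
  note t = g(2)
  have xy: "x = line g \<xi> 0" "y = line g \<xi> 1" using g by (simp_all add: line_def)
  let ?r = "1 / (b - a)"
  have l: "line (g ** dexp ((- a * ?r) *\<^sub>R \<xi>)) (?r *\<^sub>R \<xi>) t = line g \<xi> ((t - a) / (b - a))" for t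
  proof -
    have "line (g ** dexp ((- a * ?r) *\<^sub>R \<xi>)) (?r *\<^sub>R \<xi>) t = line g \<xi> (- a * ?r + ?r * t)"
      by (simp only: line_scale line_shift)
    also have "- a * ?r + ?r * t = (t - a) / (b - a)" by (simp add: diff_divide_distrib)
    finally show ?thesis .
  qed
  have "knorm \<xi> = v * (b - a)" using distZ_line[OF g(1) t, of 0 1] v xy by simp
  then have speed: "knorm (?r *\<^sub>R \<xi>) = v" using ab by (simp add: knorm_scaleR)
  show ?thesis
  proof (rule that)
    show "g ** dexp ((- a * ?r) *\<^sub>R \<xi>) \<in> SL" by (intro SL_mult dexp_scaleR_SL g t)
    show "trace0 (?r *\<^sub>R \<xi>)" using t by (rule trace0_scaleR)
    show "line (g ** dexp ((- a * ?r) *\<^sub>R \<xi>)) (?r *\<^sub>R \<xi>) a = x"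
      "line (g ** dexp ((- a * ?r) *\<^sub>R \<xi>)) (?r *\<^sub>R \<xi>) b = y"
      unfolding l xy using ab by simp_all
  qed (rule speed)
qed

text \<open>
  Near each time the curve is a line by \<open>line_between\<close> and \<open>between_unique\<close>.  The line
  representing its right germ at \<open>t\<close> is unique by \<open>line_eqI\<close> and locally constant in \<open>t\<close>, hence constant
  on the connected set \<open>[c, \<infinity>)\<close>.  Right germs exist also at the end \<open>c\<close>, which lets rays and
  complete geodesics be treated alike.
\<close>
lemma geodesic_on_half_line:
  fixes \<gamma> :: "real \<Rightarrow> 'n::finite point"
  assumes geo: "geodesic_on {c..} v \<gamma>" and v: "0 < v"
  obtains g \<xi> where "g \<in> SL" "trace0 \<xi>" "knorm \<xi> = v" "\<And>t. c \<le> t \<Longrightarrow> \<gamma> t = line g \<xi> t"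
proof -
  define germ where "germ t \<alpha> \<longleftrightarrow> (\<exists>g \<xi>. g \<in> SL \<and> trace0 \<xi> \<and> knorm \<xi> = v \<and> \<alpha> = line g \<xi>) \<and>
     (\<exists>b>t. \<forall>s\<in>{t..b}. \<gamma> s = \<alpha> s)" for t and \<alpha> :: "real \<Rightarrow> 'n point"
  have unique: "\<alpha> = \<beta>" if "germ t \<alpha>" "germ t \<beta>" for t \<alpha> \<beta>
  proof -
    obtain a b where ab: "t < a" "t < b" "\<forall>s\<in>{t..a}. \<gamma> s = \<alpha> s" "\<forall>s\<in>{t..b}. \<gamma> s = \<beta> s"
      using \<open>germ t \<alpha>\<close> \<open>germ t \<beta>\<close> unfolding germ_def by blast
    obtain g \<xi> where 1: "g \<in> SL" "trace0 \<xi>" "\<alpha> = line g \<xi>"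
      using \<open>germ t \<alpha>\<close> unfolding germ_def by blast
    obtain g' \<xi>' where 2: "g' \<in> SL" "trace0 \<xi>'" "\<beta> = line g' \<xi>'"
      using \<open>germ t \<beta>\<close> unfolding germ_def by blast
    have "t \<in> {t..a}" "t \<in> {t..b}" "min a b \<in> {t..a}" "min a b \<in> {t..b}" using ab by auto
    then have "\<alpha> t = \<beta> t" "\<alpha> (min a b) = \<beta> (min a b)" using ab by metis+
    then show "\<alpha> = \<beta>"
      unfolding 1(3) 2(3) using line_eqI[OF 1(1,2) 2(1,2), of t "min a b"] ab by (auto simp: min_def)
  qed
  have loc: "\<exists>\<alpha> e. 0 < e \<and> germ t \<alpha> \<and> (\<forall>s. c \<le> s \<longrightarrow> \<bar>s - t\<bar> < e \<longrightarrow> germ s \<alpha>)" if t: "c \<le> t" for t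
  proof -
    obtain e where e: "0 < e" and d: "\<And>s s'. c \<le> s \<Longrightarrow> c \<le> s' \<Longrightarrow> \<bar>s - t\<bar> < e \<Longrightarrow> \<bar>s' - t\<bar> < e \<Longrightarrow>
        distZ (\<gamma> s) (\<gamma> s') = v * \<bar>s - s'\<bar>"
      using geo t unfolding geodesic_on_def by (metis atLeast_iff)
    \<comment> \<open>At \<open>t = c\<close> there is no room to the left, and then \<open>a = t\<close>.\<close>
    define a where "a = max c (t - e/2)"
    define b where "b = t + e/2"
    have ab: "a < b" "c \<le> a" "c \<le> b" "\<bar>a - t\<bar> < e" "\<bar>b - t\<bar> < e"
      using e t by (auto simp: a_def b_def)
    have \<gamma>Z: "\<gamma> s \<in> Z" if "c \<le> s" for s using geo that by (auto simp: geodesic_on_def)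
    obtain g \<xi> where g: "g \<in> SL" "trace0 \<xi>" "line g \<xi> a = \<gamma> a" "line g \<xi> b = \<gamma> b" "knorm \<xi> = v"
      by (rule line_between[OF \<gamma>Z[OF ab(2)] \<gamma>Z[OF ab(3)] ab(1) v]) (use d[of a b] ab in auto)
    have eq: "\<gamma> s = line g \<xi> s" if s: "s \<in> {a..b}" for s
    proof (rule between_unique[OF g(1,2)])
      show "a \<le> s" "s \<le> b" using s by auto
      have cs: "c \<le> s" "\<bar>s - t\<bar> < e" using s ab by auto
      then show "\<gamma> s \<in> Z" by (simp add: \<gamma>Z)
      show "distZ (line g \<xi> a) (\<gamma> s) = knorm \<xi> * (s - a)" "distZ (\<gamma> s) (line g \<xi> b) = knorm \<xi> * (b - s)"
        using d[of a s] d[of s b] cs ab s g by auto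
    qed
    have "germ s (line g \<xi>)" if "s \<in> {a..<b}" for s
      unfolding germ_def using g(1,2,5) eq that by (auto intro!: exI[of _ b])
    then have "germ s (line g \<xi>)" if "c \<le> s" "\<bar>s - t\<bar> < e/2" for s
      using that by (auto simp: a_def b_def abs_if split: if_splits)
    then show ?thesis using e t by (intro exI[of _ "line g \<xi>"] exI[of _ "e/2"]) auto
  qed
  define \<Phi> where "\<Phi> t = (THE \<alpha>. germ t \<alpha>)" for t
  have \<Phi>: "\<Phi> t = \<alpha>" if "germ t \<alpha>" for t \<alpha>
    unfolding \<Phi>_def using unique that by blast
  have const: "\<Phi> t = \<Phi> c" if "c \<le> t" for t
  proof (rule connected_local_const[where A = "{c..}"])
    show "connected {c..}" by (simp add: is_interval_connected)
    show "\<forall>a\<in>{c..}. eventually (\<lambda>b. \<Phi> a = \<Phi> b) (at a within {c..})"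
    proof
      fix a assume "a \<in> {c..}"
      then obtain \<alpha> e where e: "0 < e" "germ a \<alpha>" "\<And>s. c \<le> s \<Longrightarrow> \<bar>s - a\<bar> < e \<Longrightarrow> germ s \<alpha>"
        using loc[of a] by auto
      then have "\<Phi> a = \<Phi> s" if "s \<in> {c..}" "dist s a < e" for s
        using that \<Phi> by (auto simp: dist_real_def)
      then show "eventually (\<lambda>b. \<Phi> a = \<Phi> b) (at a within {c..})"
        unfolding eventually_at using e(1) by blast
    qed
  qed (use that in auto)
  obtain \<alpha> where \<alpha>: "germ c \<alpha>" using loc[of c] by blast
  have "\<gamma> t = \<alpha> t" if t: "c \<le> t" for t
  proof -
    obtain \<beta> where \<beta>: "germ t \<beta>" using loc[OF t] by blast
    then have "\<beta> = \<alpha>" using const[OF t] \<Phi> \<alpha> by metis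
    then show ?thesis using \<beta> by (auto simp: germ_def)
  qed
  then show ?thesis using \<alpha> that unfolding germ_def by blast
qed

lemma geodesic_on_subset:
  assumes "geodesic_on I v \<gamma>" "J \<subseteq> I" shows "geodesic_on J v \<gamma>"
  unfolding geodesic_on_def
proof (intro conjI ballI)
  show "\<gamma> ` J \<subseteq> Z" using assms by (auto simp: geodesic_on_def)
  fix t assume "t \<in> J"
  then obtain e where "0 < e" "\<forall>s\<in>I. \<forall>s'\<in>I. \<bar>s - t\<bar> < e \<longrightarrow> \<bar>s' - t\<bar> < e \<longrightarrow>
      distZ (\<gamma> s) (\<gamma> s') = v * \<bar>s - s'\<bar>"
    using assms unfolding geodesic_on_def by (meson subsetD)
  then show "\<exists>e>0. \<forall>s\<in>J. \<forall>s'\<in>J. \<bar>s - t\<bar> < e \<longrightarrow> \<bar>s' - t\<bar> < e \<longrightarrow>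
      distZ (\<gamma> s) (\<gamma> s') = v * \<bar>s - s'\<bar>"
    using assms(2) by (intro exI[of _ e]) auto
qed

lemma geodesic_on_UNIV:
  fixes \<gamma> :: "real \<Rightarrow> 'n::finite point"
  assumes geo: "geodesic_on UNIV v \<gamma>" and v: "0 < v"
  obtains g \<xi> where "g \<in> SL" "trace0 \<xi>" "knorm \<xi> = v" "\<gamma> = line g \<xi>"
proof -
  have on: "geodesic_on {c..} v \<gamma>" for c using geo by (rule geodesic_on_subset) simp
  obtain g \<xi> where g: "g \<in> SL" "trace0 \<xi>" "knorm \<xi> = v" "\<And>t. 0 \<le> t \<Longrightarrow> \<gamma> t = line g \<xi> t"
    using geodesic_on_half_line[OF on v] by metis
  have "\<gamma> t = line g \<xi> t" for t
  proof -
    obtain g' \<xi>' where g': "g' \<in> SL" "trace0 \<xi>'" "\<And>s. t \<le> s \<Longrightarrow> \<gamma> s = line g' \<xi>' s"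
      using geodesic_on_half_line[OF on v, of t] by metis
    have same: "line g \<xi> s = line g' \<xi>' s" if "0 \<le> s" "t \<le> s" for s
      using g(4)[OF that(1)] g'(3)[OF that(2)] by simp
    have "line g \<xi> = line g' \<xi>'"
      by (rule line_eqI[OF g(1,2) g'(1,2), of "max t 0" "max t 0 + 1"]) (auto intro!: same)
    then show ?thesis using g' by simp
  qed
  then show ?thesis using that g by blast
qed

lemma line_geodesic_on:
  assumes "g \<in> SL" "trace0 \<xi>" shows "geodesic_on I (knorm \<xi>) (line g \<xi>)"
  unfolding geodesic_on_def using assms by (auto simp: line_Z distZ_line intro!: exI[of _ 1])

section \<open>Asymptotic rays\<close>

lemma ray_line: "g \<in> SL \<Longrightarrow> trace0 \<xi> \<Longrightarrow> knorm \<xi> = 1 \<Longrightarrow> ray (line g \<xi>)"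
  using line_geodesic_on[of g \<xi> "{0..}"] by (simp add: ray_def)

lemma ray_Z: "ray \<gamma> \<Longrightarrow> 0 \<le> t \<Longrightarrow> \<gamma> t \<in> Z"
  by (auto simp: ray_def geodesic_on_def)

lemma asymptotic_equiv: "equiv (Collect (ray :: (real \<Rightarrow> 'n::finite point) \<Rightarrow> bool)) asymptotic"
proof (rule equivI)
  show "asymptotic \<subseteq> Collect ray \<times> Collect (ray :: (real \<Rightarrow> 'n::finite point) \<Rightarrow> bool)"
    by (auto simp: asymptotic_def)
  show "refl_on (Collect ray) (asymptotic :: ((real \<Rightarrow> 'n::finite point) \<times> _) set)"
    by (auto simp: refl_on_def asymptotic_def distZ_self ray_Z intro!: exI[of _ 0])
  show "sym (asymptotic :: ((real \<Rightarrow> 'n::finite point) \<times> _) set)"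
    unfolding sym_def asymptotic_def by (auto simp: distZ_commute ray_Z)
  show "trans (asymptotic :: ((real \<Rightarrow> 'n::finite point) \<times> _) set)"
  proof (rule transI)
    fix \<alpha> \<beta> \<gamma> :: "real \<Rightarrow> 'n point"
    assume "(\<alpha>, \<beta>) \<in> asymptotic" "(\<beta>, \<gamma>) \<in> asymptotic"
    then obtain C D where r: "ray \<alpha>" "ray \<beta>" "ray \<gamma>"
      and CD: "\<forall>t\<ge>0. distZ (\<alpha> t) (\<beta> t) \<le> C" "\<forall>t\<ge>0. distZ (\<beta> t) (\<gamma> t) \<le> D"
      by (auto simp: asymptotic_def)
    have "distZ (\<alpha> t) (\<gamma> t) \<le> C + D" if "0 \<le> t" for t
      using distZ_triangle[OF r(1,2,3)[THEN ray_Z, OF that]] CD that by fastforce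
    with r show "(\<alpha>, \<gamma>) \<in> asymptotic" by (auto simp: asymptotic_def)
  qed
qed

lemma endpoint_eq_iff:
  assumes "ray \<gamma>" "ray \<delta>" shows "endpoint \<gamma> = endpoint \<delta> \<longleftrightarrow> (\<gamma>, \<delta>) \<in> asymptotic"
  unfolding endpoint_def using eq_equiv_class_iff[OF asymptotic_equiv] assms by blast

lemma endpoint_Zinf: "ray \<gamma> \<Longrightarrow> endpoint \<gamma> \<in> Zinf"
  unfolding endpoint_def Zinf_def by (simp add: quotientI)

lemma Zinf_cases:
  assumes "p \<in> Zinf"
  obtains g \<xi> where "g \<in> SL" "trace0 \<xi>" "knorm \<xi> = 1" "p = endpoint (line g \<xi>)"
proof -
  obtain \<gamma> where \<gamma>: "ray \<gamma>" "p = endpoint \<gamma>"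
    using assms by (auto simp: Zinf_def endpoint_def quotient_def)
  obtain g \<xi> where g: "g \<in> SL" "trace0 \<xi>" "knorm \<xi> = 1" "\<And>t. 0 \<le> t \<Longrightarrow> \<gamma> t = line g \<xi> t"
    using geodesic_on_half_line[of 0 1 \<gamma>] \<gamma>(1) unfolding ray_def by auto
  then have "(\<gamma>, line g \<xi>) \<in> asymptotic"
    using \<gamma>(1) by (auto simp: asymptotic_def ray_line distZ_self line_Z intro!: exI[of _ 0])
  then have "p = endpoint (line g \<xi>)" using \<gamma> g by (simp add: endpoint_eq_iff ray_line)
  then show ?thesis using that g by blast
qed

lemma norm_le_knorm: "norm \<xi> \<le> knorm (\<xi> :: real^'n::finite)"
proof -
  have "1 \<le> CARD('n)" by (simp add: Suc_leI)
  then have "1 \<le> 4 * real CARD('n)" by linarith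
  then have "1 \<le> sqrt (4 * real CARD('n))" by (simp only: real_sqrt_ge_1_iff)
  then have "1 * norm \<xi> \<le> sqrt (4 * real CARD('n)) * norm \<xi>" by (rule mult_right_mono) simp
  then show ?thesis by (simp add: knorm_def)
qed

text \<open>
  In an order starting with \<open>i\<close>, the logarithm of the length of row \<open>i\<close> is a coordinate of the Iwasawa
  projection, which is bounded by the distance.
\<close>
lemma entry_le_exp_distZ:
  fixes h :: "'n::finite cmat"
  assumes h: "h \<in> SL"
  shows "cmod (h $ i $ j) \<le> exp (distZ base (act h base))"
proof -
  obtain q0 :: "'n \<Rightarrow> nat" where q0: "inj q0" using ex_inj_nat by blast
  \<comment> \<open>The order that starts with \<open>i\<close>.\<close>
  define q where "q = (\<lambda>k. if k = i then 0 else Suc (q0 k))"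
  have q: "inj q" using q0 by (auto simp: q_def inj_def)
  let ?v = "\<lambda>i. ctranspose h *v axis i 1"
  have det: "det (ctranspose h) \<noteq> 0" using h by (simp add: SL_def det_ctranspose)
  have gsi: "gs q ?v i = ?v i" by (subst gs.simps) (simp add: q_def)
  have nz: "norm (?v i) > 0" using gs_nonzero[OF q det, of i] gsi by simp
  have "ln (norm (?v i)) = iwasawa q h $ i" by (simp add: iwasawa_def gsi)
  also have "\<dots> \<le> norm (iwasawa q h)" using Finite_Cartesian_Product.norm_nth_le[of "iwasawa q h" i] by simp
  also have "\<dots> \<le> knorm (iwasawa q h)" by (rule norm_le_knorm)
  also have "\<dots> \<le> distZ base (act h base)"
    using iwasawa_lipschitz[OF SL_mat1 SL_mat1 h q] by simp
  finally have "exp (ln (norm (?v i))) \<le> exp (distZ base (act h base))" by (simp only: exp_le_cancel_iff)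
  then have "norm (?v i) \<le> exp (distZ base (act h base))"
    unfolding exp_ln[OF nz] .
  moreover have "cmod (h $ i $ j) = cmod (?v i $ j)" by (simp add: mult_axis_nth)
  ultimately show ?thesis using Finite_Cartesian_Product.norm_nth_le[of "?v i" j] by simp
qed

lemma SU_entry_le: "k \<in> SU \<Longrightarrow> cmod (k $ i $ j) \<le> 1"
  using Finite_Cartesian_Product.norm_nth_le[of "k *v axis j 1" i] norm_unitary[OF SU_ctranspose_mult, of k "axis j 1"]
  by (simp add: mult_axis_nth)

text \<open>
  Write \<open>h = k exp(diag \<xi>) k'\<close>.  The numbers \<open>exp \<xi>\<^sub>i\<close> are entries of \<open>k\<^sup>* h k'\<^sup>*\<close> and so bounded above; as
  the coordinates of \<open>\<xi>\<close> have sum zero, they are also bounded below.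
\<close>
lemma ex_distZ_bound:
  fixes C :: real
  assumes C: "1 \<le> C"
  shows "\<exists>D. \<forall>h::'n::finite cmat. h \<in> SL \<longrightarrow> (\<forall>i j. cmod (h $ i $ j) \<le> C) \<longrightarrow> distZ base (act h base) \<le> D"
proof -
  define N where "N = real CARD('n)"
  have N: "1 \<le> N" by (simp add: N_def Suc_leI)
  define B where "B = ln (N * (N * C))"
  have NC: "1 \<le> N * (N * C)" using N C by (metis mult_mono' mult_1 zero_le_one)
  then have B: "0 \<le> B" by (simp add: B_def)
  have "distZ base (act h base) \<le> sqrt (4 * real CARD('n)) * (N * (N * B))"
    if h: "h \<in> SL" and hC: "\<forall>i j. cmod (h $ i $ j) \<le> C" for h :: "'n cmat"
  proof -
    obtain k \<xi> k' where k: "k \<in> SU" "k' \<in> SU" "trace0 \<xi>" "h = k ** dexp \<xi> ** k'"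
      using h by (rule cartan_decomposition)
    have "base = act (k ** mat 1) base" "act h base = act (k ** dexp \<xi>) base"
      using k by (simp_all add: act_SU_base act_mult_SU)
    then have "distZ base (act h base) = knorm \<xi>"
      using distZ_dexp[OF SU_SL[OF k(1)] k(3)] by simp
    moreover have upper: "\<xi> $ i \<le> B" for i
    proof -
      have "dexp \<xi> = ctranspose k ** k ** dexp \<xi> ** (k' ** ctranspose k')"
        using k by (simp add: SU_ctranspose_mult SU_mult_ctranspose)
      then have d: "dexp \<xi> = ctranspose k ** (h ** ctranspose k')"
        unfolding k(4) by (simp only: matrix_mul_assoc)
      have "exp (\<xi> $ i) = cmod (dexp \<xi> $ i $ i)" by (simp add: dexp_def)
      also have "\<dots> = cmod (\<Sum>a\<in>UNIV. ctranspose k $ i $ a * (\<Sum>b\<in>UNIV. h $ a $ b * ctranspose k' $ b $ i))"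
        unfolding d by (simp add: matrix_matrix_mult_def)
      also have "\<dots> \<le> (\<Sum>a\<in>(UNIV :: 'n set). \<Sum>b\<in>(UNIV :: 'n set). C)"
      proof (intro sum_norm_le)
        fix a :: 'n
        have "cmod (\<Sum>b\<in>UNIV. h $ a $ b * ctranspose k' $ b $ i) \<le> (\<Sum>b\<in>(UNIV :: 'n set). C)"
        proof (intro sum_norm_le)
          fix b
          have "cmod (h $ a $ b) * cmod (ctranspose k' $ b $ i) \<le> C * 1"
            using hC SU_entry_le[OF k(2)] C by (intro mult_mono) auto
          then show "cmod (h $ a $ b * ctranspose k' $ b $ i) \<le> C" by (simp add: norm_mult)
        qed
        moreover have "cmod (ctranspose k $ i $ a) \<le> 1" using SU_entry_le[OF k(1)] by simp
        ultimately have "cmod (ctranspose k $ i $ a) * cmod (\<Sum>b\<in>UNIV. h $ a $ b * ctranspose k' $ b $ i)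
            \<le> 1 * (\<Sum>b\<in>(UNIV :: 'n set). C)"
          by (intro mult_mono) auto
        then show "cmod (ctranspose k $ i $ a * (\<Sum>b\<in>UNIV. h $ a $ b * ctranspose k' $ b $ i)) \<le> (\<Sum>b\<in>(UNIV :: 'n set). C)"
          by (simp add: norm_mult)
      qed
      also have "\<dots> = N * (N * C)" by (simp add: N_def)
      finally show ?thesis using NC by (simp add: B_def ln_ge_iff)
    qed
    moreover have "- (N * B) \<le> \<xi> $ i" for i
    proof -
      have "- \<xi> $ i = (\<Sum>j\<in>UNIV - {i}. \<xi> $ j)"
        using k(3) sum.remove[of UNIV i "\<lambda>j. \<xi> $ j"] by (simp add: trace0_def)
      also have "\<dots> \<le> (\<Sum>j\<in>UNIV - {i}. B)" by (intro sum_mono upper)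
      also have "\<dots> \<le> (\<Sum>j\<in>(UNIV::'n set). B)" by (rule sum_mono2) (auto simp: B)
      finally show ?thesis by (simp add: N_def)
    qed
    moreover have "B \<le> N * B" using N B by (simp add: mult_right_le_one_le mult_le_cancel_right1)
    ultimately have *: "\<bar>\<xi> $ i\<bar> \<le> N * B" for i by (smt (verit))
    have "norm \<xi> \<le> (\<Sum>i\<in>UNIV. \<bar>\<xi> $ i\<bar>)" by (rule norm_le_l1_cart)
    also have "\<dots> \<le> (\<Sum>i\<in>(UNIV :: 'n set). N * B)" by (intro sum_mono *)
    also have "\<dots> = N * (N * B)" by (simp add: N_def)
    finally have "knorm \<xi> \<le> sqrt (4 * real CARD('n)) * (N * (N * B))"
      unfolding knorm_def by (rule mult_left_mono) simp
    then show ?thesis using \<open>distZ base (act h base) = knorm \<xi>\<close> by simp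
  qed
  then show ?thesis by blast
qed

lemma bounded_exp_imp:
  fixes m c C :: real
  assumes "0 \<le> m" "\<And>t. 0 \<le> t \<Longrightarrow> m * exp (t * c) \<le> C"
  shows "m = 0 \<or> c \<le> 0"
proof (rule ccontr)
  assume "\<not> ?thesis"
  then have mc: "0 < m" "0 < c" using assms(1) by auto
  have C: "0 \<le> C" using assms(2)[of 0] assms(1) by simp
  define t where "t = C / (m * c)"
  have "C + m = m * (1 + t * c)" using mc by (simp add: t_def field_simps)
  also have "\<dots> \<le> m * exp (t * c)" using mc exp_ge_add_one_self[of "t * c"] by simp
  also have "\<dots> \<le> C" using mc C by (intro assms(2)) (simp add: t_def)
  finally show False using mc by simp
qed

text \<open>
  The distance at time \<open>t\<close> is that of the base point and its translate by
  \<open>exp(-t diag \<xi>) g\<^sup>-\<^sup>1 h exp(t diag \<eta>)\<close>, whose entries are those of \<open>g\<^sup>-\<^sup>1 h\<close> multiplied by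
  \<open>exp(t (\<eta>\<^sub>j - \<xi>\<^sub>i))\<close>.  It is bounded iff these entries are.
\<close>
lemma asymptotic_line_iff:
  fixes g h :: "'n::finite cmat"
  assumes g: "g \<in> SL" "trace0 \<xi>" "knorm \<xi> = 1" and h: "h \<in> SL" "trace0 \<eta>" "knorm \<eta> = 1"
  shows "(line g \<xi>, line h \<eta>) \<in> asymptotic \<longleftrightarrow>
    (\<forall>i j. (matrix_inv g ** h) $ i $ j = 0 \<or> \<eta> $ j \<le> \<xi> $ i)"
proof -
  define M where "M = matrix_inv g ** h"
  define m where "m t = dexp (- (t *\<^sub>R \<xi>)) ** M ** dexp (t *\<^sub>R \<eta>)" for t
  have m_SL: "m t \<in> SL" for t
    unfolding m_def M_def using g h dexp_scaleR_SL[OF g(2), of "-t"]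
    by (intro SL_mult dexp_scaleR_SL SL_matrix_inv) auto
  have dist: "distZ (line g \<xi> t) (line h \<eta> t) = distZ base (act (m t) base)" for t
  proof -
    let ?a = "g ** dexp (t *\<^sub>R \<xi>)"
    have a: "?a \<in> SL" using g by (simp add: SL_mult dexp_scaleR_SL)
    have "?a ** m t = g ** (dexp (t *\<^sub>R \<xi>) ** dexp (- (t *\<^sub>R \<xi>))) ** M ** dexp (t *\<^sub>R \<eta>)"
      by (simp only: m_def matrix_mul_assoc)
    also have "\<dots> = h ** dexp (t *\<^sub>R \<eta>)"
      using g by (simp add: dexp_minus M_def matrix_inv_cancel_SL)
    finally have "line h \<eta> t = act ?a (act (m t) base)" by (simp add: line_def act_act)
    moreover have "line g \<xi> t = act ?a base" by (simp add: line_def)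
    moreover have "base \<in> (Z :: 'n point set)" using act_base_Z[OF SL_mat1] by simp
    ultimately show ?thesis using distZ_act[OF a] act_base_Z[OF m_SL] by metis
  qed
  have m_entry: "cmod (m t $ i $ j) = cmod (M $ i $ j) * exp (t * (\<eta> $ j - \<xi> $ i))" for t i j
  proof -
    have "m t $ i $ j = complex_of_real (exp (- (t * \<xi> $ i))) * M $ i $ j * complex_of_real (exp (t * \<eta> $ j))"
      by (simp add: m_def dexp_mult_nth)
    then have "cmod (m t $ i $ j) = exp (- (t * \<xi> $ i)) * cmod (M $ i $ j) * exp (t * \<eta> $ j)"
      by (simp add: norm_mult)
    moreover have "exp (t * (\<eta> $ j - \<xi> $ i)) = exp (- (t * \<xi> $ i)) * exp (t * \<eta> $ j)"
      by (simp add: exp_add[symmetric] algebra_simps)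
    ultimately show ?thesis by simp
  qed
  have rays: "ray (line g \<xi>)" "ray (line h \<eta>)" using g h by (simp_all add: ray_line)
  show ?thesis unfolding M_def[symmetric]
  proof
    assume "(line g \<xi>, line h \<eta>) \<in> asymptotic"
    then obtain C where C: "\<And>t. 0 \<le> t \<Longrightarrow> distZ base (act (m t) base) \<le> C"
      by (auto simp: asymptotic_def dist)
    show "\<forall>i j. M $ i $ j = 0 \<or> \<eta> $ j \<le> \<xi> $ i"
    proof (intro allI)
      fix i j
      have "cmod (M $ i $ j) = 0 \<or> \<eta> $ j - \<xi> $ i \<le> 0"
      proof (rule bounded_exp_imp)
        fix t :: real assume "0 \<le> t"
        have "cmod (m t $ i $ j) \<le> exp (distZ base (act (m t) base))" by (rule entry_le_exp_distZ[OF m_SL])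
        also have "\<dots> \<le> exp C" using C[OF \<open>0 \<le> t\<close>] by simp
        finally show "cmod (M $ i $ j) * exp (t * (\<eta> $ j - \<xi> $ i)) \<le> exp C" by (simp add: m_entry)
      qed simp
      then show "M $ i $ j = 0 \<or> \<eta> $ j \<le> \<xi> $ i" by auto
    qed
  next
    assume M: "\<forall>i j. M $ i $ j = 0 \<or> \<eta> $ j \<le> \<xi> $ i"
    \<comment> \<open>Adding 1 makes the constant at least 1, as \<open>ex_distZ_bound\<close> requires.\<close>
    obtain D where D: "\<And>h::'n cmat. h \<in> SL \<Longrightarrow> (\<And>i j. cmod (h $ i $ j) \<le> 1 + norm M) \<Longrightarrow> distZ base (act h base) \<le> D"
      using ex_distZ_bound[of "1 + norm M", where 'n = 'n] by auto
    have "distZ base (act (m t) base) \<le> D" if t: "0 \<le> t" for t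
    proof (rule D[OF m_SL])
      fix i j
      have "cmod (M $ i $ j) * exp (t * (\<eta> $ j - \<xi> $ i)) \<le> cmod (M $ i $ j)"
      proof (cases "M $ i $ j = 0")
        case False
        then have "t * (\<eta> $ j - \<xi> $ i) \<le> 0" using M t by (metis diff_le_0_iff_le mult_nonneg_nonpos)
        then show ?thesis by (simp add: mult_left_le)
      qed simp
      also have "\<dots> \<le> norm (M $ i)" by (rule Finite_Cartesian_Product.norm_nth_le)
      also have "\<dots> \<le> norm M" by (rule Finite_Cartesian_Product.norm_nth_le)
      finally show "cmod (m t $ i $ j) \<le> 1 + norm M" by (simp add: m_entry)
    qed
    then show "(line g \<xi>, line h \<eta>) \<in> asymptotic"
      using rays by (auto simp: asymptotic_def dist)
  qed
qed

section \<open>Stabilizers\<close>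

lemma ray_act:
  assumes a: "a \<in> SL" and r: "ray \<gamma>" shows "ray (act a \<circ> \<gamma>)"
  unfolding ray_def geodesic_on_def
proof (intro conjI ballI)
  show "(act a \<circ> \<gamma>) ` {0..} \<subseteq> Z" using a ray_Z[OF r] by (auto simp: act_Z)
  fix t :: real assume "t \<in> {0..}"
  then obtain e where e: "0 < e" "\<forall>s\<in>{0..}. \<forall>s'\<in>{0..}. \<bar>s - t\<bar> < e \<longrightarrow> \<bar>s' - t\<bar> < e \<longrightarrow>
      distZ (\<gamma> s) (\<gamma> s') = 1 * \<bar>s - s'\<bar>"
    using r unfolding ray_def geodesic_on_def by blast
  have "distZ (act a (\<gamma> s)) (act a (\<gamma> s')) = distZ (\<gamma> s) (\<gamma> s')" if "s \<in> {0..}" "s' \<in> {0..}" for s s'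
    using a ray_Z[OF r] that by (simp add: distZ_act)
  with e show "\<exists>e>0. \<forall>s\<in>{0..}. \<forall>s'\<in>{0..}. \<bar>s - t\<bar> < e \<longrightarrow> \<bar>s' - t\<bar> < e \<longrightarrow>
      distZ ((act a \<circ> \<gamma>) s) ((act a \<circ> \<gamma>) s') = 1 * \<bar>s - s'\<bar>"
    by (intro exI[of _ e]) simp
qed

lemma asymptotic_act:
  assumes "a \<in> SL" "(\<gamma>, \<delta>) \<in> asymptotic" shows "(act a \<circ> \<gamma>, act a \<circ> \<delta>) \<in> asymptotic"
  using assms by (auto simp: asymptotic_def ray_act distZ_act ray_Z)

lemma act_inv:
  assumes "a \<in> SL"
  shows "act a (act (matrix_inv a) x) = x" "act (matrix_inv a) (act a x) = x"
  using assms by (simp_all add: act_act matrix_inv_mult_SL)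

lemma act_inf_endpoint:
  assumes a: "a \<in> SL" shows "act_inf a (endpoint \<gamma>) = endpoint (act a \<circ> \<gamma>)"
proof
  show "act_inf a (endpoint \<gamma>) \<subseteq> endpoint (act a \<circ> \<gamma>)"
    using asymptotic_act[OF a] by (auto simp: act_inf_def endpoint_def)
  show "endpoint (act a \<circ> \<gamma>) \<subseteq> act_inf a (endpoint \<gamma>)"
  proof
    fix \<delta> assume "\<delta> \<in> endpoint (act a \<circ> \<gamma>)"
    then have "(act a \<circ> \<gamma>, \<delta>) \<in> asymptotic" by (simp add: endpoint_def)
    from asymptotic_act[OF SL_matrix_inv[OF a] this]
    have "(\<gamma>, act (matrix_inv a) \<circ> \<delta>) \<in> asymptotic" by (simp add: o_def act_inv[OF a])
    moreover have "\<delta> = act a \<circ> (act (matrix_inv a) \<circ> \<delta>)" by (simp add: o_def act_inv[OF a])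
    ultimately show "\<delta> \<in> act_inf a (endpoint \<gamma>)" unfolding act_inf_def endpoint_def by blast
  qed
qed

text \<open>
  The group of all \<open>p\<close> for which \<open>exp(-t diag \<xi>) p exp(t diag \<xi>)\<close> stays bounded as \<open>t \<rightarrow> \<infinity>\<close>.
\<close>
definition parabolic :: "real^'n \<Rightarrow> 'n::finite cmat set" where
  "parabolic \<xi> = {p \<in> SL. \<forall>i j. p $ i $ j = 0 \<or> \<xi> $ j \<le> \<xi> $ i}"

lemma stab_inf_line:
  assumes g: "g \<in> SL" "trace0 \<xi>" "knorm \<xi> = 1" and p: "p \<in> SL"
  shows "p \<in> stab_inf (endpoint (line g \<xi>)) \<longleftrightarrow> matrix_inv g ** p ** g \<in> parabolic \<xi>"
proof -
  have pg: "p ** g \<in> SL" using g p by (simp add: SL_mult)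
  have r: "ray (line g \<xi>)" "ray (line (p ** g) \<xi>)" using g pg by (simp_all add: ray_line)
  have "act p \<circ> line g \<xi> = line (p ** g) \<xi>" by (simp add: fun_eq_iff act_line)
  then have "p \<in> stab_inf (endpoint (line g \<xi>)) \<longleftrightarrow> endpoint (line g \<xi>) = endpoint (line (p ** g) \<xi>)"
    using p by (auto simp: stab_inf_def act_inf_endpoint)
  also have "\<dots> \<longleftrightarrow> (\<forall>i j. (matrix_inv g ** (p ** g)) $ i $ j = 0 \<or> \<xi> $ j \<le> \<xi> $ i)"
    using asymptotic_line_iff[OF g pg g(2,3)] by (simp add: endpoint_eq_iff r)
  also have "\<dots> \<longleftrightarrow> matrix_inv g ** p ** g \<in> parabolic \<xi>"
    using pg g p by (simp add: parabolic_def SL_mult SL_matrix_inv matrix_mul_assoc)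
  finally show ?thesis .
qed

section \<open>Coordinate subspaces and the points \<open>z\<^sub>W\<close>\<close>

definition coord :: "'n set \<Rightarrow> (complex^'n::finite) set" where
  "coord S = {x. \<forall>i. i \<notin> S \<longrightarrow> x $ i = 0}"

definition two_valued :: "'n set \<Rightarrow> real \<Rightarrow> real \<Rightarrow> real^'n::finite" where
  "two_valued S a b = (\<chi> i. if i \<in> S then a else b)"

lemma dim_coord: "vec.dim (coord S) = card S"
  unfolding coord_def by (rule dim_substandard_cart)

lemma subspace_coord: "vec.subspace (coord S)"
  by (auto simp: vec.subspace_def coord_def)

lemma axis_in_coord: "axis i 1 \<in> coord S \<longleftrightarrow> i \<in> S"
  by (auto simp: coord_def axis_def)

lemma coord_eq_iff: "coord S = coord T \<longleftrightarrow> S = T"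
proof
  assume eq: "coord S = coord T"
  have "i \<in> S \<longleftrightarrow> i \<in> T" for i
    using axis_in_coord[of i S] axis_in_coord[of i T] by (simp only: eq)
  then show "S = T" by blast
qed simp

lemma inj_SL: "g \<in> SL \<Longrightarrow> inj ((*v) g)"
  by (rule inj_on_inverseI[of _ "(*v) (matrix_inv g)"])
     (simp add: matrix_vector_mul_assoc matrix_inv_mult_SL)

lemma SL_image_inv:
  assumes "g \<in> SL" shows "(*v) (matrix_inv g) ` (*v) g ` V = V" "(*v) g ` (*v) (matrix_inv g) ` V = V"
  using assms by (simp_all add: image_image matrix_vector_mul_assoc matrix_inv_mult_SL)

lemma in_SL_image_iff: "g \<in> SL \<Longrightarrow> y \<in> (*v) g ` V \<longleftrightarrow> matrix_inv g *v y \<in> V"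
proof
  assume "g \<in> SL" "y \<in> (*v) g ` V"
  then show "matrix_inv g *v y \<in> V"
    by (auto simp: matrix_vector_mul_assoc matrix_inv_mult_SL)
next
  assume g: "g \<in> SL" and y: "matrix_inv g *v y \<in> V"
  have "y = g *v (matrix_inv g *v y)" using g by (simp add: matrix_vector_mul_assoc matrix_inv_mult_SL)
  then show "y \<in> (*v) g ` V" using y by (rule image_eqI)
qed

lemma dim_image_SL:
  assumes "g \<in> SL" shows "vec.dim ((*v) g ` V) = vec.dim V"
proof -
  have le: "vec.dim ((*v) h ` V) \<le> vec.dim V" for h :: "'a cmat" and V
    by (rule vec.dim_image_le) simp
  show ?thesis
    using le[of g V] le[of "matrix_inv g" "(*v) g ` V"] assms by (simp add: SL_image_inv)
qed

lemma subspace_image: "vec.subspace V \<Longrightarrow> vec.subspace ((*v) (g :: 'n::finite cmat) ` V)"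
  by (rule vec.subspace_image) simp_all

lemma sum_axis: "(\<Sum>i\<in>UNIV. (x $ i) *s axis i 1) = (x :: complex^'n::finite)"
  by (simp add: vec_eq_iff axis_def if_distrib cong: if_cong)

lemma coord_span: "coord S = vec.span ((\<lambda>i. axis i 1) ` S)"
proof
  show "vec.span ((\<lambda>i. axis i 1) ` S) \<subseteq> coord S"
    by (intro vec.span_minimal subspace_coord) (auto simp: axis_in_coord)
  show "coord S \<subseteq> vec.span ((\<lambda>i. axis i 1) ` S)"
  proof
    fix x :: "complex^'a" assume x: "x \<in> coord S"
    have "(\<Sum>i\<in>UNIV. (x $ i) *s axis i 1) \<in> vec.span ((\<lambda>i. axis i 1) ` S)"
    proof (intro vec.span_sum)
      fix i
      show "(x $ i) *s axis i 1 \<in> vec.span ((\<lambda>i. axis i 1) ` S)"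
        using x by (cases "i \<in> S") (auto simp: coord_def intro: vec.span_scale vec.span_base vec.span_zero)
    qed
    then show "x \<in> vec.span ((\<lambda>i. axis i 1) ` S)" by (simp only: sum_axis)
  qed
qed

lemma maps_coord_iff:
  "(*v) m ` coord S \<subseteq> coord T \<longleftrightarrow> (\<forall>i j. i \<notin> T \<longrightarrow> j \<in> S \<longrightarrow> (m :: 'n::finite cmat) $ i $ j = 0)"
proof
  assume *: "(*v) m ` coord S \<subseteq> coord T"
  show "\<forall>i j. i \<notin> T \<longrightarrow> j \<in> S \<longrightarrow> m $ i $ j = 0"
  proof (intro allI impI)
    fix i j assume "i \<notin> T" "j \<in> S"
    then have "m *v axis j 1 \<in> coord T" using * axis_in_coord by blast
    then show "m $ i $ j = 0" using \<open>i \<notin> T\<close> mult_axis_nth[of m j i] by (simp add: coord_def)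
  qed
next
  assume *: "\<forall>i j. i \<notin> T \<longrightarrow> j \<in> S \<longrightarrow> m $ i $ j = 0"
  have "m $ i $ j * x $ j = 0" if "x \<in> coord S" "i \<notin> T" for x i j
    using * that by (cases "j \<in> S") (auto simp: coord_def)
  then show "(*v) m ` coord S \<subseteq> coord T"
    by (auto simp: coord_def matrix_vector_mult_def intro!: sum.neutral)
qed

lemma SL_maps_coord_eq:
  assumes "m \<in> SL" "(*v) m ` coord S \<subseteq> coord S" shows "(*v) m ` coord S = coord S"
  by (rule vec.subspace_dim_equal) (use assms in \<open>simp_all add: subspace_image subspace_coord dim_image_SL\<close>)

lemma parabolic_two_valued:
  assumes "b < a"
  shows "parabolic (two_valued S a b) = {p \<in> SL. \<forall>i j. i \<notin> S \<longrightarrow> j \<in> S \<longrightarrow> p $ i $ j = 0}"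
  using assms unfolding parabolic_def two_valued_def by auto

lemma stab_space_image_coord:
  assumes g: "g \<in> SL" and p: "p \<in> SL" and ab: "b < a"
  shows "p \<in> stab_space ((*v) g ` coord S) \<longleftrightarrow> matrix_inv g ** p ** g \<in> parabolic (two_valued S a b)"
proof -
  let ?m = "matrix_inv g ** p ** g"
  have m: "?m \<in> SL" using g p by (simp add: SL_mult SL_matrix_inv)
  have "p \<in> stab_space ((*v) g ` coord S) \<longleftrightarrow> (*v) p ` (*v) g ` coord S = (*v) g ` coord S"
    using p by (simp add: stab_space_def)
  also have "\<dots> \<longleftrightarrow> (*v) (matrix_inv g) ` (*v) p ` (*v) g ` coord S = (*v) (matrix_inv g) ` (*v) g ` coord S"
    by (rule inj_image_eq_iff[OF inj_SL[OF SL_matrix_inv[OF g]], symmetric])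
  also have "\<dots> \<longleftrightarrow> (*v) ?m ` coord S = coord S"
    using g by (simp add: SL_image_inv) (simp add: image_image matrix_vector_mul_assoc matrix_mul_assoc)
  also have "\<dots> \<longleftrightarrow> (*v) ?m ` coord S \<subseteq> coord S"
    by (intro iffI SL_maps_coord_eq[OF m]) simp_all
  also have "\<dots> \<longleftrightarrow> ?m \<in> parabolic (two_valued S a b)"
    using m by (simp add: maps_coord_iff parabolic_two_valued[OF ab])
  finally show ?thesis .
qed

lemma stab_inf_two_valued:
  assumes g: "g \<in> SL" "trace0 (two_valued S a b)" "knorm (two_valued S a b) = 1" and ab: "b < a"
  shows "stab_inf (endpoint (line g (two_valued S a b))) = stab_space ((*v) g ` coord S)"
proof -
  have "p \<in> stab_inf (endpoint (line g (two_valued S a b))) \<longleftrightarrow> p \<in> stab_space ((*v) g ` coord S)"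
    if "p \<in> SL" for p
    using stab_inf_line[OF g that] stab_space_image_coord[OF g(1) that ab] by simp
  moreover have "stab_inf (endpoint (line g (two_valued S a b))) \<subseteq> SL" "stab_space ((*v) g ` coord S) \<subseteq> SL"
    by (auto simp: stab_inf_def stab_space_def)
  ultimately show ?thesis by blast
qed

lemma ex_transvection:
  fixes i j :: "'n::finite"
  assumes "i \<noteq> j"
  obtains e :: "'n cmat" where "e \<in> SL" "\<And>x. e *v x = x + (x $ j) *s axis i 1"
    "\<And>k l. e $ k $ l = (if k = l then 1 else 0) + (if k = i \<and> l = j then 1 else 0)"
proof -
  define e :: "'n cmat" where "e = (\<chi> k. if k = i then row i (mat 1) + 1 *s row j (mat 1) else row k (mat 1))"
  have entries: "e $ k $ l = (if k = l then 1 else 0) + (if k = i \<and> l = j then 1 else 0)" for k l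
    using assms by (auto simp: e_def row_def mat_def)
  have "det e = 1" unfolding e_def using det_row_operation[OF assms, of "mat 1" 1] by simp
  moreover have "e *v x = x + (x $ j) *s axis i 1" for x
  proof -
    have "(e *v x) $ k = (x + (x $ j) *s axis i 1) $ k" for k
    proof -
      have "(e *v x) $ k = (\<Sum>l\<in>UNIV. (if l = k then x $ k else 0) + (if l = j then (if k = i then x $ j else 0) else 0))"
        unfolding matrix_vector_mult_def using assms
        by (simp only: vec_lambda_beta entries) (intro sum.cong, auto)
      also have "\<dots> = x $ k + (if k = i then x $ j else 0)"
        by (simp add: sum.distrib)
      finally show ?thesis by (simp add: axis_def)
    qed
    then show ?thesis by (simp add: vec_eq_iff)
  qed
  ultimately show ?thesis using that entries by (simp add: SL_def)
qed

text \<open>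
  A transvection \<open>x \<mapsto> x + x\<^sub>j e\<^sub>i\<close> with \<open>i \<in> S\<close> or \<open>j \<notin> S\<close> belongs to the group, so an invariant
  subspace containing \<open>x\<close> with \<open>x\<^sub>j \<noteq> 0\<close> contains \<open>e\<^sub>i\<close>.
\<close>
lemma parabolic_invariant_subspace:
  fixes U :: "(complex^'n::finite) set"
  assumes U: "vec.subspace U" and inv: "\<And>p x. p \<in> parabolic (two_valued S a b) \<Longrightarrow> x \<in> U \<Longrightarrow> p *v x \<in> U"
    and ab: "b < a"
  shows "U \<subseteq> {0} \<or> U = coord S \<or> U = UNIV"
proof -
  have step: "axis i 1 \<in> U" if x: "x \<in> U" "x $ j \<noteq> 0" and ij: "i \<noteq> j" "i \<in> S \<or> j \<notin> S" for x i j
  proof -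
    obtain e :: "'n cmat" where e: "e \<in> SL" "\<And>x. e *v x = x + (x $ j) *s axis i 1"
      "\<And>k l. e $ k $ l = (if k = l then 1 else 0) + (if k = i \<and> l = j then 1 else 0)"
      using ex_transvection[OF ij(1)] by blast
    have "e \<in> parabolic (two_valued S a b)"
      using e(1) ij by (auto simp: parabolic_two_valued[OF ab] e(3))
    from vec.subspace_diff[OF U inv[OF this x(1)] x(1)] have "(x $ j) *s axis i 1 \<in> U"
      by (simp add: e(2))
    from vec.subspace_scale[OF U this] have "inverse (x $ j) *s ((x $ j) *s axis i 1) \<in> U" .
    then show ?thesis using x(2) by (simp add: vector_smult_assoc)
  qed
  have self: "axis j 1 \<in> U" if x: "x \<in> U" "x $ j \<noteq> 0" and all: "\<And>i. i \<noteq> j \<Longrightarrow> x $ i \<noteq> 0 \<Longrightarrow> axis i 1 \<in> U" for x j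
  proof -
    have others: "(\<Sum>i\<in>UNIV - {j}. (x $ i) *s axis i 1) \<in> U"
    proof (rule vec.subspace_sum[OF U])
      fix i assume "i \<in> UNIV - {j}"
      then show "(x $ i) *s axis i 1 \<in> U"
        using all[of i] U by (cases "x $ i = 0") (auto simp: vec.subspace_scale vec.subspace_0)
    qed
    have "x = (x $ j) *s axis j 1 + (\<Sum>i\<in>UNIV - {j}. (x $ i) *s axis i 1)"
      using sum_axis[of x] by (subst (asm) sum.remove[of _ j]) simp_all
    then have "x - (\<Sum>i\<in>UNIV - {j}. (x $ i) *s axis i 1) = (x $ j) *s axis j 1"
      by (simp only: diff_eq_eq)
    with vec.subspace_diff[OF U x(1) others] have "(x $ j) *s axis j 1 \<in> U" by simp
    from vec.subspace_scale[OF U this] have "inverse (x $ j) *s ((x $ j) *s axis j 1) \<in> U" .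
    then show ?thesis using x(2) by (simp add: vector_smult_assoc)
  qed
  have full: "coord T \<subseteq> U" if "\<And>i. i \<in> T \<Longrightarrow> axis i 1 \<in> U" for T
    unfolding coord_span using that U by (intro vec.span_minimal) auto
  show ?thesis
  proof (cases "U \<subseteq> coord S")
    case True
    show ?thesis
    proof (cases "U \<subseteq> {0}")
      case False
      then obtain x where x: "x \<in> U" "x \<noteq> 0" by auto
      from x(2) obtain j where j: "x $ j \<noteq> 0" by (metis vec_eq_iff zero_index)
      have xS: "i \<in> S" if "x $ i \<noteq> 0" for i using x True that by (auto simp: coord_def)
      have "axis j 1 \<in> U"
      proof (rule self[OF x(1) j])
        fix i assume "i \<noteq> j" "x $ i \<noteq> 0"
        then show "axis i 1 \<in> U" using step[OF x(1) j] xS by blast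
      qed
      then have "axis i 1 \<in> U" if "i \<in> S" for i
        using step[OF x(1) j, of i] that by (cases "i = j") auto
      then show ?thesis using full[of S] True by blast
    qed simp
  next
    case False
    then obtain x j where x: "x \<in> U" "j \<notin> S" "x $ j \<noteq> 0" by (auto simp: coord_def)
    have "axis j 1 \<in> U"
    proof (rule self[OF x(1,3)])
      fix i assume "i \<noteq> j"
      then show "axis i 1 \<in> U" using step[OF x(1,3)] x(2) by blast
    qed
    then have "axis i 1 \<in> U" for i
      using step[OF x(1,3), of i] x(2) by (cases "i = j") auto
    then have "coord UNIV \<subseteq> U" by (intro full)
    then show ?thesis by (auto simp: coord_def)
  qed
qed

lemma sum_two_valued:
  "(\<Sum>i\<in>UNIV. f (two_valued S a b $ i)) = real (card S) * f a + real (card (- S)) * (f b :: real)"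
proof -
  have "(\<Sum>i\<in>UNIV. f (two_valued S a b $ i)) = (\<Sum>i\<in>S. f (two_valued S a b $ i)) + (\<Sum>i\<in>-S. f (two_valued S a b $ i))"
    by (subst sum.union_disjoint[symmetric]) (auto simp: Compl_partition)
  also have "\<dots> = (\<Sum>i\<in>S. f a) + (\<Sum>i\<in>-S. f b)"
    by (intro arg_cong2[where f = "(+)"] sum.cong) (auto simp: two_valued_def)
  finally show ?thesis by simp
qed

lemma card_Compl_nonzero:
  "S \<noteq> {} \<Longrightarrow> 0 < card S" "S \<noteq> UNIV \<Longrightarrow> 0 < card (- (S :: 'n::finite set))"
  by (auto simp: card_gt_0_iff)

lemma card_Compl_UNIV: "card (- S) = CARD('n) - card (S :: 'n::finite set)"
  by (simp add: Compl_eq_Diff_UNIV card_Diff_subset)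

lemma two_valued_uminus: "- two_valued S a b = two_valued (- S) (- b) (- a)"
  by (auto simp: two_valued_def vec_eq_iff)

lemma trace0_two_valued: "trace0 (two_valued S a b) \<longleftrightarrow> real (card S) * a + real (card (- S)) * b = 0"
  unfolding trace0_def using sum_two_valued[of "\<lambda>x. x" S a b] by simp

lemma norm_two_valued: "(norm (two_valued S a b :: real^'n::finite))\<^sup>2 = real (card S) * a\<^sup>2 + real (card (- S)) * b\<^sup>2"
  using sum_two_valued[of "\<lambda>x. x\<^sup>2" S a b] by (simp add: norm_vec_def L2_set_def sum_nonneg)

lemma two_valued_normalization:
  fixes S T :: "'n::finite set"
  assumes c: "card S = card T" "S \<noteq> {}" "S \<noteq> UNIV"
    and S: "trace0 (two_valued S a b)" "knorm (two_valued S a b) = r" "b < a"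
    and T: "trace0 (two_valued T a' b')" "knorm (two_valued T a' b') = r" "b' < a'"
  shows "a = a' \<and> b = b'"
proof -
  define m where "m = real (card S)" define k where "k = real (card (- S))"
  have mk: "0 < m" "0 < k" using card_Compl_nonzero c by (auto simp: m_def k_def)
  have ct: "real (card T) = m" "real (card (- T)) = k"
    using c by (simp_all add: m_def k_def Compl_eq_Diff_UNIV card_Diff_subset)
  have "sqrt (4 * real CARD('n)) * norm (two_valued S a b) = sqrt (4 * real CARD('n)) * norm (two_valued T a' b')"
    using S(2) T(2) unfolding knorm_def by (simp only:)
  then have "(norm (two_valued S a b))\<^sup>2 = (norm (two_valued T a' b'))\<^sup>2" by simp
  then have n: "m * a\<^sup>2 + k * b\<^sup>2 = m * a'\<^sup>2 + k * b'\<^sup>2"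
    by (simp add: norm_two_valued ct flip: m_def k_def)
  have b: "b = - (m * a / k)" "b' = - (m * a' / k)"
    using S(1) T(1) mk by (simp_all add: trace0_two_valued ct field_simps flip: m_def k_def)
  have pos: "0 < x" if "- (m * x / k) < x" for x
  proof -
    have "0 < x + m * x / k" using that by simp
    also have "\<dots> = x * (1 + m / k)" by (simp add: algebra_simps)
    finally show ?thesis by (rule zero_less_mult_pos2) (use mk in \<open>simp add: add_pos_pos\<close>)
  qed
  have "0 < a" "0 < a'" using S(3) T(3) pos unfolding b by auto
  moreover have "a\<^sup>2 * (m + m\<^sup>2 / k) = a'\<^sup>2 * (m + m\<^sup>2 / k)"
    using n mk unfolding b by (simp add: power_mult_distrib power_divide field_simps power2_eq_square)
  moreover have "0 < m + m\<^sup>2 / k" using mk by (simp add: add_pos_pos)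
  ultimately have "a\<^sup>2 = a'\<^sup>2" "0 < a" "0 < a'" by auto
  then have "a = a'" by (simp add: power2_eq_iff)
  then show ?thesis using b by simp
qed

text \<open>
  The coordinate subspace of the indices with \<open>\<eta>\<^sub>i \<ge> c\<close> is invariant under the parabolic group of \<open>\<eta>\<close>.
  Transported to the side of \<open>g\<close>, it is invariant under the parabolic group of \<open>S\<close>, which leaves only
  three possibilities; so \<open>\<eta>\<close> has just two values, and the normalization determines them.
\<close>
lemma endpoint_stab_eq_structure:
  fixes g h :: "'n::finite cmat"
  assumes g: "g \<in> SL" "trace0 (two_valued S a b)" "knorm (two_valued S a b) = 1"
    and ab: "b < a" and S: "S \<noteq> {}" "S \<noteq> UNIV"
    and h: "h \<in> SL" "trace0 \<eta>" "knorm \<eta> = 1"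
    and eq: "stab_inf (endpoint (line h \<eta>)) = stab_space ((*v) g ` coord S)"
  obtains T where "\<eta> = two_valued T a b" "card T = card S" "(*v) h ` coord T = (*v) g ` coord S"
proof -
  define M where "M = matrix_inv h ** g"
  have M: "M \<in> SL" using g h by (simp add: M_def SL_mult SL_matrix_inv)
  have conj: "M ** l ** matrix_inv M \<in> parabolic \<eta>" if l: "l \<in> parabolic (two_valued S a b)" for l
  proof -
    have lSL: "l \<in> SL" using l by (simp add: parabolic_def)
    define p where "p = g ** l ** matrix_inv g"
    have p: "p \<in> SL" using g lSL by (simp add: p_def SL_mult SL_matrix_inv)
    have "matrix_inv g ** p ** g = l"
      using g(1) by (simp add: p_def matrix_inv_cancel_SL matrix_mul_assoc matrix_inv_mult_SL)
    then have "p \<in> stab_space ((*v) g ` coord S)"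
      using stab_space_image_coord[OF g(1) p ab] l by simp
    then have "matrix_inv h ** p ** h \<in> parabolic \<eta>"
      using stab_inf_line[OF h p] eq by simp
    moreover have "matrix_inv h ** p ** h = M ** l ** matrix_inv M"
      using g(1) h(1) by (simp add: p_def M_def matrix_inv_mult SL_matrix_inv matrix_inv_inv matrix_mul_assoc)
    ultimately show ?thesis by simp
  qed
  have \<eta>_inv: "p *v x \<in> coord {i. c \<le> \<eta> $ i}" if "p \<in> parabolic \<eta>" "x \<in> coord {i. c \<le> \<eta> $ i}" for p x c
  proof -
    have "(*v) p ` coord {i. c \<le> \<eta> $ i} \<subseteq> coord {i. c \<le> \<eta> $ i}"
      unfolding maps_coord_iff using that(1) by (force simp: parabolic_def)
    then show ?thesis using that(2) by blast
  qed
  have level: "{i. c \<le> \<eta> $ i} = {} \<or> (*v) M ` coord S = coord {i. c \<le> \<eta> $ i} \<or> {i. c \<le> \<eta> $ i} = UNIV" for c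
  proof -
    \<comment> \<open>The coordinate subspace of a level set, transported to the side of \<open>g\<close>.\<close>
    define U where "U = (*v) (matrix_inv M) ` coord {i. c \<le> \<eta> $ i}"
    have U: "vec.subspace U" by (simp add: U_def subspace_image subspace_coord)
    have MU: "(*v) M ` U = coord {i. c \<le> \<eta> $ i}" using M by (simp add: U_def SL_image_inv)
    have "U \<subseteq> {0} \<or> U = coord S \<or> U = UNIV"
    proof (rule parabolic_invariant_subspace[OF U _ ab])
      fix l x assume l: "l \<in> parabolic (two_valued S a b)" and "x \<in> U"
      then obtain y where y: "y \<in> coord {i. c \<le> \<eta> $ i}" "x = matrix_inv M *v y" by (auto simp: U_def)
      have "(M ** l ** matrix_inv M) *v y \<in> coord {i. c \<le> \<eta> $ i}" by (rule \<eta>_inv[OF conj[OF l] y(1)])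
      moreover have "l *v x = matrix_inv M *v ((M ** l ** matrix_inv M) *v y)"
        using M by (simp add: y(2) matrix_vector_mul_assoc matrix_mul_assoc matrix_inv_mult_SL)
      ultimately show "l *v x \<in> U" by (simp add: U_def)
    qed
    then show ?thesis
    proof (elim disjE)
      assume "U \<subseteq> {0}"
      then have "coord {i. c \<le> \<eta> $ i} \<subseteq> {0}" unfolding MU[symmetric] by auto
      moreover have "axis i 1 \<noteq> (0 :: complex^'n)" for i by (simp add: vec_eq_iff axis_def)
      ultimately have "i \<notin> {i. c \<le> \<eta> $ i}" for i
        using axis_in_coord[of i "{i. c \<le> \<eta> $ i}"] by (metis singletonD subsetD)
      then have "{i. c \<le> \<eta> $ i} = {}" by blast
      then show ?thesis by simp
    next
      assume "U = coord S" then show ?thesis using MU by simp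
    next
      assume "U = UNIV"
      moreover have "(*v) M ` UNIV = UNIV"
        using SL_image_inv(2)[OF M, of UNIV] by blast
      ultimately have "coord {i. c \<le> \<eta> $ i} = UNIV" using MU by simp
      then have "i \<in> {i. c \<le> \<eta> $ i}" for i
        using axis_in_coord[of i "{i. c \<le> \<eta> $ i}"] by simp
      then have "{i. c \<le> \<eta> $ i} = UNIV" by blast
      then show ?thesis by simp
    qed
  qed
  define a' where "a' = Max (range (($) \<eta>))"
  have max: "\<eta> $ i \<le> a'" for i by (simp add: a'_def)
  have "a' \<in> range (($) \<eta>)" unfolding a'_def by (rule Max_in) auto
  then obtain i0 where i0: "\<eta> $ i0 = a'" by (metis rangeE)
  define T where "T = {i. a' \<le> \<eta> $ i}"
  have "i0 \<in> T" by (simp add: T_def i0)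
  have T_univ: "T \<noteq> UNIV"
  proof
    assume "T = UNIV"
    then have const: "\<eta> $ i = a'" for i using max[of i] by (auto simp: T_def intro: antisym)
    then have "real CARD('n) * a' = 0" using h(2) by (simp add: trace0_def)
    then have "\<eta> = 0" using const by (simp add: vec_eq_iff)
    then show False using h(3) by simp
  qed
  have MT: "(*v) M ` coord S = coord T" using level[of a'] T_univ \<open>i0 \<in> T\<close> by (auto simp: T_def)
  obtain k0 where k0: "k0 \<notin> T" using T_univ by blast
  have le: "\<eta> $ i \<le> \<eta> $ k" if "i \<notin> T" "k \<notin> T" for i k
  proof (rule ccontr)
    assume "\<not> \<eta> $ i \<le> \<eta> $ k"
    then have "coord {j. \<eta> $ i \<le> \<eta> $ j} = coord T" using level[of "\<eta> $ i"] MT by auto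
    then show False using that(1) by (auto simp: coord_eq_iff)
  qed
  define b' where "b' = \<eta> $ k0"
  have "\<eta> $ i = two_valued T a' b' $ i" for i
  proof (cases "i \<in> T")
    case True
    then show ?thesis using max[of i] by (simp add: T_def two_valued_def)
  next
    case False
    then show ?thesis using le[OF False k0] le[OF k0 False] by (simp add: two_valued_def b'_def)
  qed
  then have \<eta>: "\<eta> = two_valued T a' b'" by (simp add: vec_eq_iff)
  have "b' < a'" using k0 by (simp add: T_def b'_def)
  have "vec.dim (coord T) = vec.dim (coord S)" using dim_image_SL[OF M, of "coord S"] MT by simp
  then have card: "card S = card T" by (simp add: dim_coord)
  have "a = a' \<and> b = b'"
    using two_valued_normalization[OF card S g(2,3) ab _ _ \<open>b' < a'\<close>] h \<eta> by simp
  moreover have "(*v) h ` coord T = (*v) g ` coord S"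
    unfolding MT[symmetric] M_def using h(1)
    by (simp add: image_image matrix_vector_mul_assoc matrix_inv_cancel_SL)
  ultimately show ?thesis using that \<eta> card by simp
qed

text \<open>
  A competing point of \<open>Z(\<infinity>)\<close> is the end of some \<open>line h \<eta>\<close>.  By \<open>endpoint_stab_eq_structure\<close> the
  matrix \<open>h\<^sup>-\<^sup>1 g\<close> maps the one coordinate subspace to the other, which makes the two lines asymptotic.
\<close>
lemma z_of_image_coord:
  fixes g :: "'n::finite cmat"
  assumes g: "g \<in> SL" "trace0 (two_valued S a b)" "knorm (two_valued S a b) = 1"
    and ab: "b < a" and S: "S \<noteq> {}" "S \<noteq> UNIV"
  shows "z_of ((*v) g ` coord S) = endpoint (line g (two_valued S a b))"
  unfolding z_of_def
proof (rule the_equality)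
  show "endpoint (line g (two_valued S a b)) \<in> Zinf \<and>
    stab_inf (endpoint (line g (two_valued S a b))) = stab_space ((*v) g ` coord S)"
    using g ab by (simp add: endpoint_Zinf ray_line stab_inf_two_valued)
next
  fix p assume p: "p \<in> Zinf \<and> stab_inf p = stab_space ((*v) g ` coord S)"
  then obtain h \<eta> where h: "h \<in> SL" "trace0 \<eta>" "knorm \<eta> = 1" "p = endpoint (line h \<eta>)"
    using Zinf_cases by blast
  obtain T where T: "\<eta> = two_valued T a b" "card T = card S" "(*v) h ` coord T = (*v) g ` coord S"
    by (rule endpoint_stab_eq_structure[OF g ab S h(1-3)]) (use p h in auto)
  have "(*v) (matrix_inv h ** g) ` coord S = (*v) (matrix_inv h) ` (*v) h ` coord T"
    unfolding T(3) by (simp add: image_image matrix_vector_mul_assoc)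
  then have "(*v) (matrix_inv h ** g) ` coord S \<subseteq> coord T" using h by (simp add: SL_image_inv)
  then have "(line h \<eta>, line g (two_valued S a b)) \<in> asymptotic"
    unfolding asymptotic_line_iff[OF h(1-3) g] maps_coord_iff
    using ab by (auto simp: T(1) two_valued_def)
  then show "p = endpoint (line g (two_valued S a b))"
    using h g by (simp add: endpoint_eq_iff ray_line)
qed

section \<open>Hermitian metrics and adapted elements\<close>

text \<open>
  The metric on \<open>\<complex>\<^sup>n\<close> for which the columns of \<open>g\<close> are an orthonormal basis.
\<close>
definition frame_metric :: "'n::finite cmat \<Rightarrow> 'n form" where
  "frame_metric g x y = cinner (matrix_inv g *v x) (matrix_inv g *v y)"

lemma herm_metric_frame_metric:
  assumes "g \<in> SL" shows "herm_metric W (frame_metric g)"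
proof -
  have nz: "matrix_inv g *v x \<noteq> 0" if "x \<noteq> 0" for x
    using injD[OF inj_SL[OF SL_matrix_inv[OF assms]], of x 0] that by auto
  have "0 < Re (cinner y y)" if "y \<noteq> 0" for y :: "complex^'a"
    using that by (simp add: cinner_self)
  then show ?thesis
    unfolding herm_metric_def frame_metric_def using nz
    by (simp add: matrix_vector_right_distrib vector_scalar_commute cinner_add_left cinner_scale_left cnj_cinner)
qed

lemma herm_metricD:
  assumes "herm_metric W h"
  shows "x \<in> W \<Longrightarrow> y \<in> W \<Longrightarrow> z \<in> W \<Longrightarrow> h (a *s x + b *s y) z = a * h x z + b * h y z"
    and "x \<in> W \<Longrightarrow> y \<in> W \<Longrightarrow> h y x = cnj (h x y)"
    and "x \<in> W \<Longrightarrow> x \<noteq> 0 \<Longrightarrow> 0 < Re (h x x)"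
  using assms unfolding herm_metric_def by blast+

lemma herm_metric_scale:
  assumes "herm_metric W h" "0 < \<alpha>"
  shows "herm_metric W (\<lambda>x y. complex_of_real \<alpha> * h x y)"
  unfolding herm_metric_def
proof (intro conjI ballI allI impI)
  fix x y z a b assume "x \<in> W" "y \<in> W" "z \<in> W"
  then have "h (a *s x + b *s y) z = a * h x z + b * h y z" by (rule herm_metricD[OF assms(1)])
  then show "complex_of_real \<alpha> * h (a *s x + b *s y) z =
      a * (complex_of_real \<alpha> * h x z) + b * (complex_of_real \<alpha> * h y z)"
    by (simp add: algebra_simps)
next
  fix x y assume "x \<in> W" "y \<in> W"
  then have "h y x = cnj (h x y)" by (rule herm_metricD[OF assms(1)])
  then show "complex_of_real \<alpha> * h y x = cnj (complex_of_real \<alpha> * h x y)" by simp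
next
  fix x assume "x \<in> W" "x \<noteq> 0"
  then have "0 < Re (h x x)" by (rule herm_metricD[OF assms(1)])
  then show "0 < Re (complex_of_real \<alpha> * h x x)" using assms(2) by simp
qed

lemma metric_equiv_equiv: "equiv (Collect (herm_metric W)) (metric_equiv W)"
proof (rule equivI)
  show "metric_equiv W \<subseteq> Collect (herm_metric W) \<times> Collect (herm_metric W)"
    by (auto simp: metric_equiv_def)
  show "refl_on (Collect (herm_metric W)) (metric_equiv W)"
    by (auto simp: refl_on_def metric_equiv_def intro!: exI[of _ 1])
  show "sym (metric_equiv W)"
  proof (rule symI)
    fix h k assume "(h, k) \<in> metric_equiv W"
    then obtain \<alpha> where hk: "herm_metric W h" "herm_metric W k" "0 < \<alpha>"
      "\<forall>x\<in>W. \<forall>y\<in>W. k x y = complex_of_real \<alpha> * h x y" by (auto simp: metric_equiv_def)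
    then have "\<forall>x\<in>W. \<forall>y\<in>W. h x y = complex_of_real (inverse \<alpha>) * k x y" by simp
    moreover have "0 < inverse \<alpha>" using hk by simp
    ultimately show "(k, h) \<in> metric_equiv W"
      unfolding metric_equiv_def using hk(1,2) by blast
  qed
  show "trans (metric_equiv W)"
  proof (rule transI)
    fix h k l assume "(h, k) \<in> metric_equiv W" "(k, l) \<in> metric_equiv W"
    then obtain \<alpha> \<beta> where hk: "herm_metric W h" "herm_metric W l" "0 < \<alpha>" "0 < \<beta>"
      "\<forall>x\<in>W. \<forall>y\<in>W. k x y = complex_of_real \<alpha> * h x y"
      "\<forall>x\<in>W. \<forall>y\<in>W. l x y = complex_of_real \<beta> * k x y" by (auto simp: metric_equiv_def)
    then have "\<forall>x\<in>W. \<forall>y\<in>W. l x y = complex_of_real (\<beta> * \<alpha>) * h x y" by simp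
    moreover have "0 < \<beta> * \<alpha>" using hk by simp
    ultimately show "(h, l) \<in> metric_equiv W"
      unfolding metric_equiv_def using hk(1,2) by blast
  qed
qed

lemma metric_class_eq_iff:
  assumes "herm_metric W h" "herm_metric W k"
  shows "metric_class W h = metric_class W k \<longleftrightarrow> (h, k) \<in> metric_equiv W"
  unfolding metric_class_def using eq_equiv_class_iff[OF metric_equiv_equiv, of h W k] assms by simp

lemma metric_classes_eq: "metric_classes W = metric_class W ` Collect (herm_metric W)"
  unfolding metric_classes_def quotient_def metric_class_def[abs_def] by (rule UNION_singleton_eq_range)

lemma metric_class_self: "herm_metric W h \<Longrightarrow> h \<in> metric_class W h"
  using equiv_class_self[OF metric_equiv_equiv] by (simp add: metric_class_def)

lemma image_coord_span: "(*v) g ` coord S = vec.span ((\<lambda>i. g *v axis i 1) ` S)"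
  unfolding coord_span
  by (subst vec.linear_span_image[OF matrix_vector_mul_linear_gen, symmetric]) (simp add: image_image)

lemma herm_metric_sum_left:
  assumes h: "herm_metric W h" and W: "vec.subspace W" and z: "z \<in> W"
    and f: "\<And>i. i \<in> I \<Longrightarrow> f i \<in> W"
  shows "h (\<Sum>i\<in>I. c i *s f i) z = (\<Sum>i\<in>I. c i * h (f i) z)"
proof -
  have lin: "h (a *s x + b *s y) z = a * h x z + b * h y z" if "x \<in> W" "y \<in> W" for x y a b
    using that z by (intro herm_metricD[OF h])
  have zero: "h 0 z = 0" using lin[of 0 0 0 0] W by (simp add: vec.subspace_0)
  show ?thesis using f
  proof (induction I rule: infinite_finite_induct)
    case (insert i I)
    have "(\<Sum>i\<in>I. c i *s f i) \<in> W"
      using insert.prems W by (intro vec.subspace_sum) (auto intro: vec.subspace_scale)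
    then have "h (c i *s f i + 1 *s (\<Sum>i\<in>I. c i *s f i)) z = c i * h (f i) z + 1 * h (\<Sum>i\<in>I. c i *s f i) z"
      using insert.prems by (intro lin) auto
    then show ?case using insert by simp
  qed (simp_all add: zero)
qed

lemma herm_metric_eq_frame_metric:
  assumes h: "herm_metric W h" and g: "g \<in> SL" and W: "W = (*v) g ` coord S"
    and on: "\<And>i j. i \<in> S \<Longrightarrow> j \<in> S \<Longrightarrow> h (g *v axis i 1) (g *v axis j 1) = (if i = j then 1 else 0)"
    and xy: "x \<in> W" "y \<in> W"
  shows "h x y = frame_metric g x y"
proof -
  have sW: "vec.subspace W" unfolding W by (intro subspace_image subspace_coord)
  have e: "g *v axis i 1 \<in> W" if "i \<in> S" for i using that by (simp add: W axis_in_coord)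
  have expand: "z = (\<Sum>i\<in>S. (matrix_inv g *v z) $ i *s (g *v axis i 1))" if "z \<in> W" for z
  proof -
    have "matrix_inv g *v z \<in> coord S" using that g by (simp add: W in_SL_image_iff)
    then have "(\<Sum>i\<in>UNIV. (matrix_inv g *v z) $ i *s axis i 1) = (\<Sum>i\<in>S. (matrix_inv g *v z) $ i *s axis i 1)"
      by (intro sum.mono_neutral_right) (auto simp: coord_def)
    then have "g *v (matrix_inv g *v z) = g *v (\<Sum>i\<in>S. (matrix_inv g *v z) $ i *s axis i 1)"
      by (simp only: sum_axis)
    then show ?thesis
      using g by (simp add: matrix_vector_mul_assoc matrix_inv_mult_SL vec.sum vector_scalar_commute)
  qed
  define u where "u = matrix_inv g *v x" define v where "v = matrix_inv g *v y"
  have "u \<in> coord S" using xy g by (simp add: u_def W in_SL_image_iff)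
  then have u0: "u $ i = 0" if "i \<notin> S" for i using that by (simp add: coord_def)
  have sym: "h a b = cnj (h b a)" if "a \<in> W" "b \<in> W" for a b
    using that by (intro herm_metricD[OF h])
  have "h x y = (\<Sum>i\<in>S. u $ i * h (g *v axis i 1) y)"
    using herm_metric_sum_left[OF h sW xy(2), of S "\<lambda>i. g *v axis i 1" "\<lambda>i. u $ i"] e expand[OF xy(1)]
    by (simp add: u_def)
  also have "\<dots> = (\<Sum>i\<in>S. u $ i * cnj (v $ i))"
  proof (rule sum.cong[OF refl])
    fix i assume i: "i \<in> S"
    have "h y (g *v axis i 1) = (\<Sum>j\<in>S. v $ j * h (g *v axis j 1) (g *v axis i 1))"
      using herm_metric_sum_left[OF h sW e[OF i], of S "\<lambda>i. g *v axis i 1" "\<lambda>i. v $ i"] e expand[OF xy(2)]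
      by (simp add: v_def)
    also have "\<dots> = (\<Sum>j\<in>S. if j = i then v $ i else 0)"
      by (rule sum.cong) (auto simp: on i)
    also have "\<dots> = v $ i" using i by simp
    finally show "u $ i * h (g *v axis i 1) y = u $ i * cnj (v $ i)"
      using sym[OF e[OF i] xy(2)] by simp
  qed
  also have "\<dots> = (\<Sum>i\<in>UNIV. u $ i * cnj (v $ i))"
    by (rule sum.mono_neutral_left) (auto simp: u0)
  finally show ?thesis by (simp add: frame_metric_def cinner_def u_def v_def)
qed

lemma orthonormal_basis_iff:
  assumes g: "g \<in> SL" and h: "herm_metric W h"
  shows "orthonormal_basis W h S (\<lambda>i. g *v axis i 1) \<longleftrightarrow>
    W = (*v) g ` coord S \<and> (\<forall>x\<in>W. \<forall>y\<in>W. h x y = frame_metric g x y)"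
proof
  assume *: "orthonormal_basis W h S (\<lambda>i. g *v axis i 1)"
  then have W: "W = (*v) g ` coord S" by (simp add: orthonormal_basis_def image_coord_span)
  moreover have "h x y = frame_metric g x y" if "x \<in> W" "y \<in> W" for x y
    by (rule herm_metric_eq_frame_metric[OF h g W _ that]) (use * in \<open>simp add: orthonormal_basis_def\<close>)
  ultimately show "W = (*v) g ` coord S \<and> (\<forall>x\<in>W. \<forall>y\<in>W. h x y = frame_metric g x y)" by blast
next
  assume *: "W = (*v) g ` coord S \<and> (\<forall>x\<in>W. \<forall>y\<in>W. h x y = frame_metric g x y)"
  then have W: "W = (*v) g ` coord S" by blast
  have e: "g *v axis i 1 \<in> W" if "i \<in> S" for i using that by (simp add: W axis_in_coord)
  have "frame_metric g (g *v axis i 1) (g *v axis j 1) = (if i = j then 1 else 0)" for i j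
    using g by (simp add: frame_metric_def matrix_vector_mul_assoc matrix_inv_mult_SL cinner_axis)
  then show "orthonormal_basis W h S (\<lambda>i. g *v axis i 1)"
    unfolding orthonormal_basis_def using * e by (simp add: W[symmetric] image_coord_span[symmetric])
qed

lemma ex_orthonormal_basis_class_iff:
  assumes g: "g \<in> SL" and H: "H \<in> metric_classes W"
  shows "(\<exists>k\<in>H. orthonormal_basis W k S (\<lambda>i. g *v axis i 1)) \<longleftrightarrow>
    W = (*v) g ` coord S \<and> H = metric_class W (frame_metric g)"
proof -
  obtain h where h: "herm_metric W h" "H = metric_class W h" using H by (auto simp: metric_classes_eq)
  have hk: "herm_metric W k" if "k \<in> H" for k
    using that by (auto simp: h metric_class_def metric_equiv_def)
  note gm = herm_metric_frame_metric[OF g, of W]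
  show ?thesis
  proof
    assume "\<exists>k\<in>H. orthonormal_basis W k S (\<lambda>i. g *v axis i 1)"
    then obtain k where k: "k \<in> H" "W = (*v) g ` coord S" "\<forall>x\<in>W. \<forall>y\<in>W. k x y = frame_metric g x y"
      using orthonormal_basis_iff[OF g] hk by blast
    have "metric_class W (frame_metric g) = metric_class W k"
      using metric_class_eq_iff[OF gm hk[OF k(1)]] gm hk[OF k(1)] k(3)
      by (auto simp: metric_equiv_def intro!: exI[of _ 1])
    moreover have "metric_class W k = H"
      using metric_class_eq_iff[OF h(1) hk[OF k(1)]] k(1) h(2) by (simp add: metric_class_def)
    ultimately show "W = (*v) g ` coord S \<and> H = metric_class W (frame_metric g)" using k by simp
  next
    assume *: "W = (*v) g ` coord S \<and> H = metric_class W (frame_metric g)"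
    have "orthonormal_basis W (frame_metric g) S (\<lambda>i. g *v axis i 1)"
      using orthonormal_basis_iff[OF g gm] * by blast
    then show "\<exists>k\<in>H. orthonormal_basis W k S (\<lambda>i. g *v axis i 1)"
      using metric_class_self[OF gm] * by blast
  qed
qed

text \<open>
  The family is built up one index at a time.  Its dimension is kept in the induction: it shows that
  there is a vector of \<open>W\<close> left to continue with, and in the end that the family spans \<open>W\<close>.
\<close>
lemma ex_orthonormal_family:
  fixes W :: "(complex^'n::finite) set"
  assumes h: "herm_metric W h" and W: "vec.subspace W" and S: "card S = vec.dim W" "finite S"
  shows "\<exists>v. (\<forall>i\<in>S. v i \<in> W) \<and> (\<forall>i\<in>S. \<forall>j\<in>S. h (v i) (v j) = (if i = j then 1 else 0)) \<and>
    vec.span (v ` S) = W"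
proof -
  have "\<exists>v. (\<forall>i\<in>R. v i \<in> W) \<and> (\<forall>i\<in>R. \<forall>j\<in>R. h (v i) (v j) = (if i = j then 1 else 0)) \<and>
    vec.dim (v ` R) = card R" if "R \<subseteq> S" for R
    using finite_subset[OF that S(2)] that
  proof (induction R rule: finite_induct)
    case (insert i R)
    then obtain v where "\<forall>i\<in>R. v i \<in> W"
      "\<forall>i\<in>R. \<forall>j\<in>R. h (v i) (v j) = (if i = j then 1 else 0)"
      "vec.dim (v ` R) = card R" by auto
    then have v: "\<And>i. i \<in> R \<Longrightarrow> v i \<in> W"
      "\<And>i j. i \<in> R \<Longrightarrow> j \<in> R \<Longrightarrow> h (v i) (v j) = (if i = j then 1 else 0)"
      "vec.dim (v ` R) = card R" by auto
    have cardR: "card R < card S"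
      using insert S(2) by (intro psubset_card_mono) auto
    have "vec.span (v ` R) \<noteq> W"
    proof
      assume "vec.span (v ` R) = W"
      from arg_cong[OF this, of vec.dim] show False using cardR v(3) S(1) by simp
    qed
    moreover have span: "vec.span (v ` R) \<subseteq> W" using v(1) W by (intro vec.span_minimal) auto
    ultimately obtain x where x: "x \<in> W" "x \<notin> vec.span (v ` R)" by auto
    define y where "y = x - (\<Sum>j\<in>R. h x (v j) *s v j)"
    have sum_in: "(\<Sum>j\<in>R. h x (v j) *s v j) \<in> vec.span (v ` R)"
      by (intro vec.span_sum vec.span_scale vec.span_base) auto
    have yW: "y \<in> W" unfolding y_def using x(1) sum_in span W by (intro vec.subspace_diff) auto
    have y_notin: "y \<notin> vec.span (v ` R)"
    proof
      assume "y \<in> vec.span (v ` R)"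
      from vec.span_add[OF this sum_in] show False using x(2) by (simp add: y_def)
    qed
    then have "y \<noteq> 0" using vec.span_zero by metis
    then have pos: "0 < Re (h y y)" using yW by (intro herm_metricD[OF h])
    have hyy: "h y y = complex_of_real (Re (h y y))"
    proof -
      have "h y y = cnj (h y y)" using yW yW by (rule herm_metricD[OF h])
      then show ?thesis by (simp add: complex_eq_iff)
    qed
    have lin: "h (a *s p + b *s q) z = a * h p z + b * h q z" if "p \<in> W" "q \<in> W" "z \<in> W" for p q z a b
      using that by (intro herm_metricD[OF h])
    have sym: "h p q = cnj (h q p)" if "p \<in> W" "q \<in> W" for p q
      using that by (intro herm_metricD[OF h])
    have orth: "h y (v k) = 0" if k: "k \<in> R" for k
    proof -
      have "h (1 *s x + (- 1) *s (\<Sum>j\<in>R. h x (v j) *s v j)) (v k)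
        = 1 * h x (v k) + (- 1) * h (\<Sum>j\<in>R. h x (v j) *s v j) (v k)"
        using x(1) sum_in span v(1)[OF k] by (intro lin) auto
      also have "h (\<Sum>j\<in>R. h x (v j) *s v j) (v k) = (\<Sum>j\<in>R. h x (v j) * h (v j) (v k))"
        using herm_metric_sum_left[OF h W v(1)[OF k], of R v "\<lambda>j. h x (v j)"] v(1) by blast
      also have "\<dots> = (\<Sum>j\<in>R. if j = k then h x (v k) else 0)"
        by (rule sum.cong) (auto simp: v(2) k)
      also have "\<dots> = h x (v k)" using k insert.hyps(1) by simp
      finally show ?thesis by (simp add: y_def)
    qed
    define c where "c = complex_of_real (1 / sqrt (Re (h y y)))"
    define w where "w = c *s y"
    have c0: "c \<noteq> 0" using pos by (simp add: c_def)
    have wW: "w \<in> W" unfolding w_def using W yW by (rule vec.subspace_scale)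
    have hw: "h w z = c * h y z" if "z \<in> W" for z
      using lin[OF yW yW that, of c 0] by (simp add: w_def)
    have ww: "h w w = 1"
    proof -
      have "h w w = c * h y w" using wW by (rule hw)
      also have "h y w = cnj (h w y)" using yW wW by (rule sym)
      also have "h w y = c * h y y" using yW by (rule hw)
      also have "c * cnj (c * h y y) = complex_of_real (1 / sqrt (Re (h y y)) * (1 / sqrt (Re (h y y)) * Re (h y y)))"
        by (subst hyy) (simp only: c_def of_real_mult complex_cnj_mult complex_cnj_complex_of_real)
      also have "1 / sqrt (Re (h y y)) * (1 / sqrt (Re (h y y)) * Re (h y y)) = 1"
        using pos by (simp add: field_simps)
      finally show ?thesis by simp
    qed
    have w1: "h w (v k) = 0" if "k \<in> R" for k using hw[OF v(1)[OF that]] orth[OF that] by simp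
    have w2: "h (v k) w = 0" if "k \<in> R" for k using sym[OF v(1)[OF that] wW] w1[OF that] by simp
    have w_notin: "w \<notin> vec.span (v ` R)"
    proof
      assume "w \<in> vec.span (v ` R)"
      from vec.span_scale[OF this, of "inverse c"] show False
        using y_notin c0 by (simp add: w_def vector_smult_assoc)
    qed
    have img: "(v(i := w)) ` insert i R = insert w (v ` R)" using insert.hyps(2) by auto
    show ?case
    proof (intro exI[of _ "v(i := w)"] conjI ballI)
      show "vec.dim ((v(i := w)) ` insert i R) = card (insert i R)"
        unfolding img using w_notin v(3) insert.hyps by (simp add: vec.dim_insert)
    qed (use wW v(1) ww w1 w2 v(2) insert.hyps(2) in \<open>auto split: if_splits\<close>)
  qed simp
  from this[of S] obtain v where v: "\<forall>i\<in>S. v i \<in> W"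
    "\<forall>i\<in>S. \<forall>j\<in>S. h (v i) (v j) = (if i = j then 1 else 0)" "vec.dim (v ` S) = card S" by auto
  have "vec.span (v ` S) = W"
  proof (rule vec.subspace_dim_equal)
    show "vec.span (v ` S) \<subseteq> W" using v(1) W by (intro vec.span_minimal) auto
  qed (use W v(3) S in simp_all)
  with v show ?thesis by blast
qed

text \<open>
  Orthonormal bases of \<open>W\<close> and \<open>W'\<close> are the columns of an invertible matrix \<open>A\<close>.  Multiplying \<open>A\<close> by a
  complex number \<open>c\<close> with \<open>c\<^sup>n = 1 / det A\<close> gives determinant 1; the columns are then orthonormal for
  the metrics scaled by \<open>1 / \<bar>c\<bar>\<^sup>2\<close>, which belong to the same classes.
\<close>
lemma ex_adapted_SL:
  fixes W W' :: "(complex^'n::finite) set"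
  assumes h: "herm_metric W h" "herm_metric W' h'" and W: "vec.subspace W" "vec.subspace W'"
    and sum: "{x + y | x y. x \<in> W \<and> y \<in> W'} = UNIV"
    and S: "card S = vec.dim W" "card (- S) = vec.dim W'"
  obtains g where "g \<in> SL" "W = (*v) g ` coord S" "W' = (*v) g ` coord (- S)"
    "metric_class W h = metric_class W (frame_metric g)"
    "metric_class W' h' = metric_class W' (frame_metric g)"
proof -
  obtain v where v: "\<forall>i\<in>S. v i \<in> W" "\<forall>i\<in>S. \<forall>j\<in>S. h (v i) (v j) = (if i = j then 1 else 0)"
    "vec.span (v ` S) = W" using ex_orthonormal_family[OF h(1) W(1) S(1)] by auto
  obtain v' where v': "\<forall>i\<in>-S. v' i \<in> W'" "\<forall>i\<in>-S. \<forall>j\<in>-S. h' (v' i) (v' j) = (if i = j then 1 else 0)"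
    "vec.span (v' ` (-S)) = W'" using ex_orthonormal_family[OF h(2) W(2) S(2)] by auto
  define A :: "'n cmat" where "A = (\<chi> i j. if j \<in> S then v j $ i else v' j $ i)"
  have A: "A *v axis j 1 = (if j \<in> S then v j else v' j)" for j
    by (simp add: vec_eq_iff mult_axis_nth A_def)
  have AW: "(*v) A ` coord S = W" "(*v) A ` coord (- S) = W'"
  proof -
    have "(\<lambda>j. A *v axis j 1) ` S = v ` S" "(\<lambda>j. A *v axis j 1) ` (- S) = v' ` (- S)"
      by (rule image_cong; simp add: A)+
    then show "(*v) A ` coord S = W" "(*v) A ` coord (- S) = W'"
      using v(3) v'(3) by (simp_all only: image_coord_span)
  qed
  have "surj ((*v) A)"
    unfolding surj_def
  proof
    fix z
    obtain x y where "z = x + y" "x \<in> W" "y \<in> W'" using sum by blast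
    then show "\<exists>u. z = A *v u" using AW by (metis imageE matrix_vector_right_distrib)
  qed
  then have "\<exists>B. A ** B = mat 1" by (simp add: matrix_right_invertible_surjective)
  then have detA: "det A \<noteq> 0" using invertible_right_inverse invertible_det_nz by blast
  define N where "N = CARD('n)"
  have N: "0 < N" by (simp add: N_def)
  \<comment> \<open>An \<open>n\<close>-th root of \<open>1 / det A\<close>.\<close>
  define c where "c = exp (Ln (inverse (det A)) / of_nat N)"
  have cN: "c ^ N = inverse (det A)"
    using N detA by (simp add: c_def exp_of_nat_mult[symmetric])
  have c0: "c \<noteq> 0" by (simp add: c_def)
  define g where "g = A ** cdiag (\<lambda>_. c)"
  have gSL: "g \<in> SL" using detA by (simp add: g_def SL_def det_mul det_cdiag cN[unfolded N_def])
  have gA: "g *v x = c *s (A *v x)" for x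
  proof -
    have "cdiag (\<lambda>_. c) *v x = c *s x"
      unfolding cdiag_def by (simp add: vec_eq_iff matrix_vector_mult_def if_distrib if_distribR cong: if_cong)
    then show ?thesis by (simp add: g_def vector_scalar_commute flip: matrix_vector_mul_assoc)
  qed
  have scale_coord: "(\<lambda>x. c *s x) ` coord R = coord R" for R :: "'n set"
  proof
    show "coord R \<subseteq> (\<lambda>x. c *s x) ` coord R"
    proof
      fix x :: "complex^'n" assume "x \<in> coord R"
      then have "x = c *s (inverse c *s x)" "inverse c *s x \<in> coord R"
        using c0 by (auto simp: vector_smult_assoc coord_def)
      then show "x \<in> (\<lambda>x. c *s x) ` coord R" by (rule image_eqI)
    qed
  qed (auto simp: coord_def)
  have gimg: "(*v) g ` coord R = (*v) A ` coord R" for R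
  proof -
    have "(*v) g ` coord R = (*v) A ` (\<lambda>x. c *s x) ` coord R"
      by (simp add: image_image gA vector_scalar_commute)
    then show ?thesis by (simp only: scale_coord)
  qed
  have gW: "W = (*v) g ` coord S" "W' = (*v) g ` coord (- S)" using AW gimg by simp_all
  define \<alpha> where "\<alpha> = 1 / (cmod c)\<^sup>2"
  have \<alpha>: "0 < \<alpha>" using c0 by (simp add: \<alpha>_def)
  have class_eq: "metric_class V f = metric_class V (frame_metric g)"
    if f: "herm_metric V f" and V: "V = (*v) g ` coord R" "vec.subspace V"
      and on: "\<And>i j. i \<in> R \<Longrightarrow> j \<in> R \<Longrightarrow> f (A *v axis i 1) (A *v axis j 1) = (if i = j then 1 else 0)"
    for V f R
  proof -
    let ?k = "\<lambda>x y. complex_of_real \<alpha> * f x y"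
    have k: "herm_metric V ?k" using f \<alpha> by (rule herm_metric_scale)
    have inV: "A *v axis i 1 \<in> V" if "i \<in> R" for i
      using that by (simp add: V(1) gimg axis_in_coord)
    have "?k (g *v axis i 1) (g *v axis j 1) = (if i = j then 1 else 0)" if "i \<in> R" "j \<in> R" for i j
    proof -
      have l: "f (c *s x) z = c * f x z" if "x \<in> V" "z \<in> V" for x z
        using herm_metricD(1)[OF f that(1,1,2), of c 0] by simp
      have s: "f x y = cnj (f y x)" if "x \<in> V" "y \<in> V" for x y
        using that by (intro herm_metricD[OF f])
      have cV: "c *s (A *v axis j 1) \<in> V" using V(2) inV[OF that(2)] by (rule vec.subspace_scale)
      have "f (g *v axis i 1) (g *v axis j 1) = c * f (A *v axis i 1) (c *s (A *v axis j 1))"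
        unfolding gA using inV[OF that(1)] cV by (rule l)
      also have "f (A *v axis i 1) (c *s (A *v axis j 1)) = cnj (f (c *s (A *v axis j 1)) (A *v axis i 1))"
        using inV[OF that(1)] cV by (rule s)
      also have "f (c *s (A *v axis j 1)) (A *v axis i 1) = c * f (A *v axis j 1) (A *v axis i 1)"
        using inV[OF that(2)] inV[OF that(1)] by (rule l)
      also have "f (A *v axis j 1) (A *v axis i 1) = (if i = j then 1 else 0)" using on[OF that(2,1)] by auto
      finally have "f (g *v axis i 1) (g *v axis j 1) = (c * cnj c) * (if i = j then 1 else 0)" by simp
      also have "c * cnj c = complex_of_real ((cmod c)\<^sup>2)" by (rule complex_norm_square[symmetric])
      finally show ?thesis using c0 by (simp add: \<alpha>_def)
    qed
    then have "?k x y = frame_metric g x y" if "x \<in> V" "y \<in> V" for x y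
      by (intro herm_metric_eq_frame_metric[OF k gSL V(1) _ that]) auto
    then have "(f, frame_metric g) \<in> metric_equiv V"
      unfolding metric_equiv_def using f herm_metric_frame_metric[OF gSL] \<alpha> by force
    then show ?thesis using metric_class_eq_iff[OF f herm_metric_frame_metric[OF gSL]] by simp
  qed
  have "metric_class W h = metric_class W (frame_metric g)"
    by (rule class_eq[OF h(1) gW(1) W(1)]) (use v(2) in \<open>simp add: A\<close>)
  moreover have "metric_class W' h' = metric_class W' (frame_metric g)"
    by (rule class_eq[OF h(2) gW(2) W(2)]) (use v'(2) in \<open>simp add: A\<close>)
  ultimately show ?thesis using that gSL gW by blast
qed

section \<open>Comparison of adapted elements\<close>

lemma two_valued_intertwine:
  fixes k :: "'n::finite cmat"
  assumes "(*v) k ` coord T \<subseteq> coord S" "(*v) k ` coord (- T) \<subseteq> coord (- S)"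
  shows "k $ i $ j = 0 \<or> two_valued S a b $ i = two_valued T a b $ j"
proof -
  have 1: "k $ i $ j = 0" if "i \<notin> S" "j \<in> T"
    by (rule assms(1)[unfolded maps_coord_iff, rule_format]) (use that in auto)
  have 2: "k $ i $ j = 0" if "i \<in> S" "j \<notin> T"
    by (rule assms(2)[unfolded maps_coord_iff, rule_format]) (use that in auto)
  show ?thesis
    using 1 2 by (cases "i \<in> S"; cases "j \<in> T") (simp_all add: two_valued_def)
qed

text \<open>
  The matrix \<open>M = g\<^sup>-\<^sup>1 g'\<close> maps the blocks of \<open>T\<close> to those of \<open>S\<close>, and \<open>M\<^sup>*M\<close> is scalar on each block,
  say \<open>exp(2 diag \<xi>)\<close>.  Since \<open>det M = 1\<close>, the vector \<open>\<xi>\<close> has sum zero; such two-valued vectors form a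
  line, so \<open>\<xi>\<close> is \<open>s\<close> times the given one.  Then \<open>M exp(-diag \<xi>)\<close> is unitary and intertwines the two
  one-parameter groups.  Allowing \<open>S\<close> and \<open>T\<close> to differ saves the permutation matrix that would
  move the columns of an arbitrary connecting geodesic to the first \<open>r\<close> places.
\<close>
lemma line_shift_of_proportional:
  fixes g g' :: "'n::finite cmat"
  assumes g: "g \<in> SL" "g' \<in> SL"
    and W: "(*v) g ` coord S = (*v) g' ` coord T" "(*v) g ` coord (- S) = (*v) g' ` coord (- T)"
    and \<alpha>: "0 < \<alpha>" "\<And>x y. x \<in> (*v) g ` coord S \<Longrightarrow> y \<in> (*v) g ` coord S \<Longrightarrow>
        frame_metric g' x y = complex_of_real \<alpha> * frame_metric g x y"
    and \<beta>: "0 < \<beta>" "\<And>x y. x \<in> (*v) g ` coord (- S) \<Longrightarrow> y \<in> (*v) g ` coord (- S) \<Longrightarrow>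
        frame_metric g' x y = complex_of_real \<beta> * frame_metric g x y"
    and tr: "trace0 (two_valued T a b)" "a \<noteq> 0" "T \<noteq> UNIV"
  obtains s where "\<And>t. line g' (two_valued T a b) t = line g (two_valued S a b) (s + t)"
proof -
  define M where "M = matrix_inv g ** g'"
  have M: "M \<in> SL" using g by (simp add: M_def SL_mult SL_matrix_inv)
  have gM: "g ** M = g'" using g by (simp add: M_def matrix_inv_cancel_SL)
  have Mv: "M *v u = matrix_inv g *v (g' *v u)" for u by (simp add: M_def matrix_vector_mul_assoc)
  have maps: "(*v) M ` coord T \<subseteq> coord S" "(*v) M ` coord (- T) \<subseteq> coord (- S)"
    using W g by (auto simp: Mv in_SL_image_iff[symmetric])
  have scal: "cinner (M *v u) (M *v v) = complex_of_real (inverse c) * cinner u v"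
    if c: "0 < c" and f: "\<And>x y. x \<in> (*v) g' ` coord R \<Longrightarrow> y \<in> (*v) g' ` coord R \<Longrightarrow>
        frame_metric g' x y = complex_of_real c * frame_metric g x y"
      and uv: "u \<in> coord R" "v \<in> coord R" for c R u v
  proof -
    have "cinner u v = frame_metric g' (g' *v u) (g' *v v)"
      using g by (simp add: frame_metric_def matrix_vector_mul_assoc matrix_inv_mult_SL)
    also have "\<dots> = complex_of_real c * frame_metric g (g' *v u) (g' *v v)"
      using uv by (intro f) auto
    also have "\<dots> = complex_of_real c * cinner (M *v u) (M *v v)" by (simp add: frame_metric_def Mv)
    finally show ?thesis using c by simp
  qed
  \<comment> \<open>Chosen so that \<open>exp(2 diag \<xi>)\<close> has the entries \<open>1/\<alpha>\<close> and \<open>1/\<beta>\<close>.\<close>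
  define x where "x = - ln \<alpha> / 2" define y where "y = - ln \<beta> / 2"
  define \<xi> where "\<xi> = two_valued T x y"
  have exp: "exp (2 * x) = inverse \<alpha>" "exp (2 * y) = inverse \<beta>"
    using \<alpha>(1) \<beta>(1) by (simp_all add: x_def y_def exp_minus)
  have MM: "ctranspose M ** M = dexp (\<xi> + \<xi>)"
  proof -
    have "(ctranspose M ** M) $ i $ j = dexp (\<xi> + \<xi>) $ i $ j" for i j
    proof -
      have "(ctranspose M ** M) $ i $ j = cinner (M *v axis j 1) (M *v axis i 1)"
        by (rule ctranspose_mult_nth)
      also have "\<dots> = dexp (\<xi> + \<xi>) $ i $ j"
      proof -
        consider "i \<in> T" "j \<in> T" | "i \<in> -T" "j \<in> -T" | "i \<in> T" "j \<in> -T" | "i \<in> -T" "j \<in> T" by blast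
        then show ?thesis
        proof cases
          case 1
          have "cinner (M *v axis j 1) (M *v axis i 1) = complex_of_real (inverse \<alpha>) * cinner (axis j 1) (axis i 1)"
            by (rule scal[OF \<alpha>(1), of T]) (use \<alpha>(2) W 1 in \<open>auto simp: axis_in_coord\<close>)
          then show ?thesis using 1 exp(1) by (auto simp: cinner_axis dexp_def \<xi>_def two_valued_def)
        next
          case 2
          have "cinner (M *v axis j 1) (M *v axis i 1) = complex_of_real (inverse \<beta>) * cinner (axis j 1) (axis i 1)"
            by (rule scal[OF \<beta>(1), of "- T"]) (use \<beta>(2) W 2 in \<open>auto simp: axis_in_coord\<close>)
          then show ?thesis using 2 exp(2) by (auto simp: cinner_axis dexp_def \<xi>_def two_valued_def)
        next
          case 3
          then have "M *v axis i 1 \<in> coord S" "M *v axis j 1 \<in> coord (- S)"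
            using maps axis_in_coord[of i T] axis_in_coord[of j "- T"] by auto
          then have "cinner (M *v axis j 1) (M *v axis i 1) = 0"
            unfolding cinner_def coord_def by (intro sum.neutral) auto
          then show ?thesis using 3 by (auto simp: dexp_def)
        next
          case 4
          then have "M *v axis j 1 \<in> coord S" "M *v axis i 1 \<in> coord (- S)"
            using maps axis_in_coord[of j T] axis_in_coord[of i "- T"] by auto
          then have "cinner (M *v axis j 1) (M *v axis i 1) = 0"
            unfolding cinner_def coord_def by (intro sum.neutral) auto
          then show ?thesis using 4 by (auto simp: dexp_def)
        qed
      qed
      finally show ?thesis .
    qed
    then show ?thesis by (simp add: vec_eq_iff)
  qed
  have "det (ctranspose M ** M) = 1" using M by (simp add: det_mul det_ctranspose SL_def)
  then have tr\<xi>: "trace0 \<xi>"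
    unfolding MM by (intro det_dexp_eq_1[THEN trace0_double[THEN iffD1]])
  define s where "s = x / a"
  have "y = s * b"
  proof -
    have pos: "0 < real (card (- T))" using card_Compl_nonzero(2)[OF tr(3)] by simp
    have yb: "real (card (- T)) * y = - (real (card T) * x)"
      "real (card (- T)) * b = - (real (card T) * a)"
      using tr\<xi> tr(1) by (simp_all add: \<xi>_def trace0_two_valued)
    have "real (card (- T)) * (s * b) = s * (real (card (- T)) * b)" by simp
    also have "\<dots> = - (real (card T) * x)" unfolding yb(2) using tr(2) by (simp add: s_def)
    finally have "real (card (- T)) * y = real (card (- T)) * (s * b)" using yb(1) by (simp only:)
    then show ?thesis using pos by (metis less_irrefl mult_cancel_left)
  qed
  then have \<xi>s: "\<xi> = s *\<^sub>R two_valued T a b"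
    using tr(2) by (simp add: \<xi>_def vec_eq_iff two_valued_def s_def)
  define k where "k = M ** dexp (- \<xi>)"
  have kM: "k ** dexp \<xi> = M"
    by (simp add: k_def dexp_minus flip: matrix_mul_assoc)
  have "ctranspose k ** k = dexp (- \<xi>) ** (ctranspose M ** M) ** dexp (- \<xi>)"
    by (simp add: k_def ctranspose_mult matrix_mul_assoc)
  also have "\<dots> = mat 1" unfolding MM dexp_add[symmetric] by simp
  finally have "k ** ctranspose k = mat 1" by (simp add: matrix_left_right_inverse)
  moreover have "k \<in> SL"
    unfolding k_def by (intro SL_mult dexp_SL trace0_minus M tr\<xi>)
  ultimately have k: "k \<in> SU" by (simp add: SU_def)
  have k_entry: "k $ i $ j = M $ i $ j * complex_of_real (exp ((- \<xi>) $ j))" for i j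
    unfolding k_def by (rule dexp_mult_nth)
  have "k $ i $ j = 0 \<or> two_valued S a b $ i = two_valued T a b $ j" for i j
    using two_valued_intertwine[OF maps, of i j a b] k_entry[of i j] by auto
  note comm = intertwine[OF this]
  have "line g' (two_valued T a b) t = line g (two_valued S a b) (s + t)" for t
  proof -
    have "g' ** dexp (t *\<^sub>R two_valued T a b) = g ** (k ** (dexp (s *\<^sub>R two_valued T a b) ** dexp (t *\<^sub>R two_valued T a b)))"
      unfolding gM[symmetric] kM[symmetric] \<xi>s by (simp add: matrix_mul_assoc)
    also have "\<dots> = g ** dexp ((s + t) *\<^sub>R two_valued S a b) ** k"
      unfolding dexp_scaleR_add[symmetric] comm by (simp add: matrix_mul_assoc)
    finally show ?thesis by (simp add: line_def act_mult_SU[OF k])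
  qed
  with that show ?thesis by blast
qed

text \<open>
  At time \<open>0\<close> the lines show that \<open>k = exp(-d diag \<zeta>) g\<^sup>-\<^sup>1 g'\<close> is unitary.  It preserves both coordinate
  subspaces because \<open>g\<close> and \<open>g'\<close> have the same images of them, and on each of these
  \<open>exp(d diag \<zeta>)\<close> is a scalar.  So the two metrics differ by the square of that scalar.
\<close>
lemma proportional_of_line_shift:
  fixes g g' :: "'n::finite cmat"
  assumes g: "g \<in> SL" "g' \<in> SL"
    and W: "(*v) g ` coord S = (*v) g' ` coord S" "(*v) g ` coord (- S) = (*v) g' ` coord (- S)"
    and tr: "trace0 (two_valued S a b)"
    and eq: "\<And>t. line g' (two_valued S a b) t = line g (two_valued S a b) (c * t + d)"
  shows "\<exists>\<alpha>>0. \<forall>x\<in>(*v) g ` coord S. \<forall>y\<in>(*v) g ` coord S.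
           frame_metric g' x y = complex_of_real \<alpha> * frame_metric g x y"
    and "\<exists>\<alpha>>0. \<forall>x\<in>(*v) g ` coord (- S). \<forall>y\<in>(*v) g ` coord (- S).
           frame_metric g' x y = complex_of_real \<alpha> * frame_metric g x y"
proof -
  let ?\<zeta> = "two_valued S a b"
  define D where "D = dexp (d *\<^sub>R ?\<zeta>)"
  have D: "D \<in> SL" unfolding D_def using tr(1) by (rule dexp_scaleR_SL)
  define k where "k = matrix_inv (g ** D) ** g'"
  have gD: "g ** D \<in> SL" using g D by (simp add: SL_mult)
  have line_eq: "line (g ** D) (c *\<^sub>R ?\<zeta>) t = line g' ?\<zeta> t" for t
    unfolding D_def line_scale line_shift eq by (simp add: add.commute)
  have k_lem: "k \<in> SU" "k $ i $ j = 0 \<or> (c *\<^sub>R ?\<zeta>) $ i = ?\<zeta> $ j" for i j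
    using line_eq_entries[OF gD trace0_scaleR[OF tr(1)] g(2) tr(1) zero_neq_one line_eq line_eq]
    by (simp_all add: k_def)
  have Dv: "(D *v x) $ i = complex_of_real (exp (d * ?\<zeta> $ i)) * x $ i" for x i
    by (simp add: D_def dexp_mult_vector_nth)
  have scaleD: "D *v x = complex_of_real (exp (d * w)) *s x" if "x \<in> coord R" "\<And>i. i \<in> R \<Longrightarrow> ?\<zeta> $ i = w" for x R w
    using that Dv by (auto simp: vec_eq_iff coord_def)
  have g'v: "matrix_inv g *v x = D *v (k *v (matrix_inv g' *v x))" for x
  proof -
    have "D ** k ** matrix_inv g' = D ** matrix_inv D ** matrix_inv g ** (g' ** matrix_inv g')"
      using g D by (simp add: k_def matrix_inv_mult matrix_mul_assoc)
    also have "\<dots> = matrix_inv g" using g D by (simp add: matrix_inv_mult_SL)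
    finally show ?thesis by (simp only: matrix_vector_mul_assoc matrix_mul_assoc)
  qed
  have invD: "x \<in> coord R" if "D *v x \<in> coord R" for x R
    using that by (auto simp: coord_def Dv)
  have scaling: "\<exists>\<alpha>>0. \<forall>x\<in>(*v) g ` coord R. \<forall>y\<in>(*v) g ` coord R.
           frame_metric g' x y = complex_of_real \<alpha> * frame_metric g x y"
    if R: "(*v) g ` coord R = (*v) g' ` coord R" and w: "\<And>i. i \<in> R \<Longrightarrow> ?\<zeta> $ i = w" for R w
  proof (intro exI[of _ "inverse ((exp (d * w))\<^sup>2)"] conjI ballI)
    fix x y assume xy: "x \<in> (*v) g ` coord R" "y \<in> (*v) g ` coord R"
    let ?u = "k *v (matrix_inv g' *v x)" let ?v = "k *v (matrix_inv g' *v y)"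
    have "D *v ?u \<in> coord R" "D *v ?v \<in> coord R"
      unfolding g'v[symmetric] using xy g by (simp_all add: in_SL_image_iff)
    then have uv: "?u \<in> coord R" "?v \<in> coord R" using invD by blast+
    have "frame_metric g x y = cinner (D *v ?u) (D *v ?v)" unfolding frame_metric_def g'v ..
    also have "\<dots> = complex_of_real ((exp (d * w))\<^sup>2) * cinner ?u ?v"
    proof -
      have "D *v ?u = complex_of_real (exp (d * w)) *s ?u" using uv(1) w by (rule scaleD)
      moreover have "D *v ?v = complex_of_real (exp (d * w)) *s ?v" using uv(2) w by (rule scaleD)
      ultimately show ?thesis
        by (simp only: cinner_scale_left cinner_scale_right) (simp add: power2_eq_square)
    qed
    also have "cinner ?u ?v = frame_metric g' x y"
      unfolding frame_metric_def by (rule cinner_unitary[OF SU_ctranspose_mult[OF k_lem(1)]])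
    finally show "frame_metric g' x y = complex_of_real (inverse ((exp (d * w))\<^sup>2)) * frame_metric g x y"
      by simp
  qed simp
  show "\<exists>\<alpha>>0. \<forall>x\<in>(*v) g ` coord S. \<forall>y\<in>(*v) g ` coord S.
           frame_metric g' x y = complex_of_real \<alpha> * frame_metric g x y"
    by (rule scaling[OF W(1), of a]) (simp add: two_valued_def)
  show "\<exists>\<alpha>>0. \<forall>x\<in>(*v) g ` coord (- S). \<forall>y\<in>(*v) g ` coord (- S).
           frame_metric g' x y = complex_of_real \<alpha> * frame_metric g x y"
    by (rule scaling[OF W(2), of b]) (simp add: two_valued_def)
qed

section \<open>Connecting geodesics\<close>

lemma mexp_block_diag:
  "mexp (t *\<^sub>R block_diag r \<rho> \<sigma>) = dexp (t *\<^sub>R two_valued {i. pos i < r} \<rho> \<sigma>)"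
proof -
  define d where "d i = t * two_valued {i. pos i < r} \<rho> \<sigma> $ i" for i :: 'a
  have A: "t *\<^sub>R block_diag r \<rho> \<sigma> = (cdiag (\<lambda>i. complex_of_real (d i)) :: 'a cmat)"
    by (auto simp: vec_eq_iff block_diag_def cdiag_def d_def two_valued_def scaleR_conv_of_real[where 'a=complex])
  have "mpow (cdiag (\<lambda>i. complex_of_real (d i))) k = cdiag (\<lambda>i. complex_of_real (d i ^ k))" for k
    unfolding mpow_def
    by (induction k) (simp_all add: vec_eq_iff cdiag_mult_nth, simp_all add: cdiag_def mat_def)
  then have pow: "mpow (cdiag (\<lambda>i. complex_of_real (d i))) k /\<^sub>R fact k
      = (\<Sum>i\<in>UNIV. (d i ^ k /\<^sub>R fact k) *\<^sub>R diag_unit i)" for k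
    by (simp add: sum_diag_unit cdiag_def vec_eq_iff scaleR_conv_of_real[where 'a=complex] cong: if_cong)
  have "(\<lambda>k. \<Sum>i\<in>UNIV. (d i ^ k /\<^sub>R fact k) *\<^sub>R diag_unit i) sums (\<Sum>i\<in>UNIV. exp (d i) *\<^sub>R (diag_unit i :: 'a cmat))"
    by (intro sums_sum bounded_linear.sums[OF bounded_linear_scaleR_left] exp_converges)
  then have "mexp (t *\<^sub>R block_diag r \<rho> \<sigma>) = (\<Sum>i\<in>UNIV. exp (d i) *\<^sub>R (diag_unit i :: 'a cmat))"
    unfolding mexp_def A pow by (rule sums_unique[symmetric])
  then show ?thesis by (simp add: sum_diag_unit dexp_def d_def cong: if_cong)
qed

lemma card_pos_less:
  assumes "r \<le> CARD('n::{finite,linorder})" shows "card {i::'n. pos i < r} = r"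
proof -
  have mono: "pos i < pos j" if "i < j" for i j :: 'n
    unfolding pos_def by (rule psubset_card_mono) (use that in auto)
  then have inj: "inj (pos :: 'n \<Rightarrow> nat)" by (metis injI less_irrefl linorder_cases)
  have "pos i < CARD('n)" for i :: 'n
    unfolding pos_def by (rule psubset_card_mono) auto
  then have "range (pos :: 'n \<Rightarrow> nat) = {..<CARD('n)}"
    using card_image[OF inj] by (intro card_subset_eq) auto
  then have "\<exists>i::'n. pos i = m" if "m < r" for m using that assms by (metis lessThan_iff order_less_le_trans rangeE)
  then have "pos ` {i::'n. pos i < r} = {..<r}" by fastforce
  then show ?thesis using card_image[OF inj_on_subset[OF inj subset_UNIV], of "{i. pos i < r}"] by simp
qed

lemma connects_line:
  fixes g :: "'n::finite cmat"
  assumes g: "g \<in> SL" "trace0 (two_valued S a b)" "knorm (two_valued S a b) = 1" "b < a"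
    and S: "S \<noteq> {}" "S \<noteq> UNIV"
    and W: "W = (*v) g ` coord S" "W' = (*v) g ` coord (- S)"
  shows "z_of W = endpoint (line g (two_valued S a b))"
    and "z_of W' = endpoint (line g (- two_valued S a b))"
    and "connects W W' (line g (two_valued S a b))"
proof -
  let ?\<zeta> = "two_valued S a b"
  show z: "z_of W = endpoint (line g ?\<zeta>)"
    unfolding W using g S by (intro z_of_image_coord)
  have tr: "trace0 (two_valued (- S) (- b) (- a))" "knorm (two_valued (- S) (- b) (- a)) = 1"
    using trace0_minus[OF g(2)] knorm_minus[of ?\<zeta>] g(3) by (simp_all flip: two_valued_uminus)
  show z': "z_of W' = endpoint (line g (- ?\<zeta>))"
    unfolding W two_valued_uminus using g S by (intro z_of_image_coord tr) auto
  have "(\<lambda>t. line g ?\<zeta> (- t / 1)) = line g (- ?\<zeta>)" by (simp add: line_def fun_eq_iff)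
  then show "connects W W' (line g ?\<zeta>)"
    unfolding connects_def using line_geodesic_on[OF g(1,2), of UNIV] g(3) z z'
    by (intro exI[of _ 1]) (simp add: Let_def)
qed

lemma geodesic_line: "g \<in> SL \<Longrightarrow> trace0 \<xi> \<Longrightarrow> knorm \<xi> = 1 \<Longrightarrow> geodesic (line g \<xi>)"
  using line_geodesic_on[of g \<xi> UNIV] by (auto simp: geodesic_def intro!: exI[of _ 1])

lemma reparam_equiv: "equiv (Collect (geodesic :: (real \<Rightarrow> 'n::finite point) \<Rightarrow> bool)) reparam"
proof (rule equivI)
  show "reparam \<subseteq> Collect geodesic \<times> Collect (geodesic :: (real \<Rightarrow> 'n point) \<Rightarrow> bool)"
    by (auto simp: reparam_def)
  show "refl_on (Collect geodesic) (reparam :: ((real \<Rightarrow> 'n point) \<times> _) set)"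
  proof (rule refl_onI)
    fix \<gamma> :: "real \<Rightarrow> 'n point" assume "\<gamma> \<in> Collect geodesic"
    moreover have "\<gamma> = (\<lambda>t. \<gamma> (1 * t + 0))" by simp
    then have "\<exists>a b. a \<noteq> 0 \<and> \<gamma> = (\<lambda>t. \<gamma> (a * t + b))" using zero_neq_one[where 'a=real] by metis
    ultimately show "(\<gamma>, \<gamma>) \<in> reparam" by (simp add: reparam_def)
  qed
  show "sym (reparam :: ((real \<Rightarrow> 'n point) \<times> _) set)"
  proof (rule symI)
    fix \<gamma> \<delta> :: "real \<Rightarrow> 'n point" assume "(\<gamma>, \<delta>) \<in> reparam"
    then obtain a b where ab: "geodesic \<gamma>" "geodesic \<delta>" "a \<noteq> 0" "\<delta> = (\<lambda>t. \<gamma> (a * t + b))"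
      by (auto simp: reparam_def)
    then have "\<gamma> = (\<lambda>t. \<delta> (inverse a * t + - b / a))" by (simp add: field_simps)
    moreover have "inverse a \<noteq> 0" using ab by simp
    ultimately show "(\<delta>, \<gamma>) \<in> reparam" unfolding reparam_def using ab(1,2) by blast
  qed
  show "trans (reparam :: ((real \<Rightarrow> 'n point) \<times> _) set)"
  proof (rule transI)
    fix \<gamma> \<delta> \<epsilon> :: "real \<Rightarrow> 'n point" assume "(\<gamma>, \<delta>) \<in> reparam" "(\<delta>, \<epsilon>) \<in> reparam"
    then obtain a b c d where ab: "geodesic \<gamma>" "geodesic \<epsilon>" "a \<noteq> 0" "\<delta> = (\<lambda>t. \<gamma> (a * t + b))"
      "c \<noteq> 0" "\<epsilon> = (\<lambda>t. \<delta> (c * t + d))"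
      unfolding reparam_def by blast
    then have "\<epsilon> = (\<lambda>t. \<gamma> ((a * c) * t + (a * d + b)))" by (simp add: algebra_simps)
    moreover have "a * c \<noteq> 0" using ab by simp
    ultimately show "(\<gamma>, \<epsilon>) \<in> reparam" unfolding reparam_def using ab(1,2) by blast
  qed
qed

lemma reparam_lines:
  assumes "g \<in> SL" "trace0 \<xi>" "knorm \<xi> = 1" "geodesic \<gamma>" "a \<noteq> 0" "\<And>t. line g \<xi> t = \<gamma> (a * t + b)"
  shows "reparam `` {\<gamma>} = reparam `` {line g \<xi>}"
proof (rule equiv_class_eq[OF reparam_equiv])
  show "(\<gamma>, line g \<xi>) \<in> reparam"
    unfolding reparam_def using assms geodesic_line by blast
qed

text \<open>
  Each end determines the two-valued shape of \<open>\<eta>\<close> and the subspace where the larger value, respectively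
  the smaller one, is taken; the two index sets are complementary because they are read off from the
  same \<open>\<eta>\<close>.
\<close>
lemma line_of_endpoints:
  fixes g h :: "'n::finite cmat"
  assumes g: "g \<in> SL" "trace0 (two_valued S a b)" "knorm (two_valued S a b) = 1" "b < a"
    and S: "S \<noteq> {}" "S \<noteq> UNIV"
    and W: "W = (*v) g ` coord S" "W' = (*v) g ` coord (- S)"
    and h: "h \<in> SL" "trace0 \<eta>" "knorm \<eta> = 1"
    and ends: "endpoint (line h \<eta>) = z_of W" "endpoint (line h (- \<eta>)) = z_of W'"
  obtains T where "\<eta> = two_valued T a b" "T \<noteq> UNIV" "W = (*v) h ` coord T" "W' = (*v) h ` coord (- T)"
proof -
  have g': "trace0 (two_valued (- S) (- b) (- a))" "knorm (two_valued (- S) (- b) (- a)) = 1"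
    using trace0_minus[OF g(2)] knorm_minus[of "two_valued S a b"] g(3)
    by (simp_all flip: two_valued_uminus)
  have h': "trace0 (- \<eta>)" "knorm (- \<eta>) = 1" using trace0_minus[OF h(2)] h(3) by simp_all
  have S': "- S \<noteq> {}" "- S \<noteq> UNIV" "- a < - b" using S g(4) by auto
  note z = connects_line(1,2)[OF g S W]
  have stab: "stab_inf (endpoint (line h \<eta>)) = stab_space ((*v) g ` coord S)"
    unfolding ends z by (rule stab_inf_two_valued[OF g])
  obtain T where T: "\<eta> = two_valued T a b" "card T = card S" "(*v) h ` coord T = (*v) g ` coord S"
    by (rule endpoint_stab_eq_structure[OF g S h stab])
  have stab': "stab_inf (endpoint (line h (- \<eta>))) = stab_space ((*v) g ` coord (- S))"
    unfolding ends z two_valued_uminus by (rule stab_inf_two_valued[OF g(1) g' S'(3)])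
  obtain T' where T': "- \<eta> = two_valued T' (- b) (- a)" "(*v) h ` coord T' = (*v) g ` coord (- S)"
    by (rule endpoint_stab_eq_structure[OF g(1) g' S'(3,1,2) h(1) h' stab'])
  have "T' = - T"
  proof -
    have "i \<in> T' \<longleftrightarrow> i \<notin> T" for i
    proof -
      have "- \<eta> $ i = (if i \<in> T' then - b else - a)"
        using arg_cong[OF T'(1), of "\<lambda>v. v $ i"] by (simp add: two_valued_def)
      moreover have "\<eta> $ i = (if i \<in> T then a else b)" by (simp add: T(1) two_valued_def)
      ultimately show ?thesis using g(4) by (auto split: if_splits)
    qed
    then show ?thesis by blast
  qed
  moreover have "T \<noteq> UNIV"
  proof
    assume "T = UNIV"
    then have "card (- S) = 0" using T(2) card_Compl_nonzero(2)[OF S(2)] by (simp add: card_Compl_UNIV)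
    then show False using card_Compl_nonzero(2)[OF S(2)] by simp
  qed
  ultimately show ?thesis using that T T' W by simp
qed

theorem proposition4p9:
  fixes W W' :: "'n::{finite,linorder} cvec set"
    and r n :: nat and \<rho> \<sigma> :: real
    and geo :: "'n cmat \<Rightarrow> real \<Rightarrow> 'n point"
  assumes "n = CARD('n)" and "n \<ge> 2"
    and "vec.subspace W" and "W \<noteq> {0}" and "W \<noteq> UNIV"
    and "vec.subspace W'" and "W' \<noteq> {0}" and "W' \<noteq> UNIV"
    and "W \<inter> W' = {0}" and "{x + y | x y. x \<in> W \<and> y \<in> W'} = UNIV"
    and "r = vec.dim W"
    and "\<rho> = sqrt ((real n - real r) / (4 * real r * (real n)\<^sup>2))"
    and "\<sigma> = - (real r / (real n - real r)) * \<rho>"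
    and "geo = (\<lambda>g t. act (g ** mexp (t *\<^sub>R block_diag r \<rho> \<sigma>)) base)"
  shows "(\<forall>h h' g. herm_metric W h \<and> herm_metric W' h' \<and>
            adapted W W' r (metric_class W h) (metric_class W' h') g \<longrightarrow>
            connects W W' (geo g)) \<and>
         (\<exists>F. (\<forall>H\<in>metric_classes W. \<forall>H'\<in>metric_classes W'.
                 (\<exists>g. adapted W W' r H H' g) \<and>
                 (\<forall>g. adapted W W' r H H' g \<longrightarrow> F (H, H') = reparam `` {geo g})) \<and>
              bij_betw F (metric_classes W \<times> metric_classes W') (connecting_classes W W'))"
proof -
  note n = assms(1) and W = assms(3) and W' = assms(6) and sum = assms(10) and r = assms(11)
  define S :: "'n set" where "S = {i. pos i < r}"
  define \<zeta> where "\<zeta> = two_valued S \<rho> \<sigma>"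
  have "vec.dim W + vec.dim W' = n"
    using vec.dim_sums_Int[OF W W'] unfolding sum assms(9) n by (simp add: vec_dim_card del: vec.dim_UNIV)
  moreover have "0 < vec.dim V" if "V \<noteq> {0}" "vec.subspace V" for V :: "'n cvec set"
    using that vec.subspace_0[OF that(2)] by (intro gr0I) (simp only: vec.dim_eq_0, blast)
  then have "0 < vec.dim W" "0 < vec.dim W'" using assms(3,4,6,7) by auto
  ultimately have r': "0 < r" "r < n" "vec.dim W' = n - r" unfolding r by auto
  have cardS: "card S = r" unfolding S_def using r' n by (intro card_pos_less) simp
  then have cardS': "card (- S) = n - r" using n by (simp add: card_Compl_UNIV)
  have S: "S \<noteq> {}" "S \<noteq> UNIV" using cardS cardS' r' n by auto
  have Scompl: "{i. r \<le> pos i} = - S" by (auto simp: S_def)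
  have \<rho>: "0 < \<rho>" using r' by (simp add: assms(12))
  have nr: "0 < real n - real r" using r' by simp
  have "\<sigma> < 0" using \<rho> nr r' by (simp add: assms(13))
  then have \<sigma>\<rho>: "\<sigma> < \<rho>" using \<rho> by simp
  have tr: "trace0 \<zeta>"
    using nr r' by (simp add: \<zeta>_def trace0_two_valued cardS cardS' assms(13) of_nat_diff)
  have kn: "knorm \<zeta> = 1"
  proof -
    define x where "x = real r" define N where "N = real n" define m where "m = N - x"
    have pos: "0 < x" "0 < m" "0 < N" and N: "N = x + m" using r' by (auto simp: x_def N_def m_def)
    have \<rho>2: "\<rho>\<^sup>2 = m / (4 * x * N\<^sup>2)"
      unfolding assms(12) using pos by (simp add: x_def N_def m_def)
    have "(norm \<zeta>)\<^sup>2 = x * \<rho>\<^sup>2 + m * \<sigma>\<^sup>2"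
      using r' by (simp add: \<zeta>_def norm_two_valued cardS cardS' x_def N_def m_def of_nat_diff)
    also have "\<sigma>\<^sup>2 = (x / m)\<^sup>2 * \<rho>\<^sup>2"
      by (simp add: assms(13) x_def N_def m_def power_mult_distrib power_divide)
    also have "x * \<rho>\<^sup>2 + m * ((x / m)\<^sup>2 * \<rho>\<^sup>2) = \<rho>\<^sup>2 * (x * N / m)"
      unfolding N using pos by (simp add: power_divide field_simps power2_eq_square)
    also have "\<dots> = 1 / (4 * N)"
      unfolding \<rho>2 using pos(1,2,3) by (simp add: power2_eq_square)
    finally have "4 * N * (norm \<zeta>)\<^sup>2 = 1" using pos by simp
    then have "(knorm \<zeta>)\<^sup>2 = 1" using n by (simp add: knorm_def power_mult_distrib N_def)
    then show ?thesis using knorm_nonneg[of \<zeta>] by (simp add: power2_eq_1_iff)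
  qed
  note \<zeta> = tr[unfolded \<zeta>_def] kn[unfolded \<zeta>_def] \<sigma>\<rho>
  have geo: "geo g = line g \<zeta>" for g
    by (simp add: assms(14) mexp_block_diag line_def fun_eq_iff \<zeta>_def S_def)
  have adapted_iff: "adapted W W' r H H' g \<longleftrightarrow> g \<in> SL \<and> W = (*v) g ` coord S \<and> W' = (*v) g ` coord (- S)
      \<and> H = metric_class W (frame_metric g) \<and> H' = metric_class W' (frame_metric g)"
    if "H \<in> metric_classes W" "H' \<in> metric_classes W'" for H H' g
    using ex_orthonormal_basis_class_iff[OF _ that(1), of g S] ex_orthonormal_basis_class_iff[OF _ that(2), of g "- S"]
    unfolding adapted_def Scompl S_def[symmetric] by blast
  have conn: "connects W W' (geo g)" if "adapted W W' r H H' g" "H \<in> metric_classes W" "H' \<in> metric_classes W'" for H H' g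
    using that unfolding geo \<zeta>_def adapted_iff[OF that(2,3)] using connects_line(3)[OF _ \<zeta> S] by blast
  have ex: "\<exists>g. adapted W W' r H H' g" if H: "H \<in> metric_classes W" "H' \<in> metric_classes W'" for H H'
  proof -
    obtain h h' where h: "herm_metric W h" "H = metric_class W h" "herm_metric W' h'" "H' = metric_class W' h'"
      using H by (auto simp: metric_classes_eq)
    obtain g where "g \<in> SL" "W = (*v) g ` coord S" "W' = (*v) g ` coord (- S)"
      "metric_class W h = metric_class W (frame_metric g)"
      "metric_class W' h' = metric_class W' (frame_metric g)"
      by (rule ex_adapted_SL[OF h(1,3) W W' sum, of S]) (use cardS cardS' r r' in auto)
    then show ?thesis using adapted_iff[OF H] h by blast
  qed
  have prop_of_class: "\<exists>\<alpha>>0. \<forall>x\<in>V. \<forall>y\<in>V. frame_metric g' x y = complex_of_real \<alpha> * frame_metric g x y"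
    if "g \<in> SL" "g' \<in> SL" "metric_class V (frame_metric g) = metric_class V (frame_metric g')" for g g' :: "'n cmat" and V
    using that(3) metric_class_eq_iff[OF herm_metric_frame_metric[OF that(1)] herm_metric_frame_metric[OF that(2)], of V]
    by (auto simp: metric_equiv_def)
  have class_of_prop: "metric_class V (frame_metric g) = metric_class V (frame_metric g')"
    if "g \<in> SL" "g' \<in> SL" "\<exists>\<alpha>>0. \<forall>x\<in>V. \<forall>y\<in>V. frame_metric g' x y = complex_of_real \<alpha> * frame_metric g x y"
    for g g' :: "'n cmat" and V
    using that(3) metric_class_eq_iff[OF herm_metric_frame_metric[OF that(1)] herm_metric_frame_metric[OF that(2)], of V]
      herm_metric_frame_metric[OF that(1), of V] herm_metric_frame_metric[OF that(2), of V]
    by (simp add: metric_equiv_def)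
  have shift: "\<exists>s. \<forall>t. line g' \<zeta> t = line g (two_valued T \<rho> \<sigma>) (s + t)"
    if g: "g \<in> SL" "W = (*v) g ` coord T" "W' = (*v) g ` coord (- T)"
      and g': "g' \<in> SL" "W = (*v) g' ` coord S" "W' = (*v) g' ` coord (- S)"
      and cl: "metric_class W (frame_metric g) = metric_class W (frame_metric g')"
        "metric_class W' (frame_metric g) = metric_class W' (frame_metric g')" for g g' T
  proof -
    obtain \<alpha> where \<alpha>: "0 < \<alpha>" "\<And>x y. x \<in> W \<Longrightarrow> y \<in> W \<Longrightarrow> frame_metric g' x y = complex_of_real \<alpha> * frame_metric g x y"
      using prop_of_class[OF g(1) g'(1) cl(1)] by blast
    obtain \<beta> where \<beta>: "0 < \<beta>" "\<And>x y. x \<in> W' \<Longrightarrow> y \<in> W' \<Longrightarrow> frame_metric g' x y = complex_of_real \<beta> * frame_metric g x y"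
      using prop_of_class[OF g(1) g'(1) cl(2)] by blast
    obtain s where "\<And>t. line g' (two_valued S \<rho> \<sigma>) t = line g (two_valued T \<rho> \<sigma>) (s + t)"
    proof (rule line_shift_of_proportional[OF g(1) g'(1)])
      show "(*v) g ` coord T = (*v) g' ` coord S" "(*v) g ` coord (- T) = (*v) g' ` coord (- S)"
        using g g' by simp_all
      show "0 < \<alpha>" "0 < \<beta>" by fact+
      show "frame_metric g' x y = complex_of_real \<alpha> * frame_metric g x y"
        if "x \<in> (*v) g ` coord T" "y \<in> (*v) g ` coord T" for x y
        using that unfolding g(2)[symmetric] by (rule \<alpha>(2))
      show "frame_metric g' x y = complex_of_real \<beta> * frame_metric g x y"
        if "x \<in> (*v) g ` coord (- T)" "y \<in> (*v) g ` coord (- T)" for x y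
        using that unfolding g(3)[symmetric] by (rule \<beta>(2))
      show "trace0 (two_valued S \<rho> \<sigma>)" "\<rho> \<noteq> 0" "S \<noteq> UNIV" using \<zeta>(1) \<rho> S(2) by simp_all
    qed blast
    then show ?thesis unfolding \<zeta>_def by blast
  qed
  \<comment> \<open>By \<open>shift\<close> with \<open>T = S\<close> the class does not depend on the choice of the adapted element.\<close>
  define F where "F = (\<lambda>(H, H'). reparam `` {geo (SOME g. adapted W W' r H H' g)})"
  have F: "F (H, H') = reparam `` {geo g}"
    if H: "H \<in> metric_classes W" "H' \<in> metric_classes W'" and g: "adapted W W' r H H' g" for H H' g
  proof -
    define g1 where "g1 = (SOME g. adapted W W' r H H' g)"
    have g1: "adapted W W' r H H' g1" unfolding g1_def using g by (rule someI)
    note a = g[unfolded adapted_iff[OF H]] and a1 = g1[unfolded adapted_iff[OF H]]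
    have "\<exists>s. \<forall>t. line g \<zeta> t = line g1 (two_valued S \<rho> \<sigma>) (s + t)"
      by (rule shift) (use a a1 in auto)
    then obtain s where s: "\<And>t. line g \<zeta> t = line g1 \<zeta> (s + t)" unfolding \<zeta>_def by blast
    have "reparam `` {line g1 \<zeta>} = reparam `` {line g \<zeta>}"
      by (rule reparam_lines[of g \<zeta> _ 1 s]) (use a a1 s tr kn in \<open>simp_all add: geodesic_line add.commute\<close>)
    then show ?thesis by (simp add: F_def g1_def[symmetric] geo)
  qed
  have inj: "inj_on F (metric_classes W \<times> metric_classes W')"
  proof (rule inj_onI, clarify)
    fix H1 H1' H2 H2'
    assume H: "H1 \<in> metric_classes W" "H1' \<in> metric_classes W'" "H2 \<in> metric_classes W" "H2' \<in> metric_classes W'"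
      and eq: "F (H1, H1') = F (H2, H2')"
    obtain g1 g2 where g1: "adapted W W' r H1 H1' g1" and g2: "adapted W W' r H2 H2' g2"
      using ex[OF H(1,2)] ex[OF H(3,4)] by blast
    note a1 = g1[unfolded adapted_iff[OF H(1,2)]] and a2 = g2[unfolded adapted_iff[OF H(3,4)]]
    have "reparam `` {line g1 \<zeta>} = reparam `` {line g2 \<zeta>}"
      using eq F[OF H(1,2) g1] F[OF H(3,4) g2] by (simp add: geo)
    then have "(line g1 \<zeta>, line g2 \<zeta>) \<in> reparam"
      using eq_equiv_class_iff[OF reparam_equiv, of "line g1 \<zeta>" "line g2 \<zeta>"] a1 a2 tr kn
      by (simp add: geodesic_line)
    then obtain c d where cd: "line g2 \<zeta> = (\<lambda>t. line g1 \<zeta> (c * t + d))" by (auto simp: reparam_def)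
    have eqs: "line g2 (two_valued S \<rho> \<sigma>) t = line g1 (two_valued S \<rho> \<sigma>) (c * t + d)" for t
      using fun_cong[OF cd, of t] by (simp add: \<zeta>_def)
    have Ws: "(*v) g1 ` coord S = (*v) g2 ` coord S" "(*v) g1 ` coord (- S) = (*v) g2 ` coord (- S)"
      using a1 a2 by simp_all
    have SL: "g1 \<in> SL" "g2 \<in> SL" using a1 a2 by simp_all
    note pr = proportional_of_line_shift[OF SL Ws \<zeta>(1) eqs]
    have "metric_class W (frame_metric g1) = metric_class W (frame_metric g2)"
      by (rule class_of_prop[OF SL]) (use pr(1) a1 in simp)
    moreover have "metric_class W' (frame_metric g1) = metric_class W' (frame_metric g2)"
      by (rule class_of_prop[OF SL]) (use pr(2) a1 in simp)
    ultimately show "H1 = H2 \<and> H1' = H2'" using a1 a2 by simp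
  qed
  have surj: "\<exists>H\<in>metric_classes W. \<exists>H'\<in>metric_classes W'. F (H, H') = reparam `` {\<gamma>}"
    if \<gamma>: "connects W W' \<gamma>" for \<gamma>
  proof -
    obtain v where v: "0 < v" "geodesic_on UNIV v \<gamma>"
      and ends: "(endpoint (\<lambda>t. \<gamma> (t / v)) = z_of W \<and> endpoint (\<lambda>t. \<gamma> (- t / v)) = z_of W') \<or>
        (endpoint (\<lambda>t. \<gamma> (t / v)) = z_of W' \<and> endpoint (\<lambda>t. \<gamma> (- t / v)) = z_of W)"
      using \<gamma> unfolding connects_def Let_def by blast
    obtain h \<xi> where h: "h \<in> SL" "trace0 \<xi>" "knorm \<xi> = v" "\<gamma> = line h \<xi>"
      using v by (rule_tac geodesic_on_UNIV)
    have geod: "geodesic \<gamma>" using v by (auto simp: geodesic_def)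
    \<comment> \<open>An element adapted to any metrics describes \<open>z\<^sub>W\<close> and \<open>z\<^sub>W\<^sub>'\<close> as the ends of one line.\<close>
    have std: "herm_metric V (frame_metric (mat 1))" for V :: "'n cvec set"
      by (rule herm_metric_frame_metric) simp
    obtain g0 where g0: "g0 \<in> SL" "W = (*v) g0 ` coord S" "W' = (*v) g0 ` coord (- S)"
      by (rule ex_adapted_SL[OF std std W W' sum, of S]) (use cardS cardS' r r' in auto)
    \<comment> \<open>The sign \<open>\<epsilon>\<close> records which end of \<open>\<gamma>\<close> is \<open>z\<^sub>W\<close>.\<close>
    have main: ?thesis
      if \<epsilon>: "\<epsilon> = 1 \<or> \<epsilon> = - 1" and e: "endpoint (\<lambda>t. \<gamma> (\<epsilon> * t / v)) = z_of W" "endpoint (\<lambda>t. \<gamma> (- \<epsilon> * t / v)) = z_of W'" for \<epsilon> :: real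
    proof -
      define \<eta> where "\<eta> = (\<epsilon> / v) *\<^sub>R \<xi>"
      have l: "line h \<eta> t = \<gamma> (\<epsilon> * t / v)" "line h (- \<eta>) t = \<gamma> (- \<epsilon> * t / v)" for t
        using line_scale[of h "\<epsilon> / v" \<xi> t] line_scale[of h "- (\<epsilon> / v)" \<xi> t] by (simp_all add: \<eta>_def h(4))
      have \<eta>: "trace0 \<eta>" "knorm \<eta> = 1"
        using \<epsilon> v h by (auto simp: \<eta>_def trace0_scaleR knorm_scaleR)
      have "line h \<eta> = (\<lambda>t. \<gamma> (\<epsilon> * t / v))" "line h (- \<eta>) = (\<lambda>t. \<gamma> (- \<epsilon> * t / v))"
        using l by auto
      then have "endpoint (line h \<eta>) = z_of W" "endpoint (line h (- \<eta>)) = z_of W'" using e by simp_all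
      then obtain T where T: "\<eta> = two_valued T \<rho> \<sigma>" "W = (*v) h ` coord T" "W' = (*v) h ` coord (- T)"
        by (rule line_of_endpoints[OF g0(1) \<zeta> S g0(2,3) h(1) \<eta>])
      define H where "H = metric_class W (frame_metric h)"
      define H' where "H' = metric_class W' (frame_metric h)"
      have H: "H \<in> metric_classes W" "H' \<in> metric_classes W'"
        unfolding H_def H'_def metric_classes_eq using herm_metric_frame_metric[OF h(1)] by blast+
      obtain g where g: "adapted W W' r H H' g" using ex[OF H] by blast
      have a: "g \<in> SL" "W = (*v) g ` coord S" "W' = (*v) g ` coord (- S)"
        "metric_class W (frame_metric h) = metric_class W (frame_metric g)"
        "metric_class W' (frame_metric h) = metric_class W' (frame_metric g)"
        using g[unfolded adapted_iff[OF H]] unfolding H_def H'_def by blast+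
      have "\<exists>s. \<forall>t. line g \<zeta> t = line h (two_valued T \<rho> \<sigma>) (s + t)"
        by (rule shift[OF h(1) T(2,3) a])
      then obtain s where "\<And>t. line g \<zeta> t = line h \<eta> (s + t)" unfolding T(1) by blast
      then have s: "line g \<zeta> t = \<gamma> ((\<epsilon> / v) * t + \<epsilon> * s / v)" for t
        by (simp add: l(1) algebra_simps add_divide_distrib)
      have "reparam `` {\<gamma>} = reparam `` {line g \<zeta>}"
        by (rule reparam_lines[OF _ tr kn geod _ s]) (use a \<epsilon> v in auto)
      then have "F (H, H') = reparam `` {\<gamma>}" using F[OF H g] by (simp add: geo)
      with H show ?thesis by blast
    qed
    show ?thesis using ends main[of 1] main[of "-1"] by auto
  qed
  have "F ` (metric_classes W \<times> metric_classes W') = connecting_classes W W'"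
  proof
    show "F ` (metric_classes W \<times> metric_classes W') \<subseteq> connecting_classes W W'"
    proof clarify
      fix H H' assume H: "H \<in> metric_classes W" "H' \<in> metric_classes W'"
      obtain g where g: "adapted W W' r H H' g" using ex[OF H] by blast
      have "geo g \<in> Collect (connects W W')" using conn[OF g H] by simp
      then show "F (H, H') \<in> connecting_classes W W'"
        unfolding F[OF H g] connecting_classes_def by (rule quotientI)
    qed
    show "connecting_classes W W' \<subseteq> F ` (metric_classes W \<times> metric_classes W')"
    proof
      fix X assume "X \<in> connecting_classes W W'"
      then obtain \<gamma> where \<gamma>: "connects W W' \<gamma>" "X = reparam `` {\<gamma>}"
        unfolding connecting_classes_def quotient_def by blast
      obtain H H' where "H \<in> metric_classes W" "H' \<in> metric_classes W'" "F (H, H') = X"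
        using surj[OF \<gamma>(1)] \<gamma>(2) by blast
      then show "X \<in> F ` (metric_classes W \<times> metric_classes W')" by (metis SigmaI imageI)
    qed
  qed
  with inj have bij: "bij_betw F (metric_classes W \<times> metric_classes W') (connecting_classes W W')"
    by (simp add: bij_betw_def)
  have "connects W W' (geo g)"
    if "herm_metric W h \<and> herm_metric W' h' \<and> adapted W W' r (metric_class W h) (metric_class W' h') g" for h h' g
    using that conn[of "metric_class W h" "metric_class W' h'" g] by (auto simp: metric_classes_eq)
  then show ?thesis
    using ex F bij by (intro conjI exI[of _ F] allI impI ballI) auto
qed

end
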